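(* Let $n \ge 1$ and let $X$ be an (unlabelled) character table of the symmetric group $S_n$. If $n \neq 4$ and $n \neq 6$, then there is a unique way to assign the partitions of $n$ to the rows and to the columns of $X$ so that $X_{\lambda\nu} = \chi^\lambda(\nu)$ for all partitions $\lambda, \nu$ of $n$. If $n = 4$ or $n = 6$, then there are exactly two different such labellings.
   Context: For partitions $\lambda,\nu$ of $n$, $\chi^\lambda$ denotes the ordinary (complex) irreducible character of $S_n$ canonically labelled by $\lambda$ (the character of the Specht module $S^\lambda$, so $\chi^{(n)}$ is trivial), and $\chi^\lambda(\nu)$ is its value on elements of cycle type $\nu$. Let $k$ be the number of partitions of $n$. An (unlabelled) character table of $S_n$ is a $k\times k$ complex matrix whose rows are indexed by the irreducible characters and whose columns are indexed by the conjugacy classes of $S_n$, each listed in some unspecified order, with entries the character values. A labelling of $X$ is a pair $(\alpha,\beta)$, where $\alpha$ is a bijection from the set of rows of $X$ to the set of partitions of $n$ and $\beta$ is a bijection from the set of columns of $X$ to the set of partitions of $n$, such that $X_{ij} = \chi^{\alpha(i)}(\beta(j))$ for all rows $i$ and columns $j$. In the claim, $X_{\lambda\nu}$ denotes the entry in the row labelled $\lambda$ and the column labelled $\nu$. *)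

theory Defs
  imports
    "HOL-Algebra.Sym_Groups"
    "HOL-Algebra.Group_Action"
    "HOL-Combinatorics.Orbits"
    "HOL-Library.Function_Algebras"
    "Jordan_Normal_Form.Matrix"
begin

section \<open>Complex representations and characters\<close>

text \<open>
  Complex vector spaces are rendered as subspaces of the space of all functions
  \<^typ>\<open>'b \<Rightarrow> complex\<close>, with pointwise operations.
\<close>

definition cscale :: "complex \<Rightarrow> ('b \<Rightarrow> complex) \<Rightarrow> 'b \<Rightarrow> complex" where
  "cscale c f = (\<lambda>x. c * f x)"

global_interpretation cfun: vector_space cscale
  by unfold_locales (auto simp: cscale_def fun_eq_iff algebra_simps)

definition linear_rep ::
    "('g, 'm) monoid_scheme \<Rightarrow> ('b \<Rightarrow> complex) set \<Rightarrow> ('g \<Rightarrow> ('b \<Rightarrow> complex) \<Rightarrow> 'b \<Rightarrow> complex) \<Rightarrow> bool" where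
  "linear_rep G V \<rho> \<longleftrightarrow>
     (\<exists>B. finite B \<and> cfun.span B = V) \<and>
     (\<forall>g\<in>carrier G. \<forall>v\<in>V. \<rho> g v \<in> V) \<and>
     (\<forall>g\<in>carrier G. \<forall>v\<in>V. \<forall>w\<in>V. \<rho> g (v + w) = \<rho> g v + \<rho> g w) \<and>
     (\<forall>g\<in>carrier G. \<forall>c. \<forall>v\<in>V. \<rho> g (cscale c v) = cscale c (\<rho> g v)) \<and>
     (\<forall>v\<in>V. \<rho> \<one>\<^bsub>G\<^esub> v = v) \<and>
     (\<forall>g\<in>carrier G. \<forall>h\<in>carrier G. \<forall>v\<in>V. \<rho> (g \<otimes>\<^bsub>G\<^esub> h) v = \<rho> g (\<rho> h v))"

definition irreducible_rep ::
    "('g, 'm) monoid_scheme \<Rightarrow> ('b \<Rightarrow> complex) set \<Rightarrow> ('g \<Rightarrow> ('b \<Rightarrow> complex) \<Rightarrow> 'b \<Rightarrow> complex) \<Rightarrow> bool" where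
  "irreducible_rep G V \<rho> \<longleftrightarrow>
     linear_rep G V \<rho> \<and> V \<noteq> {0} \<and>
     (\<forall>W. cfun.subspace W \<and> W \<subseteq> V \<and> (\<forall>g\<in>carrier G. \<forall>w\<in>W. \<rho> g w \<in> W) \<longrightarrow> W = {0} \<or> W = V)"

text \<open>The trace of a linear endomorphism of a finite-dimensional space \<open>V\<close>; the choice of basis is immaterial.\<close>

definition trace_on :: "('b \<Rightarrow> complex) set \<Rightarrow> (('b \<Rightarrow> complex) \<Rightarrow> 'b \<Rightarrow> complex) \<Rightarrow> complex" where
  "trace_on V f =
     (let B = (SOME B. cfun.independent B \<and> cfun.span B = V)
      in \<Sum>b\<in>B. cfun.representation B (f b) b)"

definition rep_character ::
    "('b \<Rightarrow> complex) set \<Rightarrow> ('g \<Rightarrow> ('b \<Rightarrow> complex) \<Rightarrow> 'b \<Rightarrow> complex) \<Rightarrow> 'g \<Rightarrow> complex" where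
  "rep_character V \<rho> g = trace_on V (\<rho> g)"

text \<open>
  Every finite-dimensional complex representation is isomorphic to one on a subspace of
  \<^typ>\<open>nat \<Rightarrow> complex\<close>, so restricting to these loses no characters.  Characters are made
  extensional on \<open>carrier G\<close>, so that equal characters are equal functions.
\<close>

definition irreducible_characters :: "('g, 'm) monoid_scheme \<Rightarrow> ('g \<Rightarrow> complex) set" where
  "irreducible_characters G =
     {restrict (rep_character V \<rho>) (carrier G) | (V :: (nat \<Rightarrow> complex) set) \<rho>. irreducible_rep G V \<rho>}"

definition conjugacy_classes :: "('g, 'm) monoid_scheme \<Rightarrow> 'g set set" where
  "conjugacy_classes G =
     orbits G (carrier G) (\<lambda>g. \<lambda>h\<in>carrier G. g \<otimes>\<^bsub>G\<^esub> h \<otimes>\<^bsub>G\<^esub> inv\<^bsub>G\<^esub> g)"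

text \<open>
  The orderings of the characters (by \<open>\<psi>\<close>) and classes (by \<open>C\<close>) are existentially quantified:
  the table itself carries no labels.
\<close>

definition is_character_table :: "('g, 'm) monoid_scheme \<Rightarrow> complex mat \<Rightarrow> bool" where
  "is_character_table G X \<longleftrightarrow>
     (\<exists>\<psi> C. bij_betw \<psi> {..<dim_row X} (irreducible_characters G) \<and>
            bij_betw C {..<dim_col X} (conjugacy_classes G) \<and>
            (\<forall>i<dim_row X. \<forall>j<dim_col X. \<forall>g\<in>C j. X $$ (i, j) = \<psi> i g))"

section \<open>Partitions and Specht modules\<close>

definition partitions_of :: "nat \<Rightarrow> nat list set" where
  "partitions_of n = {\<mu>. sorted_wrt (\<ge>) \<mu> \<and> 0 \<notin> set \<mu> \<and> sum_list \<mu> = n}"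

definition cycle_type :: "nat \<Rightarrow> (nat \<Rightarrow> nat) \<Rightarrow> nat list" where
  "cycle_type n p =
     rev (sorted_list_of_multiset (image_mset card (mset_set (Orbits.orbit p ` {1..n}))))"

text \<open>
  A tableau of shape \<open>\<mu>\<close> is the list of its rows; its entries are \<open>1, \<dots>, n\<close>, each occurring
  once.  Tabloids are row-equivalence classes of tableaux.
\<close>

definition tableaux :: "nat list \<Rightarrow> nat list list set" where
  "tableaux \<mu> = {t. map length t = \<mu> \<and> distinct (concat t) \<and> set (concat t) = {1..sum_list \<mu>}}"

definition tabloid :: "nat list \<Rightarrow> nat list list \<Rightarrow> nat list list set" where
  "tabloid \<mu> t = {s \<in> tableaux \<mu>. map set s = map set t}"

definition column :: "nat list list \<Rightarrow> nat \<Rightarrow> nat set" where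
  "column t j = {r ! j | r. r \<in> set t \<and> j < length r}"

definition column_stabilizer :: "nat list \<Rightarrow> nat list list \<Rightarrow> (nat \<Rightarrow> nat) set" where
  "column_stabilizer \<mu> t = {p. p permutes {1..sum_list \<mu>} \<and> (\<forall>j. p ` column t j = column t j)}"

text \<open>
  The permutation module \<open>M\<^sup>\<mu>\<close> with basis the tabloids of shape \<open>\<mu>\<close> is the space of
  complex functions supported on these tabloids; the basis vector of a tabloid is its indicator function.
\<close>

definition tabloid_vector :: "nat list list set \<Rightarrow> nat list list set \<Rightarrow> complex" where
  "tabloid_vector T = (\<lambda>S. if S = T then 1 else 0)"

definition polytabloid :: "nat list \<Rightarrow> nat list list \<Rightarrow> nat list list set \<Rightarrow> complex" where
  "polytabloid \<mu> t =
     (\<Sum>p\<in>column_stabilizer \<mu> t. cscale (of_int (sign p)) (tabloid_vector (tabloid \<mu> (map (map p) t))))"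

definition specht_module :: "nat list \<Rightarrow> (nat list list set \<Rightarrow> complex) set" where
  "specht_module \<mu> = cfun.span (polytabloid \<mu> ` tableaux \<mu>)"

text \<open>
  The linear action of a permutation \<open>p\<close> that sends the basis vector of \<open>T\<close> to that of \<open>p T\<close>.
\<close>

definition tabloid_action ::
    "(nat \<Rightarrow> nat) \<Rightarrow> (nat list list set \<Rightarrow> complex) \<Rightarrow> nat list list set \<Rightarrow> complex" where
  "tabloid_action p f = (\<lambda>T. f ((\<lambda>t. map (map (Hilbert_Choice.inv p)) t) ` T))"

definition specht_character :: "nat list \<Rightarrow> (nat \<Rightarrow> nat) \<Rightarrow> complex" where
  "specht_character \<mu> = rep_character (specht_module \<mu>) tabloid_action"

text \<open>The value \<open>\<chi>\<^sup>\<mu>(\<nu>)\<close>; it does not depend on the chosen element of cycle type \<open>\<nu>\<close>.\<close>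

definition chi :: "nat list \<Rightarrow> nat list \<Rightarrow> complex" where
  "chi \<mu> \<nu> =
     specht_character \<mu> (SOME p. p \<in> carrier (sym_group (sum_list \<nu>)) \<and> cycle_type (sum_list \<nu>) p = \<nu>)"

text \<open>
  Labellings are pairs of functions that are extensional on the row and column indices, so
  that the set below counts labellings correctly.
\<close>

definition labellings :: "nat \<Rightarrow> complex mat \<Rightarrow> ((nat \<Rightarrow> nat list) \<times> (nat \<Rightarrow> nat list)) set" where
  "labellings n X =
     {(\<alpha>, \<beta>). \<alpha> \<in> extensional {..<dim_row X} \<and> bij_betw \<alpha> {..<dim_row X} (partitions_of n) \<and>
              \<beta> \<in> extensional {..<dim_col X} \<and> bij_betw \<beta> {..<dim_col X} (partitions_of n) \<and>
              (\<forall>i<dim_row X. \<forall>j<dim_col X. X $$ (i, j) = chi (\<alpha> i) (\<beta> j))}"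

end

theory Submission
  imports Defs "Jordan_Normal_Form.Determinant"
begin

text \<open>
  The Specht modules are irreducible with scalar endomorphisms and pairwise different characters, and the
  permutations of a given cycle type are nonempty unions of classes; since the table is square, this already
  forces every irreducible character to be a Specht character and every cycle type to be a single class.  So a
  labelling exists.

  Two labellings of \<open>X\<close> differ by a relabelling \<open>\<tau>\<close> of the cycle types which, by the orthogonality relations,
  preserves the identity and all class multiplication constants.  The class of transpositions is recognised by
  two properties: products of two of its elements lie in at most three classes, and never in the class itself.
  Apart from it only the four-cycles in degree 4 and the fixed-point-free involutions in degree 6 have them.  If
  \<open>\<tau>\<close> fixes the transpositions, it preserves the relation "differ by multiplication with a transposition", that is,
  splitting or joining two cycles, and induction on the number of cycles shows that \<open>\<tau>\<close> is trivial, because a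
  cycle type is almost determined by the types into which it splits.  In degrees 4 and 6 the second possibility
  for the image of the transpositions does occur: in degree 6 by the outer automorphism, in degree 4 because every
  irreducible character takes the same value up to sign on transpositions and on four-cycles.
\<close>

section \<open>Orthogonality relations\<close>

text \<open>Relabellings preserve structure because everything relevant can be read off the bare
  matrix. A permutation and its inverse have the same cycle type, so the orthogonality relations
  need no complex conjugation. The identity column is the only column of positive integers, class
  sizes come from the sums of squares of the columns, and the class multiplication numbers are
  rational expressions in the entries of three columns and the identity column. The obstacle in the
  induction on splitting: {3, 1, 1^k} and {2, 2, 1^k} split into exactly the same types, and so do
  {4, 1, 1^k} and {3, 2, 1^k}. Adjacency alone cannot separate them; multiplicities can. Into one
  common type, the first member of each pair is split by at least three transpositions, the second
  by at most two. In degrees 4 and 6 there are no more than two labellings: once one labelling is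
  fixed, every other labelling must put the transpositions at the column to which the fixed one
  gives the exceptional type, and the place of the transpositions decides the labelling.\<close>

definition lin_on :: "('b \<Rightarrow> complex) set \<Rightarrow> (('b \<Rightarrow> complex) \<Rightarrow> 'c \<Rightarrow> complex) \<Rightarrow> bool" where
  "lin_on V f \<longleftrightarrow> (\<forall>v\<in>V. \<forall>w\<in>V. f (v + w) = f v + f w) \<and> (\<forall>c. \<forall>v\<in>V. f (cscale c v) = cscale c (f v))"

definition basis_of :: "('b \<Rightarrow> complex) set \<Rightarrow> ('b \<Rightarrow> complex) set" where
  "basis_of V = (SOME B. cfun.independent B \<and> cfun.span B = V)"

definition coord :: "('b \<Rightarrow> complex) set \<Rightarrow> ('b \<Rightarrow> complex) \<Rightarrow> ('b \<Rightarrow> complex) \<Rightarrow> complex" where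
  "coord V b v = cfun.representation (basis_of V) v b"

lemma trace_on_coord: "trace_on V f = (\<Sum>b\<in>basis_of V. coord V b (f b))"
  by (simp add: trace_on_def basis_of_def coord_def Let_def)

lemma cscale_simps [simp]:
  "cscale a (cscale b v) = cscale (a * b) v" "cscale 1 v = v" "cscale 0 v = 0" "cscale a 0 = 0"
  by (auto simp: cscale_def fun_eq_iff)

lemma sum_fun_apply: "(\<Sum>a\<in>A. f a) x = (\<Sum>a\<in>A. (f a x :: complex))"
  by (induction A rule: infinite_finite_induct) auto

section \<open>Coordinates and traces in finitely spanned spaces\<close>

locale fin_dim =
  fixes V :: "('b \<Rightarrow> complex) set"
  assumes fin_dim: "\<exists>B. finite B \<and> cfun.span B = V"
begin

lemma subspace: "cfun.subspace V"
  using fin_dim by auto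

lemma basis: "cfun.independent (basis_of V)" "cfun.span (basis_of V) = V"
proof -
  obtain B where "B \<subseteq> V" "cfun.independent B" "V \<subseteq> cfun.span B"
    using cfun.maximal_independent_subset by blast
  then have "cfun.independent B \<and> cfun.span B = V"
    using cfun.span_subspace subspace by blast
  then have "cfun.independent (basis_of V) \<and> cfun.span (basis_of V) = V"
    unfolding basis_of_def by (rule someI)
  then show "cfun.independent (basis_of V)" "cfun.span (basis_of V) = V" by auto
qed

lemma finite_basis: "finite (basis_of V)"
proof -
  obtain B where B: "finite B" "cfun.span B = V" using fin_dim by blast
  show ?thesis
    using cfun.independent_span_bound[OF B(1) basis(1)] B(2) basis(2) cfun.span_superset by blast
qed

lemma basis_subset: "basis_of V \<subseteq> V"
  using basis(2) cfun.span_superset by blast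

lemma expand: "v \<in> V \<Longrightarrow> (\<Sum>b\<in>basis_of V. cscale (coord V b v) b) = v"
  unfolding coord_def using basis finite_basis
  by (intro cfun.sum_representation_eq) auto

lemma coord_sum: 
  "(\<And>i. i \<in> I \<Longrightarrow> x i \<in> V) \<Longrightarrow> coord V b (\<Sum>i\<in>I. cscale (c i) (x i)) = (\<Sum>i\<in>I. c i * coord V b (x i))"
  unfolding coord_def using basis subspace
  by (subst cfun.representation_sum) (auto simp: cfun.representation_scale cfun.subspace_scale)

lemma coord_basis: "a \<in> basis_of V \<Longrightarrow> coord V b a = (if b = a then 1 else 0)"
  unfolding coord_def using cfun.representation_basis[OF basis(1)] by auto

lemma coord_scale: "v \<in> V \<Longrightarrow> coord V b (cscale c v) = c * coord V b v"
  unfolding coord_def using basis by (simp add: cfun.representation_scale)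

lemma coord_0: "coord V b 0 = 0"
  by (simp add: coord_def cfun.representation_zero)

lemma sum_mem: "(\<And>i. i \<in> I \<Longrightarrow> x i \<in> V) \<Longrightarrow> (\<Sum>i\<in>I. cscale (c i) (x i)) \<in> V"
  by (intro cfun.subspace_sum[OF subspace] cfun.subspace_scale[OF subspace])

lemma lin_zero: "lin_on V f \<Longrightarrow> f 0 = 0"
  by (metis lin_on_def cfun.subspace_0[OF subspace] cfun.scale_zero_left)

lemma lin_sum:
  assumes f: "lin_on V f" and x: "\<And>i. i \<in> I \<Longrightarrow> x i \<in> V"
  shows "f (\<Sum>i\<in>I. cscale (c i) (x i)) = (\<Sum>i\<in>I. cscale (c i) (f (x i)))"
  using x
proof (induction I rule: infinite_finite_induct)
  case (insert i I)
  have "cscale (c i) (x i) \<in> V" "(\<Sum>i\<in>I. cscale (c i) (x i)) \<in> V"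
    using insert.prems by (auto intro!: sum_mem cfun.subspace_scale[OF subspace])
  then have "f (cscale (c i) (x i) + (\<Sum>i\<in>I. cscale (c i) (x i))) = cscale (c i) (f (x i)) + f (\<Sum>i\<in>I. cscale (c i) (x i))"
    using insert.prems f unfolding lin_on_def by (metis insertI1)
  also have "f (\<Sum>i\<in>I. cscale (c i) (x i)) = (\<Sum>i\<in>I. cscale (c i) (f (x i)))" using insert by blast
  finally show ?case unfolding sum.insert[OF insert.hyps] .
qed (simp_all add: lin_zero[OF f])

lemma coord_lin: 
  assumes "lin_on V f" "f ` V \<subseteq> W" "fin_dim W" "v \<in> V"
  shows "coord W c (f v) = (\<Sum>b\<in>basis_of V. coord V b v * coord W c (f b))"
proof -
  have "f v = (\<Sum>b\<in>basis_of V. cscale (coord V b v) (f b))"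
    using lin_sum[OF assms(1), of "basis_of V" "\<lambda>b. b" "\<lambda>b. coord V b v"] expand[OF assms(4)] basis_subset by auto
  then show ?thesis
    using fin_dim.coord_sum[OF assms(3), of "basis_of V" f c "\<lambda>b. coord V b v"] assms(2) basis_subset by auto
qed

lemma ne_basis: "V \<noteq> {0} \<Longrightarrow> basis_of V \<noteq> {}"
  using basis(2) by auto

end

text \<open>Cyclicity of the trace: the trace of T f T^-1 is written as a double sum over both
  bases, the sums are exchanged, and T^-1 T = id is put back in. Here \<open>s\<close> gives the
  preimages of the basis of W.\<close>

lemma trace_on_iso:
  assumes "fin_dim V" "fin_dim W" and T: "lin_on V T" "inj_on T V" "T ` V = W"
    and f: "lin_on V f" "f ` V \<subseteq> V" and f': "\<And>v. v \<in> V \<Longrightarrow> f' (T v) = T (f v)"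
  shows "trace_on W f' = trace_on V f"
proof -
  interpret V: fin_dim V by fact
  interpret W: fin_dim W by fact
  define s where "s c = inv_into V T c" for c
  have s: "s c \<in> V" "T (s c) = c" if "c \<in> basis_of W" for c
  proof -
    have "c \<in> T ` V" using that W.basis_subset T(3) by blast
    then show "s c \<in> V" "T (s c) = c" unfolding s_def by (rule inv_into_into, rule f_inv_into_f)
  qed
  have b: "(\<Sum>c\<in>basis_of W. cscale (coord W c (T b)) (s c)) = b" if "b \<in> basis_of V" for b
  proof (rule inj_onD[OF T(2)])
    show bV: "b \<in> V" using that V.basis_subset by blast
    show "(\<Sum>c\<in>basis_of W. cscale (coord W c (T b)) (s c)) \<in> V" using s by (intro V.sum_mem) auto
    have "T (\<Sum>c\<in>basis_of W. cscale (coord W c (T b)) (s c)) = (\<Sum>c\<in>basis_of W. cscale (coord W c (T b)) (T (s c)))"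
      using s by (intro V.lin_sum[OF T(1)]) auto
    also have "\<dots> = (\<Sum>c\<in>basis_of W. cscale (coord W c (T b)) c)" using s by auto
    also have "\<dots> = T b" using T(3) bV by (intro W.expand) auto
    finally show "T (\<Sum>c\<in>basis_of W. cscale (coord W c (T b)) (s c)) = T b" .
  qed
  have "trace_on W f' = (\<Sum>c\<in>basis_of W. coord W c (T (f (s c))))"
    unfolding trace_on_coord by (intro sum.cong refl) (metis s f')
  also have "\<dots> = (\<Sum>c\<in>basis_of W. \<Sum>b\<in>basis_of V. coord V b (f (s c)) * coord W c (T b))"
    using s(1) f(2) T(3) by (intro sum.cong refl V.coord_lin[OF T(1) _ W.fin_dim_axioms]) blast+
  also have "\<dots> = (\<Sum>b\<in>basis_of V. \<Sum>c\<in>basis_of W. coord W c (T b) * coord V b (f (s c)))"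
    by (subst sum.swap) (simp add: mult.commute)
  also have "\<dots> = (\<Sum>b\<in>basis_of V. coord V b (f (\<Sum>c\<in>basis_of W. cscale (coord W c (T b)) (s c))))"
  proof (intro sum.cong refl)
    fix b
    have "f (\<Sum>c\<in>basis_of W. cscale (coord W c (T b)) (s c)) = (\<Sum>c\<in>basis_of W. cscale (coord W c (T b)) (f (s c)))"
      using s by (intro V.lin_sum[OF f(1)]) auto
    then show "(\<Sum>c\<in>basis_of W. coord W c (T b) * coord V b (f (s c))) = coord V b (f (\<Sum>c\<in>basis_of W. cscale (coord W c (T b)) (s c)))"
      using V.coord_sum[of "basis_of W" "\<lambda>c. f (s c)" b "\<lambda>c. coord W c (T b)"] s(1) f(2)
      by (metis (no_types, lifting) image_subset_iff)
  qed
  also have "\<dots> = trace_on V f" unfolding trace_on_coord using b by auto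
  finally show ?thesis .
qed

lemma linear_repD:
  assumes "linear_rep G V \<rho>"
  shows "fin_dim V" "g \<in> carrier G \<Longrightarrow> v \<in> V \<Longrightarrow> \<rho> g v \<in> V" "g \<in> carrier G \<Longrightarrow> lin_on V (\<rho> g)"
    "v \<in> V \<Longrightarrow> \<rho> \<one>\<^bsub>G\<^esub> v = v"
    "g \<in> carrier G \<Longrightarrow> h \<in> carrier G \<Longrightarrow> v \<in> V \<Longrightarrow> \<rho> (g \<otimes>\<^bsub>G\<^esub> h) v = \<rho> g (\<rho> h v)"
  using assms by (auto simp: linear_rep_def fin_dim_def lin_on_def)

section \<open>Averaging over a finite group\<close>

definition intertwiners ::
  "('g, 'm) monoid_scheme \<Rightarrow> ('b \<Rightarrow> complex) set \<Rightarrow> ('g \<Rightarrow> ('b \<Rightarrow> complex) \<Rightarrow> 'b \<Rightarrow> complex) \<Rightarrow>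
   ('c \<Rightarrow> complex) set \<Rightarrow> ('g \<Rightarrow> ('c \<Rightarrow> complex) \<Rightarrow> 'c \<Rightarrow> complex) \<Rightarrow> (('b \<Rightarrow> complex) \<Rightarrow> 'c \<Rightarrow> complex) set" where
  "intertwiners G V \<rho> W \<sigma> =
     {f. lin_on V f \<and> f ` V \<subseteq> W \<and> (\<forall>g\<in>carrier G. \<forall>v\<in>V. f (\<rho> g v) = \<sigma> g (f v))}"

locale finite_group = group G for G (structure) +
  assumes finite_carrier: "finite (carrier G)"
begin

text \<open>The group average of \<rho>(g) E \<sigma>(g^-1), without normalisation, for the rank-one
  map E that sends w to its j-coordinate times the vector i.\<close>

definition average where
  "average V \<rho> W \<sigma> i j w = (\<Sum>g\<in>carrier G. cscale (coord W j (\<sigma> (inv g) w)) (\<rho> g i))"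

lemma average_intertwiner:
  assumes V: "linear_rep G V \<rho>" and W: "linear_rep G W \<sigma>" and i: "i \<in> V"
  shows "average V \<rho> W \<sigma> i j \<in> intertwiners G W \<sigma> V \<rho>"
proof -
  interpret V: fin_dim V by (rule linear_repD(1)[OF V])
  interpret W: fin_dim W by (rule linear_repD(1)[OF W])
  note V' = linear_repD[OF V] and W' = linear_repD[OF W]
  have "average V \<rho> W \<sigma> i j (v + w) = average V \<rho> W \<sigma> i j v + average V \<rho> W \<sigma> i j w" if "v \<in> W" "w \<in> W" for v w
  proof -
    have "coord W j (\<sigma> (inv g) (v + w)) = coord W j (\<sigma> (inv g) v) + coord W j (\<sigma> (inv g) w)" if g: "g \<in> carrier G" for g
    proof -
      have "\<sigma> (inv g) (v + w) = \<sigma> (inv g) v + \<sigma> (inv g) w" using W'(3)[of "inv g"] g \<open>v \<in> W\<close> \<open>w \<in> W\<close> by (auto simp: lin_on_def)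
      then show ?thesis using W'(2)[of "inv g"] g \<open>v \<in> W\<close> \<open>w \<in> W\<close> W.basis 
        by (simp add: coord_def cfun.representation_add)
    qed
    then show ?thesis unfolding average_def by (simp add: cfun.scale_left_distrib sum.distrib)
  qed
  moreover have "average V \<rho> W \<sigma> i j (cscale c w) = cscale c (average V \<rho> W \<sigma> i j w)" if "w \<in> W" for c w
  proof -
    have "coord W j (\<sigma> (inv g) (cscale c w)) = c * coord W j (\<sigma> (inv g) w)" if g: "g \<in> carrier G" for g
    proof -
      have "\<sigma> (inv g) (cscale c w) = cscale c (\<sigma> (inv g) w)" using W'(3)[of "inv g"] g \<open>w \<in> W\<close> by (auto simp: lin_on_def)
      then show ?thesis using W'(2)[of "inv g"] g \<open>w \<in> W\<close> W.coord_scale by simp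
    qed
    then show ?thesis unfolding average_def by (simp add: cfun.scale_sum_right)
  qed
  moreover have "average V \<rho> W \<sigma> i j ` W \<subseteq> V"
    using V'(2) i unfolding average_def by (auto intro!: V.sum_mem)
  moreover have "average V \<rho> W \<sigma> i j (\<sigma> h w) = \<rho> h (average V \<rho> W \<sigma> i j w)" if h: "h \<in> carrier G" and w: "w \<in> W" for h w
  proof -
    \<comment> \<open>Replacing g by h g moves h out of the sum.\<close>
    have "average V \<rho> W \<sigma> i j (\<sigma> h w) = (\<Sum>g\<in>carrier G. cscale (coord W j (\<sigma> (inv (h \<otimes> g)) (\<sigma> h w))) (\<rho> (h \<otimes> g) i))"
      unfolding average_def
      by (rule sum.reindex_bij_betw[symmetric, of "\<lambda>g. h \<otimes> g"])
         (use h in \<open>auto intro!: bij_betwI[of _ _ _ "\<lambda>g. inv h \<otimes> g"] simp: m_assoc[symmetric]\<close>)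
    also have "\<dots> = (\<Sum>g\<in>carrier G. cscale (coord W j (\<sigma> (inv g) w)) (\<rho> h (\<rho> g i)))"
    proof (intro sum.cong refl)
      fix g assume g: "g \<in> carrier G"
      have "\<sigma> (inv (h \<otimes> g)) (\<sigma> h w) = \<sigma> (inv (h \<otimes> g) \<otimes> h) w" using g h w W'(5) by simp
      also have "inv (h \<otimes> g) \<otimes> h = inv g" using g h by (simp add: inv_mult_group m_assoc)
      finally show "cscale (coord W j (\<sigma> (inv (h \<otimes> g)) (\<sigma> h w))) (\<rho> (h \<otimes> g) i) = cscale (coord W j (\<sigma> (inv g) w)) (\<rho> h (\<rho> g i))"
        using V'(5) g h i by simp
    qed
    also have "\<dots> = \<rho> h (average V \<rho> W \<sigma> i j w)" unfolding average_def
      using V'(2,3) h i by (subst V.lin_sum) auto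
    finally show ?thesis .
  qed
  ultimately show ?thesis by (auto simp: intertwiners_def lin_on_def)
qed

lemma coord_average:
  assumes "linear_rep G V \<rho>" "i \<in> V"
  shows "coord V k (average V \<rho> W \<sigma> i j w) = (\<Sum>g\<in>carrier G. coord W j (\<sigma> (inv g) w) * coord V k (\<rho> g i))"
  unfolding average_def using linear_repD[OF assms(1)] assms(2)
  by (subst fin_dim.coord_sum) auto

text \<open>Expanded in matrix coefficients, the sum is a total of coordinates of averaged rank-one
  maps. These are intertwiners, hence zero by assumption.\<close>

lemma character_orthogonal:
  assumes V: "linear_rep G V \<rho>" and W: "linear_rep G W \<sigma>"
    and 0: "\<And>f w. f \<in> intertwiners G W \<sigma> V \<rho> \<Longrightarrow> w \<in> W \<Longrightarrow> f w = 0"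
  shows "(\<Sum>g\<in>carrier G. rep_character V \<rho> g * rep_character W \<sigma> (inv g)) = 0"
proof -
  interpret V: fin_dim V by (rule linear_repD(1)[OF V])
  interpret W: fin_dim W by (rule linear_repD(1)[OF W])
  have "(\<Sum>g\<in>carrier G. rep_character V \<rho> g * rep_character W \<sigma> (inv g)) =
      (\<Sum>g\<in>carrier G. \<Sum>i\<in>basis_of V. \<Sum>j\<in>basis_of W. coord W j (\<sigma> (inv g) j) * coord V i (\<rho> g i))"
    by (simp add: rep_character_def trace_on_coord sum_product mult.commute)
  also have "\<dots> = (\<Sum>i\<in>basis_of V. \<Sum>j\<in>basis_of W. \<Sum>g\<in>carrier G. coord W j (\<sigma> (inv g) j) * coord V i (\<rho> g i))"
    by (subst sum.swap, rule sum.cong[OF refl], rule sum.swap)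
  also have "\<dots> = (\<Sum>i\<in>basis_of V. \<Sum>j\<in>basis_of W. coord V i (average V \<rho> W \<sigma> i j j))"
    using V.basis_subset by (intro sum.cong refl) (subst coord_average[OF V], auto)
  also have "\<dots> = 0"
    using 0[OF average_intertwiner[OF V W]] V.basis_subset W.basis_subset
    by (intro sum.neutral ballI) (auto simp: subset_iff V.coord_0)
  finally show ?thesis .
qed

end

text \<open>The conclusion of Schur's lemma is part of the locale. For Specht modules it is verified
  directly by the column antisymmetrizer, so no existence of eigenvalues enters.\<close>

locale absolutely_irreducible = finite_group +
  fixes V \<rho>
  assumes rep: "linear_rep G V \<rho>" and nonzero: "V \<noteq> {0}"
    and scalars: "\<And>f. f \<in> intertwiners G V \<rho> V \<rho> \<Longrightarrow> \<exists>c. \<forall>v\<in>V. f v = cscale c v"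
begin

sublocale fin_dim V by (rule linear_repD(1)[OF rep])

abbreviation "\<chi> \<equiv> rep_character V \<rho>"
abbreviation "B \<equiv> basis_of V"
definition "R g a b = coord V a (\<rho> g b)"

lemma chi_R: "\<chi> g = (\<Sum>b\<in>B. R g b b)"
  by (simp add: rep_character_def trace_on_coord R_def)

lemma R_mult:
  assumes "g \<in> carrier G" "h \<in> carrier G" "b \<in> B"
  shows "R (g \<otimes> h) a b = (\<Sum>c\<in>B. R g a c * R h c b)"
proof -
  have "b \<in> V" using assms basis_subset by blast
  then have "R (g \<otimes> h) a b = coord V a (\<rho> g (\<rho> h b))" unfolding R_def using linear_repD(5)[OF rep] assms by simp
  also have "\<dots> = (\<Sum>c\<in>B. R g a c * R h c b)"
    using coord_lin[of "\<rho> g" V "\<rho> h b"] linear_repD(2,3)[OF rep] assms \<open>b \<in> V\<close> 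
    by (auto simp: R_def mult.commute fin_dim_axioms image_subset_iff)
  finally show ?thesis .
qed

lemma R_one: "a \<in> B \<Longrightarrow> b \<in> B \<Longrightarrow> R \<one> a b = (if a = b then 1 else 0)"
  unfolding R_def using linear_repD(4)[OF rep] basis_subset coord_basis by (simp add: subset_iff)

definition "d = (of_nat (card B) :: complex)"

lemma d_nonzero: "d \<noteq> 0"
  unfolding d_def using finite_basis ne_basis[OF nonzero] by simp

lemma chi_one: "\<chi> \<one> = d"
  by (simp add: chi_R R_one d_def)

text \<open>The averaged rank-one map is a scalar c, whose matrix coefficients are these sums. Its
  trace determines c.\<close>

lemma schur_coefficients:
  assumes "i \<in> B" "j \<in> B" "k \<in> B" "l \<in> B"
  shows "(\<Sum>g\<in>carrier G. R (inv g) j l * R g k i) = (if i = j \<and> k = l then of_nat (Coset.order G) / d else 0)"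
proof -
  have iV: "i \<in> V" using assms basis_subset by blast
  obtain c where c: "\<And>v. v \<in> V \<Longrightarrow> average V \<rho> V \<rho> i j v = cscale c v"
    using scalars[OF average_intertwiner[OF rep rep iV]] by blast
  have eq: "(\<Sum>g\<in>carrier G. R (inv g) j l * R g k i) = (if k = l then c else 0)" if "k \<in> B" "l \<in> B" for k l
  proof -
    have lV: "l \<in> V" using that basis_subset by blast
    have "(\<Sum>g\<in>carrier G. R (inv g) j l * R g k i) = coord V k (average V \<rho> V \<rho> i j l)"
      by (simp add: coord_average[OF rep iV] R_def)
    also have "\<dots> = (if k = l then c else 0)" using c[OF lV] that lV by (simp add: coord_scale coord_basis)
    finally show ?thesis .
  qed
  \<comment> \<open>Summing over k = l collapses the products of coefficients to those of g^-1 g =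
    1.\<close>
  have "c * d = (\<Sum>k\<in>B. \<Sum>g\<in>carrier G. R (inv g) j k * R g k i)" using eq by (simp add: d_def mult.commute)
  also have "\<dots> = (\<Sum>g\<in>carrier G. R (inv g \<otimes> g) j i)"
  proof (subst sum.swap, intro sum.cong refl)
    fix g assume "g \<in> carrier G"
    then show "(\<Sum>k\<in>B. R (inv g) j k * R g k i) = R (inv g \<otimes> g) j i" using R_mult[of "inv g" g i j] assms by simp
  qed
  also have "\<dots> = (if i = j then of_nat (Coset.order G) else 0)" using assms by (simp add: R_one Coset.order_def)
  finally have "c = (if i = j then of_nat (Coset.order G) / d else 0)" using d_nonzero by (simp add: field_simps split: if_splits)
  then show ?thesis using eq[OF assms(3,4)] by auto
qed

lemma character_norm: "(\<Sum>g\<in>carrier G. \<chi> g * \<chi> (inv g)) = of_nat (Coset.order G)"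
proof -
  have "(\<Sum>g\<in>carrier G. \<chi> g * \<chi> (inv g)) = (\<Sum>g\<in>carrier G. \<Sum>i\<in>B. \<Sum>j\<in>B. R (inv g) j j * R g i i)"
    by (simp add: chi_R sum_product mult.commute)
  also have "\<dots> = (\<Sum>i\<in>B. \<Sum>j\<in>B. \<Sum>g\<in>carrier G. R (inv g) j j * R g i i)"
    by (subst sum.swap, rule sum.cong[OF refl], rule sum.swap)
  also have "\<dots> = (\<Sum>i\<in>B. \<Sum>j\<in>B. if i = j then of_nat (Coset.order G) / d else 0)"
    by (intro sum.cong refl) (subst schur_coefficients, auto)
  also have "\<dots> = of_nat (Coset.order G)" using d_nonzero finite_basis by (simp add: d_def)
  finally show ?thesis .
qed

text \<open>The matrices of all conjugates of y add up to the scalar |G| \<chi>(y) / \<chi>(1), here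
  computed on coefficients. This identity is the source of the class multiplication numbers.\<close>

lemma character_conjugate_average:
  assumes x: "x \<in> carrier G" and y: "y \<in> carrier G"
  shows "(\<Sum>z\<in>carrier G. \<chi> (x \<otimes> (z \<otimes> y \<otimes> inv z))) = of_nat (Coset.order G) * \<chi> x * \<chi> y / \<chi> \<one>"
proof -
  \<comment> \<open>The two factors containing z are kept together as
    \<open>R (inv z) e a * R z b c\<close>, the form that \<open>schur_coefficients\<close>
    evaluates.\<close>
  have "\<chi> (x \<otimes> (z \<otimes> y \<otimes> inv z)) =
      (\<Sum>a\<in>B. \<Sum>b\<in>B. \<Sum>e\<in>B. \<Sum>c\<in>B. R x a b * R y c e * (R (inv z) e a * R z b c))" if z: "z \<in> carrier G" for z
    using x y z by (simp add: chi_R R_mult sum_distrib_left sum_distrib_right mult_ac)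
  then have "(\<Sum>z\<in>carrier G. \<chi> (x \<otimes> (z \<otimes> y \<otimes> inv z))) =
      (\<Sum>z\<in>carrier G. \<Sum>a\<in>B. \<Sum>b\<in>B. \<Sum>e\<in>B. \<Sum>c\<in>B. R x a b * R y c e * (R (inv z) e a * R z b c))" by simp
  also have "\<dots> = (\<Sum>a\<in>B. \<Sum>b\<in>B. \<Sum>e\<in>B. \<Sum>c\<in>B. R x a b * R y c e * (\<Sum>z\<in>carrier G. R (inv z) e a * R z b c))"
    unfolding sum_distrib_left
    by (subst sum.swap, rule sum.cong[OF refl], subst sum.swap, rule sum.cong[OF refl],
        subst sum.swap, rule sum.cong[OF refl], rule sum.swap)
  also have "\<dots> = (\<Sum>a\<in>B. \<Sum>b\<in>B. \<Sum>e\<in>B. \<Sum>c\<in>B. R x a b * R y c e * (if c = e \<and> b = a then of_nat (Coset.order G) / d else 0))"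
    by (intro sum.cong refl arg_cong2[where f = "(*)"] schur_coefficients)
  also have "\<dots> = (\<Sum>a\<in>B. \<Sum>b\<in>B. if b = a then (\<Sum>e\<in>B. R x a a * R y e e * of_nat (Coset.order G) / d) else 0)"
    using finite_basis by (intro sum.cong refl) (auto simp: if_distrib sum.If_cases cong: if_cong)
  also have "\<dots> = (\<Sum>a\<in>B. \<Sum>e\<in>B. R x a a * R y e e * of_nat (Coset.order G) / d)"
    using finite_basis by simp
  also have "\<dots> = of_nat (Coset.order G) * \<chi> x * \<chi> y / \<chi> \<one>"
    unfolding chi_one by (simp add: chi_R sum_product sum_divide_distrib sum_distrib_left mult_ac)
  finally show ?thesis .
qed

end

section \<open>Specht modules\<close>

abbreviation act :: "(nat \<Rightarrow> nat) \<Rightarrow> nat list list \<Rightarrow> nat list list" where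
  "act p t \<equiv> map (map p) t"

definition row_of :: "nat list list \<Rightarrow> nat \<Rightarrow> nat" where
  "row_of t x = (THE i. i < length t \<and> x \<in> set (t ! i))"

definition col_of :: "nat list list \<Rightarrow> nat \<Rightarrow> nat" where
  "col_of t x = (THE j. \<exists>i<length t. j < length (t ! i) \<and> t ! i ! j = x)"

lemma distinct_concat_position:
  assumes "distinct (concat t)" "i < length t" "j < length (t ! i)" "i' < length t" "j' < length (t ! i')" "t ! i ! j = t ! i' ! j'"
  shows "i = i' \<and> j = j'"
  using assms
proof (induction t arbitrary: i i')
  case (Cons r t)
  have disj: "set r \<inter> set (concat t) = {}" using Cons.prems by auto
  have mem: "t ! k ! l \<in> set (concat t)" if "k < length t" "l < length (t ! k)" for k l
    using that by (auto intro!: bexI[of _ "t ! k"])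
  show ?case
  proof (cases i)
    case 0
    show ?thesis
    proof (cases i')
      case 0
      then show ?thesis using Cons.prems \<open>i = 0\<close> by (simp add: nth_eq_iff_index_eq)
    next
      case (Suc k)
      have "r ! j \<in> set r" using Cons.prems \<open>i = 0\<close> by (intro nth_mem) simp
      moreover have "t ! k ! j' \<in> set (concat t)" using Cons.prems Suc by (intro mem) simp_all
      moreover have "r ! j = t ! k ! j'" using Cons.prems \<open>i = 0\<close> Suc by simp
      ultimately show ?thesis using disj by (metis disjoint_iff)
    qed
  next
    case (Suc m)
    show ?thesis
    proof (cases i')
      case 0
      have "r ! j' \<in> set r" using Cons.prems 0 by (intro nth_mem) simp
      moreover have "t ! m ! j \<in> set (concat t)" using Cons.prems \<open>i = Suc m\<close> by (intro mem) simp_all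
      moreover have "t ! m ! j = r ! j'" using Cons.prems \<open>i = Suc m\<close> 0 by simp
      ultimately show ?thesis using disj by (metis disjoint_iff)
    next
      case (Suc k)
      then show ?thesis using Cons.prems \<open>i = Suc m\<close> Cons.IH[of m k] by auto
    qed
  qed
qed simp

lemma row_of_eq:
  assumes "distinct (concat t)" "i < length t" "x \<in> set (t ! i)"
  shows "row_of t x = i"
  unfolding row_of_def
proof (rule the_equality)
  show "k = i" if "k < length t \<and> x \<in> set (t ! k)" for k
    using that assms distinct_concat_position[OF assms(1)] by (metis in_set_conv_nth)
qed (use assms in auto)

lemma col_of_eq:
  assumes "distinct (concat t)" "i < length t" "j < length (t ! i)"
  shows "col_of t (t ! i ! j) = j"
  unfolding col_of_def
proof (rule the_equality)
  show "k = j" if "\<exists>l<length t. k < length (t ! l) \<and> t ! l ! k = t ! i ! j" for k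
    using that assms distinct_concat_position[OF assms(1)] by metis
qed (use assms in auto)

lemma finite_tableaux: "finite (tableaux \<mu>)"
proof (rule finite_subset)
  show "tableaux \<mu> \<subseteq> {t. set t \<subseteq> {r. set r \<subseteq> {1..sum_list \<mu>} \<and> length r \<le> sum_list \<mu>} \<and> length t \<le> length \<mu>}"
  proof
    fix t assume "t \<in> tableaux \<mu>"
    then have t: "map length t = \<mu>" "set (concat t) = {1..sum_list \<mu>}" by (simp_all add: tableaux_def)
    have "set r \<subseteq> {1..sum_list \<mu>} \<and> length r \<le> sum_list \<mu>" if r: "r \<in> set t" for r
    proof
      show "set r \<subseteq> {1..sum_list \<mu>}" unfolding t(2)[symmetric] using r by auto
      have "length r \<in> set \<mu>" unfolding t(1)[symmetric] using r by simp
      then show "length r \<le> sum_list \<mu>" by (rule member_le_sum_list) simp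
    qed
    moreover have "length t \<le> length \<mu>" unfolding t(1)[symmetric] by simp
    ultimately show "t \<in> {t. set t \<subseteq> {r. set r \<subseteq> {1..sum_list \<mu>} \<and> length r \<le> sum_list \<mu>} \<and> length t \<le> length \<mu>}"
      by blast
  qed
  show "finite {t. set t \<subseteq> {r. set r \<subseteq> {1..sum_list \<mu>} \<and> length r \<le> sum_list \<mu>} \<and> length t \<le> length \<mu>}"
    by (intro finite_lists_length_le) auto
qed

locale tableau =
  fixes n :: nat and \<mu> :: "nat list" and t :: "nat list list"
  assumes \<mu>: "\<mu> \<in> partitions_of n" and t: "t \<in> tableaux \<mu>"
begin

lemma sum_mu: "sum_list \<mu> = n" using \<mu> by (simp add: partitions_of_def)

lemma len: "map length t = \<mu>" and dist: "distinct (concat t)" and set_t: "set (concat t) = {1..n}"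
  using t by (auto simp: tableaux_def sum_mu)

lemma length_t: "length t = length \<mu>" using len by auto

lemma length_row: "i < length t \<Longrightarrow> length (t ! i) = \<mu> ! i"
  using len by auto

lemma position:
  assumes "x \<in> {1..n}"
  obtains i j where "i < length t" "j < length (t ! i)" "x = t ! i ! j" "row_of t x = i" "col_of t x = j"
proof -
  have "x \<in> set (concat t)" using assms set_t by simp
  then obtain r where "r \<in> set t" "x \<in> set r" by auto
  then obtain i j where ij: "i < length t" "j < length (t ! i)" "x = t ! i ! j" by (metis in_set_conv_nth)
  then have "row_of t x = i" "col_of t x = j" using row_of_eq[OF dist] col_of_eq[OF dist] by auto
  then show ?thesis using that ij by blast
qed

lemma position_mem: "i < length t \<Longrightarrow> j < length (t ! i) \<Longrightarrow> t ! i ! j \<in> {1..n}"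
  unfolding set_t[symmetric] by (auto intro!: bexI[of _ "t ! i"])

lemma row_of_nth: "i < length t \<Longrightarrow> j < length (t ! i) \<Longrightarrow> row_of t (t ! i ! j) = i"
  using row_of_eq[OF dist] by simp

lemma row_col_inj: "x \<in> {1..n} \<Longrightarrow> y \<in> {1..n} \<Longrightarrow> row_of t x = row_of t y \<Longrightarrow> col_of t x = col_of t y \<Longrightarrow> x = y"
  by (metis position)

lemma set_row: "i < length t \<Longrightarrow> set (t ! i) = {x\<in>{1..n}. row_of t x = i}"
  using position_mem row_of_nth by (auto simp: in_set_conv_nth) (metis position atLeastAtMost_iff One_nat_def)+

lemma column_eq: "column t j = {x\<in>{1..n}. col_of t x = j}"
proof (intro Set.set_eqI iffI)
  fix x assume "x \<in> column t j"
  then obtain i where "i < length t" "j < length (t ! i)" "x = t ! i ! j"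
    by (auto simp: column_def in_set_conv_nth)
  then show "x \<in> {x\<in>{1..n}. col_of t x = j}" using position_mem col_of_eq[OF dist] by auto
next
  fix x assume "x \<in> {x\<in>{1..n}. col_of t x = j}"
  then obtain i where "i < length t" "j < length (t ! i)" "x = t ! i ! j" by (metis (mono_tags, lifting) mem_Collect_eq position)
  then show "x \<in> column t j" unfolding column_def by (auto intro!: exI[of _ "t ! i"])
qed

text \<open>Row lengths weakly decrease, so a column has no gap above any of its entries.\<close>

lemma column_closed:
  assumes "x \<in> {1..n}" "i < row_of t x"
  obtains y where "y \<in> {1..n}" "col_of t y = col_of t x" "row_of t y = i"
proof -
  obtain k j where k: "k < length t" "j < length (t ! k)" "x = t ! k ! j" "row_of t x = k" "col_of t x = j"
    using position[OF assms(1)] by metis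
  have "i < length t" using k assms(2) by simp
  have "\<mu> ! k \<le> \<mu> ! i"
    using \<mu> assms(2) k length_t sorted_wrt_nth_less[of "(\<ge>)" \<mu> i k] by (auto simp: partitions_of_def)
  then have "j < length (t ! i)" using k length_row \<open>i < length t\<close> by simp
  then show ?thesis
    using that[OF position_mem] col_of_eq[OF dist] row_of_nth \<open>i < length t\<close> k by auto
qed

text \<open>Turns pointwise comparisons of \<open>row_of\<close> into comparisons of partial sums,
  that is, into the dominance order of shapes.\<close>

lemma card_rows: "card {x\<in>{1..n}. row_of t x < k} = sum_list (take k \<mu>)"
proof -
  have "{x\<in>{1..n}. row_of t x < k} = set (concat (take k t))"
  proof (intro Set.set_eqI iffI)
    fix x assume x: "x \<in> {x\<in>{1..n}. row_of t x < k}"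
    then obtain i j where "i < length t" "j < length (t ! i)" "x = t ! i ! j" "row_of t x = i"
      using position by (metis (no_types, lifting) mem_Collect_eq)
    then have "t ! i \<in> set (take k t)" "x \<in> set (t ! i)" using x by (auto simp: in_set_conv_nth)
    then show "x \<in> set (concat (take k t))" by auto
  next
    fix x assume "x \<in> set (concat (take k t))"
    then obtain r where "r \<in> set (take k t)" "x \<in> set r" by auto
    then obtain i where "i < k" "i < length t" "x \<in> set (t ! i)" unfolding in_set_conv_nth[of r] by auto
    then show "x \<in> {x\<in>{1..n}. row_of t x < k}" using set_row by auto
  qed
  moreover have "distinct (concat (take k t))"
    using dist by (metis append_take_drop_id concat_append distinct_append)
  ultimately have "card {x\<in>{1..n}. row_of t x < k} = length (concat (take k t))"
    by (metis distinct_card)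
  also have "\<dots> = sum_list (take k \<mu>)" using len by (auto simp: length_concat take_map)
  finally show ?thesis .
qed

lemma colstab_iff:
  "p \<in> column_stabilizer \<mu> t \<longleftrightarrow> p permutes {1..n} \<and> (\<forall>x\<in>{1..n}. col_of t (p x) = col_of t x)"
proof
  assume "p \<in> column_stabilizer \<mu> t"
  then have p: "p permutes {1..n}" "\<And>j. p ` column t j = column t j" by (auto simp: column_stabilizer_def sum_mu)
  then show "p permutes {1..n} \<and> (\<forall>x\<in>{1..n}. col_of t (p x) = col_of t x)" unfolding column_eq by blast
next
  assume p: "p permutes {1..n} \<and> (\<forall>x\<in>{1..n}. col_of t (p x) = col_of t x)"
  then have 1: "p permutes {1..n}" and 2: "\<And>x. x \<in> {1..n} \<Longrightarrow> col_of t (p x) = col_of t x" by auto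
  have mem: "p x \<in> {1..n} \<longleftrightarrow> x \<in> {1..n}" for x using permutes_in_image[OF 1] by auto
  have "p ` column t j = column t j" for j
  proof
    show "p ` column t j \<subseteq> column t j" unfolding column_eq using mem 2 by blast
    show "column t j \<subseteq> p ` column t j"
    proof
      fix y assume y: "y \<in> column t j"
      have "p (inv' p y) = y" using 1 by (simp add: permutes_inverses)
      then have "inv' p y \<in> column t j" using y mem[of "inv' p y"] 2[of "inv' p y"] unfolding column_eq by auto
      then show "y \<in> p ` column t j" using \<open>p (inv' p y) = y\<close> by force
    qed
  qed
  then show "p \<in> column_stabilizer \<mu> t" using 1 by (simp add: column_stabilizer_def sum_mu)
qed

lemma colstab_permutes: "p \<in> column_stabilizer \<mu> t \<Longrightarrow> p permutes {1..n}"
  using colstab_iff by simp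

lemma finite_colstab: "finite (column_stabilizer \<mu> t)"
  by (rule finite_subset[OF _ finite_permutations[of "{1..n}"]]) (auto dest: colstab_permutes)

lemma id_colstab: "id \<in> column_stabilizer \<mu> t"
  by (simp add: colstab_iff permutes_id)

lemma comp_colstab:
  assumes "p \<in> column_stabilizer \<mu> t" "q \<in> column_stabilizer \<mu> t"
  shows "p \<circ> q \<in> column_stabilizer \<mu> t"
  using assms permutes_in_image[of q "{1..n}"] unfolding colstab_iff by (auto intro: permutes_compose simp del: atLeastAtMost_iff)

lemma inv_colstab:
  assumes "p \<in> column_stabilizer \<mu> t"
  shows "inv' p \<in> column_stabilizer \<mu> t"
proof -
  have p: "p permutes {1..n}" "\<And>x. x \<in> {1..n} \<Longrightarrow> col_of t (p x) = col_of t x" using assms colstab_iff by auto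
  have "col_of t (inv' p x) = col_of t x" if "x \<in> {1..n}" for x
    using p(2)[of "inv' p x"] that permutes_in_image[OF permutes_inv[OF p(1)]] permutes_inverses(1)[OF p(1)] by metis
  then show ?thesis using p permutes_inv colstab_iff by blast
qed

lemma act_tableau: 
  assumes "p permutes {1..n}" shows "tableau n \<mu> (act p t)"
proof
  have "distinct (map p (concat t))" using dist permutes_inj_on[OF assms] by (simp add: distinct_map)
  moreover have "set (map p (concat t)) = {1..n}" unfolding set_map set_t using assms by (simp add: permutes_image)
  ultimately show "act p t \<in> tableaux \<mu>"
    unfolding tableaux_def mem_Collect_eq sum_mu map_concat by (simp add: len comp_def)
qed (rule \<mu>)

lemma row_act:
  assumes p: "p permutes {1..n}" and x: "x \<in> {1..n}"
  shows "row_of (act p t) (p x) = row_of t x"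
proof -
  interpret a: tableau n \<mu> "act p t" by (rule act_tableau[OF p])
  obtain i j where "i < length t" "j < length (t ! i)" "x = t ! i ! j" "row_of t x = i" using position[OF x] by metis
  then show ?thesis using a.row_of_nth[of i j] by simp
qed

end

lemma tabloid_eq_iff:
  assumes "t \<in> tableaux \<mu>"
  shows "tabloid \<mu> t = tabloid \<mu> s \<longleftrightarrow> map set t = map set s"
  using assms by (auto simp: tabloid_def)

lemma tabloid_eqI:
  assumes "tableau n \<mu> t" "tableau n \<mu> s" "\<And>x. x \<in> {1..n} \<Longrightarrow> row_of t x = row_of s x"
  shows "tabloid \<mu> t = tabloid \<mu> s"
proof -
  interpret t: tableau n \<mu> t by fact
  interpret s: tableau n \<mu> s by fact
  have "map set t = map set s"
    by (rule nth_equalityI) (use t.length_t s.length_t t.set_row s.set_row assms(3) in auto)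
  then show ?thesis by (simp add: tabloid_def)
qed

lemma row_of_tabloid:
  assumes "tableau n \<mu> t" "tableau n \<mu> s" "tabloid \<mu> t = tabloid \<mu> s" "x \<in> {1..n}"
  shows "row_of t x = row_of s x"
proof -
  interpret t: tableau n \<mu> t by fact
  interpret s: tableau n \<mu> s by fact
  have eq: "map set t = map set s" using assms(3) tabloid_eq_iff[OF t.t] by simp
  obtain i j where ij: "i < length t" "j < length (t ! i)" "x = t ! i ! j" "row_of t x = i" using t.position[OF assms(4)] by metis
  have "set (t ! i) = set (s ! i)" using eq ij(1) by (metis length_map nth_map)
  moreover have "x \<in> set (t ! i)" "i < length s" using ij t.length_t s.length_t by simp_all
  ultimately have "x \<in> set (s ! i)" "i < length s" by simp_all
  then show ?thesis using row_of_eq[OF s.dist] ij(4) by metis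
qed

section \<open>Sorting the columns of a tableau\<close>

lemma rank_bij:
  fixes f :: "'a \<Rightarrow> nat"
  assumes "finite K" "inj_on f K"
  shows "bij_betw (\<lambda>y. card {z\<in>K. f z < f y}) K {..<card K}"
proof -
  have inj: "inj_on (\<lambda>y. card {z\<in>K. f z < f y}) K"
  proof (rule inj_onI)
    have lt: "card {z\<in>K. f z < f x} < card {z\<in>K. f z < f y}" if "x \<in> K" "f x < f y" for x y
      using that assms(1) by (intro psubset_card_mono psubsetI) auto
    fix x y assume "x \<in> K" "y \<in> K" "card {z\<in>K. f z < f x} = card {z\<in>K. f z < f y}"
    then show "x = y" using lt[of x y] lt[of y x] inj_onD[OF assms(2), of x y] by (cases "f x" "f y" rule: linorder_cases) auto
  qed
  have sub: "(\<lambda>y. card {z\<in>K. f z < f y}) ` K \<subseteq> {..<card K}"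
    using assms(1) by (auto intro!: psubset_card_mono)
  show ?thesis unfolding bij_betw_def
    using inj card_subset_eq[OF _ sub] card_image[OF inj] by auto
qed

text \<open>\<open>f\<close> maps the elements below y injectively into the naturals below
  \<open>f y\<close>.\<close>

lemma rank_le:
  fixes f :: "'a \<Rightarrow> nat"
  assumes "inj_on f K"
  shows "card {z\<in>K. f z < f y} \<le> f y"
proof -
  have "card {z\<in>K. f z < f y} = card (f ` {z\<in>K. f z < f y})"
    by (rule card_image[symmetric]) (use assms in \<open>auto simp: inj_on_def\<close>)
  also have "\<dots> \<le> card {..<f y}" by (rule card_mono) auto
  finally show ?thesis by simp
qed

text \<open>The witness sorts every column of \<open>t\<close> by \<open>f\<close>: an entry ends up in the row given by its rank, which is at most its \<open>f\<close>-value.\<close>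

lemma (in tableau) sort_columns:
  assumes inj: "\<And>x y. x \<in> {1..n} \<Longrightarrow> y \<in> {1..n} \<Longrightarrow> col_of t x = col_of t y \<Longrightarrow> f x = f y \<Longrightarrow> x = y"
  obtains p where "p \<in> column_stabilizer \<mu> t" "\<And>x. x \<in> {1..n} \<Longrightarrow> row_of (act p t) x \<le> f x"
proof -
  define K where "K c = {x\<in>{1..n}. col_of t x = c}" for c
  define rk where "rk g x = card {z\<in>K (col_of t x). g z < (g x :: nat)}" for g x
  have finK: "finite (K c)" for c by (simp add: K_def)
  have rk_bij: "bij_betw (rk g) (K c) {..<card (K c)}" if "inj_on g (K c)" for g c
  proof -
    have b: "bij_betw (\<lambda>y. card {z\<in>K c. g z < g y}) (K c) {..<card (K c)}" by (rule rank_bij[OF finK that])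
    have e: "card {z\<in>K c. g z < g y} = rk g y" if "y \<in> K c" for y using that by (simp add: rk_def K_def)
    show ?thesis by (rule iffD1[OF bij_betw_cong[OF e] b])
  qed
  have f_inj: "inj_on f (K c)" for c unfolding K_def inj_on_def using inj by blast
  have r_inj: "inj_on (row_of t) (K c)" for c unfolding K_def inj_on_def using row_col_inj by blast
  \<comment> \<open>By \<open>column_closed\<close> all smaller rows occur in the column, so ranking
    by row returns the row itself.\<close>
  have rk_row: "rk (row_of t) x = row_of t x" if x: "x \<in> {1..n}" for x
  proof -
    have "row_of t ` {z\<in>K (col_of t x). row_of t z < row_of t x} = {..<row_of t x}"
    proof
      show "{..<row_of t x} \<subseteq> row_of t ` {z\<in>K (col_of t x). row_of t z < row_of t x}"
      proof
        fix i assume "i \<in> {..<row_of t x}"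
        then obtain y where "y \<in> {1..n}" "col_of t y = col_of t x" "row_of t y = i" using column_closed[OF x] by auto
        then show "i \<in> row_of t ` {z\<in>K (col_of t x). row_of t z < row_of t x}"
          using \<open>i \<in> {..<row_of t x}\<close> by (intro image_eqI[of _ _ y]) (auto simp: K_def)
      qed
    qed auto
    moreover have "inj_on (row_of t) {z\<in>K (col_of t x). row_of t z < row_of t x}"
      by (rule inj_on_subset[OF r_inj]) auto
    ultimately show ?thesis unfolding rk_def by (metis card_image card_lessThan)
  qed
  \<comment> \<open>The position of x receives the entry of the same column whose
    \<open>f\<close>-rank is the row of x.\<close>
  define p where "p x = (if x \<in> {1..n} then inv_into (K (col_of t x)) (rk f) (row_of t x) else x)" for x
  have p: "p x \<in> K (col_of t x)" "rk f (p x) = row_of t x" if x: "x \<in> {1..n}" for x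
  proof -
    have "x \<in> K (col_of t x)" using x by (simp add: K_def)
    then have "rk (row_of t) x \<in> {..<card (K (col_of t x))}" using rk_bij[OF r_inj] bij_betw_apply by metis
    then have "row_of t x \<in> rk f ` K (col_of t x)" 
      using rk_row[OF x] rk_bij[OF f_inj] by (simp add: bij_betw_def)
    then show "p x \<in> K (col_of t x)" "rk f (p x) = row_of t x" unfolding p_def using x 
      by (auto intro: inv_into_into simp: f_inv_into_f)
  qed
  have pn: "p x \<in> {1..n}" and pc: "col_of t (p x) = col_of t x" if "x \<in> {1..n}" for x
    using p(1)[OF that] by (auto simp: K_def)
  have "inj_on p {1..n}"
  proof (rule inj_onI)
    fix x y assume xy: "x \<in> {1..n}" "y \<in> {1..n}" "p x = p y"
    then have "row_of t x = row_of t y" "col_of t x = col_of t y" using p(2) pc by metis+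
    then show "x = y" using row_col_inj xy by blast
  qed
  moreover have "p ` {1..n} \<subseteq> {1..n}" using pn by blast
  ultimately have "bij_betw p {1..n} {1..n}" by (simp add: bij_betw_def endo_inj_surj)
  then have perm: "p permutes {1..n}" by (rule bij_imp_permutes) (auto simp: p_def)
  moreover have "row_of (act p t) x \<le> f x" if "x \<in> {1..n}" for x
  proof -
    have "x \<in> p ` {1..n}" using that permutes_image[OF perm] by simp
    then obtain y where y: "y \<in> {1..n}" "x = p y" by blast
    have "row_of (act p t) x = rk f x" using row_act[OF perm y(1)] p(2)[OF y(1)] y(2) by simp
    also have "\<dots> \<le> f x" unfolding rk_def by (rule rank_le[OF f_inj])
    finally show ?thesis .
  qed
  ultimately show ?thesis using that colstab_iff pc by blast
qed

subsection \<open>The column antisymmetrizer\<close>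

lemma act_comp: "act (p \<circ> q) t = act p (act q t)"
  by simp

lemma tabloid_action_linear:
  "tabloid_action p (f + g) = tabloid_action p f + tabloid_action p g"
  "tabloid_action p (cscale c f) = cscale c (tabloid_action p f)"
  by (auto simp: tabloid_action_def cscale_def fun_eq_iff)

lemma tabloid_action_0: "tabloid_action p 0 = 0"
  by (auto simp: tabloid_action_def fun_eq_iff)

lemma tabloid_action_sum: "tabloid_action p (\<Sum>i\<in>I. f i) = (\<Sum>i\<in>I. tabloid_action p (f i))"
  by (induction I rule: infinite_finite_induct) (simp_all only: sum.infinite sum.empty sum.insert tabloid_action_0 tabloid_action_linear simp_thms)

lemma tabloid_action_id: "tabloid_action id f = f"
  by (simp add: tabloid_action_def fun_eq_iff)

text \<open>Functions are pulled back along the inverse, which makes this a left action.\<close>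

lemma tabloid_action_comp:
  assumes "bij p" "bij q"
  shows "tabloid_action (p \<circ> q) f = tabloid_action p (tabloid_action q f)"
proof -
  have "act (inv' (p \<circ> q)) = act (inv' q) \<circ> act (inv' p)"
    using assms by (simp add: o_inv_distrib fun_eq_iff)
  then show ?thesis unfolding tabloid_action_def by (simp only: image_comp[symmetric])
qed

lemma tabloid_action_vector:
  assumes "bij p"
  shows "tabloid_action p (tabloid_vector T) = tabloid_vector (act p ` T)"
proof -
  have 1: "act (inv' p) ` act p ` S = S" "act p ` act (inv' p) ` S = S" for S
    using assms by (simp_all add: image_image bij_is_inj bij_is_surj surj_f_inv_f comp_def map_idI)
  then have "act (inv' p) ` S = T \<longleftrightarrow> S = act p ` T" for S by metis
  then show ?thesis by (simp add: tabloid_action_def tabloid_vector_def fun_eq_iff)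
qed

lemma tabloid_act:
  assumes "tableau n \<mu> t" and p: "p permutes {1..n}"
  shows "act p ` tabloid \<mu> t = tabloid \<mu> (act p t)"
proof -
  interpret t: tableau n \<mu> t by fact
  have sub: "act q ` tabloid \<mu> s \<subseteq> tabloid \<mu> (act q s)" if q: "q permutes {1..n}" for q s
  proof clarify
    fix u assume u: "u \<in> tabloid \<mu> s"
    then have "tableau n \<mu> u" by (simp add: tableau_def t.\<mu> tabloid_def)
    then have "act q u \<in> tableaux \<mu>" using q tableau.act_tableau tableau.t by blast
    moreover have "map (image q) (map set u) = map (image q) (map set s)" using u by (simp add: tabloid_def)
    ultimately show "act q u \<in> tabloid \<mu> (act q s)" by (simp add: tabloid_def comp_def)
  qed
  have pi: "act p (act (inv' p) s) = s" "act (inv' p) (act p s) = s" for s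
    using permutes_inverses[OF p] by (simp_all add: comp_def map_idI)
  show ?thesis
  proof
    show "tabloid \<mu> (act p t) \<subseteq> act p ` tabloid \<mu> t"
    proof
      fix s assume "s \<in> tabloid \<mu> (act p t)"
      then have "act (inv' p) s \<in> tabloid \<mu> t" using sub[OF permutes_inv[OF p], of "act p t"] pi(2)[of t] by (metis imageI subsetD)
      then show "s \<in> act p ` tabloid \<mu> t" by (metis imageI pi(1))
    qed
  qed (rule sub[OF p])
qed

lemma tabloid_action_tabloid:
  assumes "tableau n \<mu> t" "p permutes {1..n}"
  shows "tabloid_action p (tabloid_vector (tabloid \<mu> t)) = tabloid_vector (tabloid \<mu> (act p t))"
  using tabloid_action_vector[OF permutes_bij[OF assms(2)]] tabloid_act[OF assms] by simp

text \<open>The signed sum over the column stabilizer of t, as an operator. Nothing ties f to the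
  shape \<mu>: comparing different shapes requires applying it to tabloids of another shape.\<close>

definition kappa :: "nat list \<Rightarrow> nat list list \<Rightarrow> (nat list list set \<Rightarrow> complex) \<Rightarrow> nat list list set \<Rightarrow> complex" where
  "kappa \<mu> t f = (\<Sum>p\<in>column_stabilizer \<mu> t. cscale (of_int (sign p)) (tabloid_action p f))"

lemma kappa_scale: "kappa \<mu> t (cscale c f) = cscale c (kappa \<mu> t f)"
  unfolding kappa_def by (simp add: tabloid_action_linear cfun.scale_sum_right mult.commute)

lemma kappa_sum: "kappa \<mu> t (\<Sum>i\<in>I. f i) = (\<Sum>i\<in>I. kappa \<mu> t (f i))"
  unfolding kappa_def by (subst sum.swap) (simp only: tabloid_action_sum cfun.scale_sum_right)

context tableau
begin

lemma perm: "p \<in> column_stabilizer \<mu> t \<Longrightarrow> permutation p" "p \<in> column_stabilizer \<mu> t \<Longrightarrow> bij p"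
  using colstab_permutes permutation_permutes permutes_bij by blast+

lemma polytabloid_kappa: "polytabloid \<mu> t = kappa \<mu> t (tabloid_vector (tabloid \<mu> t))"
  unfolding polytabloid_def kappa_def
  using tabloid_action_tabloid[OF tableau_axioms colstab_permutes] by simp

lemma sign_sq: "(of_int (sign p) * of_int (sign p) :: complex) = 1"
  by (simp add: sign_def)

text \<open>Right translation by q permutes the column stabilizer and multiplies every sign by
  \<open>sign q\<close>; left translation gives \<open>action_kappa\<close>.\<close>

lemma kappa_action:
  assumes q: "q \<in> column_stabilizer \<mu> t"
  shows "kappa \<mu> t (tabloid_action q f) = cscale (of_int (sign q)) (kappa \<mu> t f)"
proof -
  have "kappa \<mu> t f = (\<Sum>p\<in>column_stabilizer \<mu> t. cscale (of_int (sign (p \<circ> q))) (tabloid_action (p \<circ> q) f))"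
    unfolding kappa_def
    by (rule sum.reindex_bij_betw[symmetric], rule bij_betwI[of _ _ _ "\<lambda>p. p \<circ> inv' q"])
       (use q comp_colstab inv_colstab perm(2)[OF q] in \<open>auto simp: comp_assoc bij_is_inj bij_is_surj surj_iff[THEN iffD1]\<close>)
  also have "\<dots> = (\<Sum>p\<in>column_stabilizer \<mu> t. cscale (of_int (sign q)) (cscale (of_int (sign p)) (tabloid_action p (tabloid_action q f))))"
    using q perm by (intro sum.cong refl) (simp add: sign_compose tabloid_action_comp mult.commute)
  also have "\<dots> = cscale (of_int (sign q)) (kappa \<mu> t (tabloid_action q f))"
    unfolding kappa_def by (simp only: cfun.scale_sum_right)
  finally show ?thesis by (simp add: sign_sq)
qed

lemma action_kappa:
  assumes q: "q \<in> column_stabilizer \<mu> t"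
  shows "tabloid_action q (kappa \<mu> t f) = cscale (of_int (sign q)) (kappa \<mu> t f)"
proof -
  have "kappa \<mu> t f = (\<Sum>p\<in>column_stabilizer \<mu> t. cscale (of_int (sign (q \<circ> p))) (tabloid_action (q \<circ> p) f))"
    unfolding kappa_def
    by (rule sum.reindex_bij_betw[symmetric], rule bij_betwI[of _ _ _ "\<lambda>p. inv' q \<circ> p"])
       (use q comp_colstab inv_colstab perm(2)[OF q] in \<open>auto simp: comp_assoc[symmetric] bij_is_inj bij_is_surj surj_iff[THEN iffD1]\<close>)
  also have "\<dots> = (\<Sum>p\<in>column_stabilizer \<mu> t. cscale (of_int (sign q)) (cscale (of_int (sign p)) (tabloid_action q (tabloid_action p f))))"
    using q perm by (intro sum.cong refl) (simp add: sign_compose tabloid_action_comp)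
  also have "\<dots> = cscale (of_int (sign q)) (tabloid_action q (kappa \<mu> t f))"
    unfolding kappa_def by (simp only: cfun.scale_sum_right tabloid_action_sum tabloid_action_linear)
  finally show ?thesis using arg_cong[of _ _ "cscale (of_int (sign q))"] sign_sq by (metis cscale_simps(1,2))
qed

text \<open>By \<open>action_kappa\<close> all summands of the outer sum coincide, since the two
  signs cancel.\<close>

lemma kappa_kappa: "kappa \<mu> t (kappa \<mu> t f) = cscale (of_nat (card (column_stabilizer \<mu> t))) (kappa \<mu> t f)"
proof -
  have "kappa \<mu> t (kappa \<mu> t f) = (\<Sum>p\<in>column_stabilizer \<mu> t. kappa \<mu> t f)"
    unfolding kappa_def[of \<mu> t "kappa \<mu> t f"] by (intro sum.cong refl) (simp add: action_kappa sign_sq)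
  then show ?thesis by (simp only: cfun.sum_constant_scale)
qed

lemma card_colstab: "card (column_stabilizer \<mu> t) \<noteq> 0"
  using finite_colstab id_colstab by auto

text \<open>The transposition of a and b lies in the column stabilizer of t and fixes the tabloid of
  s, so the value equals its own negative.\<close>

lemma kappa_pair:
  assumes s: "tableau n \<nu> s" and ab: "a \<in> {1..n}" "b \<in> {1..n}" "a \<noteq> b" "col_of t a = col_of t b" "row_of s a = row_of s b"
  shows "kappa \<mu> t (tabloid_vector (tabloid \<nu> s)) = 0"
proof -
  interpret s: tableau n \<nu> s by fact
  let ?q = "transpose a b" and ?v = "tabloid_vector (tabloid \<nu> s)"
  have perm: "?q permutes {1..n}" using ab by (auto intro: permutes_swap_id)
  have q: "?q \<in> column_stabilizer \<mu> t" using ab perm by (auto simp: colstab_iff transpose_def)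
  interpret a: tableau n \<nu> "act ?q s" by (rule s.act_tableau[OF perm])
  have "tabloid \<nu> (act ?q s) = tabloid \<nu> s"
  proof (rule tabloid_eqI[OF a.tableau_axioms s])
    fix x assume x: "x \<in> {1..n}"
    have "row_of (act ?q s) (?q (?q x)) = row_of s (?q x)" 
      by (rule s.row_act[OF perm]) (use x permutes_in_image[OF perm] in blast)
    then show "row_of (act ?q s) x = row_of s x" using ab by (auto simp: transpose_def split: if_splits)
  qed
  then have "kappa \<mu> t ?v = cscale (of_int (sign ?q)) (kappa \<mu> t ?v)"
    using kappa_action[OF q, of ?v] tabloid_action_tabloid[OF s perm] by simp
  then have "kappa \<mu> t ?v = cscale (-1) (kappa \<mu> t ?v)" using ab by (simp add: sign_swap_id)
  then show ?thesis by (auto simp: cscale_def fun_eq_iff)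
qed

text \<open>By \<open>kappa_pair\<close>, entries of one column of t lie in different rows of s, so
  the columns of t can be sorted by their row in s.\<close>

lemma kappa_nonzero_sort:
  assumes s: "tableau n \<nu> s" and nz: "kappa \<mu> t (tabloid_vector (tabloid \<nu> s)) \<noteq> 0"
  obtains p where "p \<in> column_stabilizer \<mu> t" "\<And>x. x \<in> {1..n} \<Longrightarrow> row_of (act p t) x \<le> row_of s x"
proof (rule sort_columns[of "row_of s"])
  show "x = y" if "x \<in> {1..n}" "y \<in> {1..n}" "col_of t x = col_of t y" "row_of s x = row_of s y" for x y
    using kappa_pair[OF s that(1,2) _ that(3,4)] nz by auto
qed (use that in auto)

text \<open>After sorting, every entry sits in t at least as high as in s, so the first k rows of
  \<mu> have room for those of \<nu>.\<close>

lemma kappa_dominates: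
  assumes s: "tableau n \<nu> s" and nz: "kappa \<mu> t (tabloid_vector (tabloid \<nu> s)) \<noteq> 0"
  shows "sum_list (take k \<nu>) \<le> sum_list (take k \<mu>)"
proof -
  interpret s: tableau n \<nu> s by fact
  obtain p where p: "p \<in> column_stabilizer \<mu> t" "\<And>x. x \<in> {1..n} \<Longrightarrow> row_of (act p t) x \<le> row_of s x"
    using kappa_nonzero_sort[OF assms] by blast
  interpret a: tableau n \<mu> "act p t" by (rule act_tableau[OF colstab_permutes[OF p(1)]])
  have "card {x\<in>{1..n}. row_of s x < k} \<le> card {x\<in>{1..n}. row_of (act p t) x < k}"
    by (rule card_mono) (use p(2) le_less_trans in \<open>auto\<close>)
  then show ?thesis using s.card_rows a.card_rows by simp
qed

text \<open>For equal shapes, the sorted tableau and s have equally many entries in their first k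
  rows for every k. The one-sided comparison of rows is then an equality, and the tabloid of s is
  that of t moved by a column permutation.\<close>

lemma kappa_multiple:
  assumes s: "tableau n \<mu> s"
  shows "\<exists>c. kappa \<mu> t (tabloid_vector (tabloid \<mu> s)) = cscale c (polytabloid \<mu> t)"
proof (cases "kappa \<mu> t (tabloid_vector (tabloid \<mu> s)) = 0")
  case True
  then show ?thesis by (metis cscale_simps(3))
next
  case False
  interpret s: tableau n \<mu> s by fact
  obtain p where p: "p \<in> column_stabilizer \<mu> t" "\<And>x. x \<in> {1..n} \<Longrightarrow> row_of (act p t) x \<le> row_of s x"
    using kappa_nonzero_sort[OF s False] by blast
  have pp: "p permutes {1..n}" by (rule colstab_permutes[OF p(1)])
  interpret a: tableau n \<mu> "act p t" by (rule act_tableau[OF pp])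
  have eq: "{x\<in>{1..n}. row_of s x < k} = {x\<in>{1..n}. row_of (act p t) x < k}" for k
    by (rule card_subset_eq) (use p(2) le_less_trans s.card_rows a.card_rows in \<open>auto\<close>)
  have "tabloid \<mu> (act p t) = tabloid \<mu> s"
  proof (rule tabloid_eqI[OF a.tableau_axioms s])
    fix x assume "x \<in> {1..n}"
    then have "x \<in> {y\<in>{1..n}. row_of (act p t) y < Suc (row_of (act p t) x)}" by simp
    then have "x \<in> {y\<in>{1..n}. row_of s y < Suc (row_of (act p t) x)}" by (simp only: eq)
    then show "row_of (act p t) x = row_of s x" using p(2)[of x] by simp
  qed
  then have "kappa \<mu> t (tabloid_vector (tabloid \<mu> s)) = cscale (of_int (sign p)) (polytabloid \<mu> t)"
    using kappa_action[OF p(1)] tabloid_action_tabloid[OF tableau_axioms pp] polytabloid_kappa by metis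
  then show ?thesis by blast
qed

text \<open>A permutation preserving every column and every row is the identity, so only one summand
  contributes. In particular polytabloids do not vanish.\<close>

lemma polytabloid_self: "polytabloid \<mu> t (tabloid \<mu> t) = 1"
proof -
  have only_id: "p = id" if p: "p \<in> column_stabilizer \<mu> t" "tabloid \<mu> (act p t) = tabloid \<mu> t" for p
  proof
    fix x
    have pp: "p permutes {1..n}" by (rule colstab_permutes[OF p(1)])
    show "p x = id x"
    proof (cases "x \<in> {1..n}")
      case True
      then have px: "p x \<in> {1..n}" using permutes_in_image[OF pp] by blast
      have "row_of t (p x) = row_of (act p t) (p x)"
        using row_of_tabloid[OF tableau_axioms act_tableau[OF pp] p(2)[symmetric] px] .
      also have "\<dots> = row_of t x" using row_act[OF pp True] .
      finally show ?thesis using row_col_inj[OF px True] p(1) True by (auto simp: colstab_iff)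
    next
      case False
      then show ?thesis using pp by (simp add: permutes_not_in)
    qed
  qed
  have "polytabloid \<mu> t (tabloid \<mu> t) = (\<Sum>p\<in>column_stabilizer \<mu> t. if p = id then 1 else 0)"
    unfolding polytabloid_def sum_fun_apply
    by (intro sum.cong refl) (auto simp: cscale_def tabloid_vector_def sign_id dest: only_id)
  also have "\<dots> = 1" using finite_colstab id_colstab by simp
  finally show ?thesis .
qed

end

subsection \<open>Irreducibility and independence of Specht modules\<close>

lemma column_act: "column (act q t) j = q ` column t j"
proof (intro equalityI subsetI)
  fix y assume "y \<in> column (act q t) j"
  then obtain r where "r \<in> set t" "j < length r" "y = q (r ! j)" by (auto simp: column_def)
  then show "y \<in> q ` column t j" by (auto simp: column_def)
next
  fix y assume "y \<in> q ` column t j"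
  then obtain r where "r \<in> set t" "j < length r" "y = q (r ! j)" by (auto simp: column_def)
  then have "map q r \<in> set (act q t)" "j < length (map q r)" "y = map q r ! j" by auto
  then show "y \<in> column (act q t) j" unfolding column_def by blast
qed

lemma sym_group_simps:
  "carrier (sym_group n) = {p. p permutes {1..n}}" "p \<otimes>\<^bsub>sym_group n\<^esub> q = p \<circ> q" "\<one>\<^bsub>sym_group n\<^esub> = id"
  by (simp_all add: sym_group_def)

lemma sym_group_inv: "p permutes {1..n} \<Longrightarrow> inv\<^bsub>sym_group n\<^esub> p = inv' p"
  by (rule group.inv_equality[OF sym_group_is_group]) (auto simp: sym_group_simps permutes_inv permutes_inv_o)

lemma finite_group_sym: "finite_group (sym_group n)"
proof -
  interpret group "sym_group n" by (rule sym_group_is_group)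
  show ?thesis by unfold_locales (simp add: sym_group_simps finite_permutations)
qed

lemma order_sym_group: "Coset.order (sym_group n) = fact n"
  by (simp add: Coset.order_def sym_group_simps card_permutations)

context tableau
begin

lemma colstab_act:
  assumes q: "q permutes {1..n}" and p: "p \<in> column_stabilizer \<mu> t"
  shows "q \<circ> p \<circ> inv' q \<in> column_stabilizer \<mu> (act q t)"
proof -
  have "(q \<circ> p \<circ> inv' q) ` q ` A = q ` p ` A" for A
    by (simp add: image_comp comp_def permutes_inverses(2)[OF q])
  then show ?thesis using p q unfolding column_stabilizer_def sum_mu column_act
    by (auto intro!: permutes_compose permutes_inv)
qed

text \<open>The column stabilizer of q t is the conjugate by q of that of t, and conjugation
  preserves signs.\<close>

lemma action_polytabloid:
  assumes q: "q permutes {1..n}"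
  shows "tabloid_action q (polytabloid \<mu> t) = polytabloid \<mu> (act q t)"
proof -
  interpret a: tableau n \<mu> "act q t" by (rule act_tableau[OF q])
  have iq: "inv' q permutes {1..n}" by (rule permutes_inv[OF q])
  have inv_act: "act (inv' q) (act q t) = t" by (simp add: comp_def permutes_inverses[OF q] map_idI)
  have "polytabloid \<mu> (act q t) = (\<Sum>p\<in>column_stabilizer \<mu> t. cscale (of_int (sign (q \<circ> p \<circ> inv' q)))
      (tabloid_vector (tabloid \<mu> (act (q \<circ> p \<circ> inv' q) (act q t)))))"
    unfolding polytabloid_def
  proof (rule sum.reindex_bij_betw[symmetric], rule bij_betwI[of _ _ _ "\<lambda>p. inv' q \<circ> p \<circ> q"])
    show "(\<lambda>p. inv' q \<circ> p \<circ> q) \<in> column_stabilizer \<mu> (act q t) \<rightarrow> column_stabilizer \<mu> t"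
      using a.colstab_act[OF iq] inv_act by (simp add: permutes_inv_inv[OF q])
    show "inv' q \<circ> (q \<circ> x \<circ> inv' q) \<circ> q = x" for x 
      by (simp add: fun_eq_iff permutes_inverses[OF q])
    show "q \<circ> (inv' q \<circ> x \<circ> q) \<circ> inv' q = x" for x 
      by (simp add: fun_eq_iff permutes_inverses[OF q])
  qed (use colstab_act[OF q] in auto)
  also have "\<dots> = (\<Sum>p\<in>column_stabilizer \<mu> t. cscale (of_int (sign p)) (tabloid_action q (tabloid_vector (tabloid \<mu> (act p t)))))"
  proof (intro sum.cong refl arg_cong2[where f = cscale])
    fix p assume p: "p \<in> column_stabilizer \<mu> t"
    have pq: "permutation q" using q permutation_permutes by blast
    then have "permutation (inv' q)" "permutation p" "permutation (q \<circ> p)"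
      using permutation_inverse permutation_compose perm(1)[OF p] by blast+
    note this pq
    then have "sign (q \<circ> p \<circ> inv' q) = sign q * sign p * sign q"
      by (simp add: sign_compose sign_inverse)
    then show "(of_int (sign (q \<circ> p \<circ> inv' q)) :: complex) = of_int (sign p)" by (simp add: sign_def)
    have "q \<circ> p \<circ> inv' q \<circ> q = q \<circ> p" by (simp add: fun_eq_iff permutes_inverses[OF q])
    then have a: "act (q \<circ> p \<circ> inv' q) (act q t) = act q (act p t)" unfolding act_comp[symmetric] by (rule arg_cong)
    then show "tabloid_vector (tabloid \<mu> (act (q \<circ> p \<circ> inv' q) (act q t))) = tabloid_action q (tabloid_vector (tabloid \<mu> (act p t)))"
      using tabloid_action_tabloid[OF act_tableau[OF colstab_permutes[OF p]] q] by (simp only: a)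
  qed
  also have "\<dots> = tabloid_action q (polytabloid \<mu> t)"
    unfolding polytabloid_def by (simp only: tabloid_action_sum tabloid_action_linear)
  finally show ?thesis by simp
qed

end

lemma rows_of_list:
  "sum_list \<mu> = length xs \<Longrightarrow> \<exists>t. map length t = \<mu> \<and> concat t = xs"
proof (induction \<mu> arbitrary: xs)
  case (Cons m \<mu>)
  then have "sum_list \<mu> = length (drop m xs)" by simp
  then obtain t where "map length t = \<mu>" "concat t = drop m xs" using Cons.IH by blast
  then show ?case using Cons.prems by (intro exI[of _ "take m xs # t"]) auto
qed simp

lemma permutes_map_list:
  assumes "distinct xs" "distinct ys" "set xs = set ys"
  shows "\<exists>p. p permutes set xs \<and> map p xs = ys"
proof -
  have len: "length xs = length ys" using assms by (metis distinct_card)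
  define p where "p x = (case map_of (zip xs ys) x of Some y \<Rightarrow> y | None \<Rightarrow> x)" for x
  have nth: "p (xs ! i) = ys ! i" if "i < length xs" for i
    using that assms(1) len map_of_zip_nth[of xs ys i] by (simp add: p_def)
  then have map: "map p xs = ys" using len by (intro nth_equalityI) auto
  have "p ` set xs = set xs" using map assms(3) by (metis set_map)
  then have "bij_betw p (set xs) (set xs)" by (simp add: bij_betw_def eq_card_imp_inj_on)
  then have "p permutes set xs"
    by (rule bij_imp_permutes) (use len in \<open>simp add: p_def map_of_zip_is_None[THEN iffD2]\<close>)
  then show ?thesis using map by blast
qed

locale shape =
  fixes n :: nat and \<mu> :: "nat list"
  assumes \<mu>: "\<mu> \<in> partitions_of n"
begin

abbreviation "S \<equiv> specht_module \<mu>"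

lemma sum_mu: "sum_list \<mu> = n" using \<mu> by (simp add: partitions_of_def)

lemma tableauI: "t \<in> tableaux \<mu> \<Longrightarrow> tableau n \<mu> t"
  by (simp add: tableau_def \<mu>)

lemma ex_tableau: "\<exists>t. t \<in> tableaux \<mu>"
proof -
  obtain t where "map length t = \<mu>" "concat t = [1..<Suc n]"
    using rows_of_list[of \<mu> "[1..<Suc n]"] sum_mu by (auto simp del: upt_Suc)
  then have "t \<in> tableaux \<mu>" by (auto simp: tableaux_def sum_mu simp del: set_concat upt_Suc)
  then show ?thesis ..
qed

text \<open>Both tableaux list {1..n} once in the same shape; the permutation matches the two
  reading words.\<close>

lemma tableaux_transitive:
  assumes "s \<in> tableaux \<mu>" "t \<in> tableaux \<mu>"
  shows "\<exists>p. p permutes {1..n} \<and> act p s = t"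
proof -
  interpret s: tableau n \<mu> s by (rule tableauI[OF assms(1)])
  interpret t: tableau n \<mu> t by (rule tableauI[OF assms(2)])
  obtain p where p: "p permutes set (concat s)" "map p (concat s) = concat t"
    using permutes_map_list[OF s.dist t.dist] s.set_t t.set_t by auto
  have "act p s = t"
  proof (rule concat_injective)
    show "concat (act p s) = concat t" using p(2) by (simp add: map_concat)
    show "length (act p s) = length t" using s.length_t t.length_t by simp
    show "\<forall>(x, y)\<in>set (zip (act p s) t). length x = length y"
      using s.length_row t.length_row s.length_t t.length_t by (auto simp: in_set_zip)
  qed
  then show ?thesis using p(1) s.set_t by auto
qed

definition "tabloids = tabloid \<mu> ` tableaux \<mu>"

lemma finite_tabloids: "finite tabloids"
  by (simp add: tabloids_def finite_tableaux)

lemma polytabloid_support: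
  assumes "t \<in> tableaux \<mu>" "T \<notin> tabloids"
  shows "polytabloid \<mu> t T = 0"
proof -
  interpret t: tableau n \<mu> t by (rule tableauI[OF assms(1)])
  have "tabloid \<mu> (act p t) \<in> tabloids" if "p \<in> column_stabilizer \<mu> t" for p
    using tableau.t[OF t.act_tableau[OF t.colstab_permutes[OF that]]] by (simp add: tabloids_def)
  then show ?thesis unfolding polytabloid_def sum_fun_apply
    using assms(2) by (intro sum.neutral ballI) (auto simp: cscale_def tabloid_vector_def)
qed

lemma specht_support:
  assumes "f \<in> S" "T \<notin> tabloids"
  shows "f T = 0"
proof -
  have "S \<subseteq> {f. f T = 0}" unfolding specht_module_def
    by (rule cfun.span_minimal)
       (use polytabloid_support assms(2) in \<open>auto simp: cfun.subspace_def cscale_def\<close>)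
  then show ?thesis using assms(1) by blast
qed

lemma specht_expand:
  assumes "f \<in> S"
  shows "(\<Sum>T\<in>tabloids. cscale (f T) (tabloid_vector T)) = f"
proof
  fix U
  have "(\<Sum>T\<in>tabloids. cscale (f T) (tabloid_vector T)) U = (\<Sum>T\<in>tabloids. if U = T then f T else 0)"
    unfolding sum_fun_apply by (intro sum.cong refl) (simp add: cscale_def tabloid_vector_def)
  also have "\<dots> = f U" using specht_support[OF assms] finite_tabloids by simp
  finally show "(\<Sum>T\<in>tabloids. cscale (f T) (tabloid_vector T)) U = f U" .
qed

lemma polytabloid_mem: "t \<in> tableaux \<mu> \<Longrightarrow> polytabloid \<mu> t \<in> S"
  unfolding specht_module_def by (rule cfun.span_base) simp

lemma subspace_S: "cfun.subspace S"
  by (simp add: specht_module_def)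

lemma action_mem:
  assumes "q permutes {1..n}" "v \<in> S"
  shows "tabloid_action q v \<in> S"
proof -
  have "S \<subseteq> {v. tabloid_action q v \<in> S}"
    unfolding specht_module_def[of \<mu>]
  proof (rule cfun.span_minimal, unfold specht_module_def[symmetric])
    show "polytabloid \<mu> ` tableaux \<mu> \<subseteq> {v. tabloid_action q v \<in> S}"
    proof clarify
      fix t assume t: "t \<in> tableaux \<mu>"
      interpret t: tableau n \<mu> t by (rule tableauI[OF t])
      show "tabloid_action q (polytabloid \<mu> t) \<in> S"
        using t.action_polytabloid[OF assms(1)] polytabloid_mem tableau.t[OF t.act_tableau[OF assms(1)]] by simp
    qed
    show "cfun.subspace {v. tabloid_action q v \<in> S}"
      using subspace_S unfolding cfun.subspace_def mem_Collect_eq by (simp add: tabloid_action_linear tabloid_action_0)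
  qed
  then show ?thesis using assms(2) by blast
qed

lemma specht_rep: "linear_rep (sym_group n) S tabloid_action"
  unfolding linear_rep_def sym_group_simps mem_Collect_eq
proof (intro conjI)
  show "\<exists>B. finite B \<and> cfun.span B = S"
    by (rule exI[of _ "polytabloid \<mu> ` tableaux \<mu>"]) (simp add: specht_module_def finite_tableaux)
qed (auto simp: tabloid_action_linear tabloid_action_id action_mem tabloid_action_comp permutes_bij)

lemma specht_nonzero: "S \<noteq> {0}"
proof -
  obtain t where t: "t \<in> tableaux \<mu>" using ex_tableau by blast
  have "polytabloid \<mu> t (tabloid \<mu> t) = 1" by (rule tableau.polytabloid_self[OF tableauI[OF t]])
  then have "polytabloid \<mu> t \<noteq> 0" by (metis zero_fun_apply zero_neq_one)
  then show ?thesis using polytabloid_mem[OF t] by blast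
qed

lemma kappa_expand:
  assumes "f \<in> S"
  shows "kappa \<nu> t f = (\<Sum>T\<in>tabloids. cscale (f T) (kappa \<nu> t (tabloid_vector T)))"
proof -
  have "kappa \<nu> t f = kappa \<nu> t (\<Sum>T\<in>tabloids. cscale (f T) (tabloid_vector T))" using specht_expand[OF assms] by simp
  then show ?thesis by (simp only: kappa_sum kappa_scale)
qed

text \<open>By expansion into tabloids: the antisymmetrizer of t maps the whole Specht module into
  the line of one polytabloid.\<close>

lemma kappa_multiple:
  assumes t: "t \<in> tableaux \<mu>" and f: "f \<in> S"
  shows "\<exists>c. kappa \<mu> t f = cscale c (polytabloid \<mu> t)"
proof -
  interpret t: tableau n \<mu> t by (rule tableauI[OF t])
  have "\<exists>c. kappa \<mu> t (tabloid_vector T) = cscale c (polytabloid \<mu> t)" if "T \<in> tabloids" for T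
    using that t.kappa_multiple[OF tableauI] by (auto simp: tabloids_def)
  then obtain c where "\<And>T. T \<in> tabloids \<Longrightarrow> kappa \<mu> t (tabloid_vector T) = cscale (c T) (polytabloid \<mu> t)" by metis
  then have "kappa \<mu> t f = (\<Sum>T\<in>tabloids. cscale (f T * c T) (polytabloid \<mu> t))"
    unfolding kappa_expand[OF f] by (intro sum.cong refl) simp
  then show ?thesis by (simp only: cfun.scale_sum_left[symmetric]) blast
qed

text \<open>The bilinear (not Hermitian) form for which the tabloids are orthonormal. Bilinearity
  makes \<open>kappa\<close> self-adjoint without conjugating scalars; positivity is recovered in
  \<open>form_nondegenerate\<close>.\<close>

definition form where "form f g = (\<Sum>T\<in>tabloids. f T * g T :: complex)"

lemma tabloids_act: 
  assumes q: "q permutes {1..n}" shows "bij_betw (\<lambda>T. act q ` T) tabloids tabloids"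
proof -
  have sub: "act p ` T \<in> tabloids" if "p permutes {1..n}" "T \<in> tabloids" for p T
    using that tabloid_act[OF tableauI that(1)] tableau.t[OF tableau.act_tableau[OF tableauI that(1)]] by (auto simp: tabloids_def)
  have pi: "act q (act (inv' q) s) = s" "act (inv' q) (act q s) = s" for s
    using permutes_inverses[OF q] by (simp_all add: comp_def map_idI)
  show ?thesis
    by (rule bij_betwI[of _ _ _ "\<lambda>T. act (inv' q) ` T"]) (use sub q permutes_inv[OF q] pi in \<open>auto simp: image_comp comp_def\<close>)
qed

lemma form_action:
  assumes q: "q permutes {1..n}"
  shows "form (tabloid_action q f) g = form f (tabloid_action (inv' q) g)"
proof -
  have "form (tabloid_action q f) g = (\<Sum>T\<in>tabloids. tabloid_action q f (act q ` T) * g (act q ` T))"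
    unfolding form_def by (rule sum.reindex_bij_betw[OF tabloids_act[OF q], symmetric])
  also have "\<dots> = form f (tabloid_action (inv' q) g)"
    unfolding form_def tabloid_action_def
    by (simp add: image_comp comp_def permutes_inverses[OF q] permutes_inv_inv[OF q])
  finally show ?thesis .
qed

lemma form_linear:
  "form (cscale c f) g = c * form f g" "form f (cscale c g) = c * form f g"
  "form (\<Sum>i\<in>I. h i) g = (\<Sum>i\<in>I. form (h i) g)" "form f (\<Sum>i\<in>I. h i) = (\<Sum>i\<in>I. form f (h i))"
  unfolding form_def cscale_def sum_fun_apply
  by (auto simp: sum_distrib_left sum_distrib_right mult_ac intro: sum.swap)

text \<open>The adjoint of a permutation is its inverse, and inversion permutes the column
  stabilizer without changing signs.\<close>

lemma form_kappa:
  assumes t: "t \<in> tableaux \<mu>"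
  shows "form f (kappa \<mu> t g) = form (kappa \<mu> t f) g"
proof -
  interpret t: tableau n \<mu> t by (rule tableauI[OF t])
  have bij: "bij_betw inv' (column_stabilizer \<mu> t) (column_stabilizer \<mu> t)"
    by (rule bij_betwI[of _ _ _ inv']) (use t.inv_colstab permutes_inv_inv[OF t.colstab_permutes] in auto)
  have "form (kappa \<mu> t f) g = (\<Sum>p\<in>column_stabilizer \<mu> t. of_int (sign p) * form f (tabloid_action (inv' p) g))"
    unfolding kappa_def form_linear using form_action[OF t.colstab_permutes] by simp
  also have "\<dots> = (\<Sum>p\<in>column_stabilizer \<mu> t. of_int (sign (inv' p)) * form f (tabloid_action (inv' p) g))"
    using t.perm by (intro sum.cong refl) (simp add: sign_inverse)
  also have "\<dots> = (\<Sum>p\<in>column_stabilizer \<mu> t. of_int (sign p) * form f (tabloid_action p g))"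
    by (rule sum.reindex_bij_betw[OF bij])
  also have "\<dots> = form f (kappa \<mu> t g)" unfolding kappa_def form_linear ..
  finally show ?thesis by simp
qed

text \<open>Polytabloids are real, so w is also orthogonal to their conjugates and hence to the
  conjugate of every element of the module. For w itself this is the vanishing of a sum of squared
  moduli.\<close>

lemma form_nondegenerate:
  assumes w: "w \<in> S" and 0: "\<And>t. t \<in> tableaux \<mu> \<Longrightarrow> form w (polytabloid \<mu> t) = 0"
  shows "w = 0"
proof -
  have cnj_poly: "cnj (polytabloid \<mu> t T) = polytabloid \<mu> t T" for t T
    unfolding polytabloid_def sum_fun_apply by (simp add: cscale_def tabloid_vector_def if_distrib cong: if_cong)
  have "S \<subseteq> {g. form w (\<lambda>T. cnj (g T)) = 0}" unfolding specht_module_def[of \<mu>]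
    by (rule cfun.span_minimal)
       (use 0 in \<open>auto simp: cnj_poly cfun.subspace_def form_def cscale_def algebra_simps sum.distrib sum_distrib_left[symmetric]\<close>)
  then have "form w (\<lambda>T. cnj (w T)) = 0" using w by blast
  then have "(\<Sum>T\<in>tabloids. complex_of_real ((cmod (w T))\<^sup>2)) = 0"
    unfolding form_def by (simp only: complex_norm_square)
  then have "(\<Sum>T\<in>tabloids. (cmod (w T))\<^sup>2) = 0" by (metis of_real_eq_0_iff of_real_sum)
  then have "w T = 0" if "T \<in> tabloids" for T using that finite_tabloids by (simp add: sum_nonneg_eq_0_iff)
  then show ?thesis using specht_support[OF w] by (auto simp: fun_eq_iff)
qed

text \<open>Transitivity on tableaux makes all polytabloids translates of a single one.\<close>

lemma specht_generated:
  assumes "cfun.subspace W" "\<And>g w. g permutes {1..n} \<Longrightarrow> w \<in> W \<Longrightarrow> tabloid_action g w \<in> W"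
    "t \<in> tableaux \<mu>" "polytabloid \<mu> t \<in> W"
  shows "S \<subseteq> W"
  unfolding specht_module_def
proof (rule cfun.span_minimal[OF _ assms(1)], clarify)
  fix s assume "s \<in> tableaux \<mu>"
  then obtain p where p: "p permutes {1..n}" "act p t = s" using tableaux_transitive assms(3) by blast
  then have "polytabloid \<mu> s = tabloid_action p (polytabloid \<mu> t)"
    using tableau.action_polytabloid[OF tableauI[OF assms(3)]] by simp
  then show "polytabloid \<mu> s \<in> W" using assms(2,4) p(1) by simp
qed

lemma kappa_mem:
  assumes "cfun.subspace W" "\<And>g w. g permutes {1..n} \<Longrightarrow> w \<in> W \<Longrightarrow> tabloid_action g w \<in> W"
    "tableau n \<nu> t" "w \<in> W"
  shows "kappa \<nu> t w \<in> W"
  unfolding kappa_def using assms tableau.colstab_permutes[OF assms(3)]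
  by (intro cfun.subspace_sum[OF assms(1)] cfun.subspace_scale[OF assms(1)]) auto

text \<open>The submodule argument: a nonzero w in W pairs nontrivially with some polytabloid of t.
  By self-adjointness \<open>kappa\<close> does not annihilate w, and it sends w to a multiple of
  that polytabloid. So W contains a generator.\<close>

lemma specht_irreducible: "irreducible_rep (sym_group n) S tabloid_action"
  unfolding irreducible_rep_def sym_group_simps mem_Collect_eq
proof (intro conjI allI impI)
  fix W assume W: "cfun.subspace W \<and> W \<subseteq> S \<and> (\<forall>g\<in>{p. p permutes {1..n}}. \<forall>w\<in>W. tabloid_action g w \<in> W)"
  then have sub: "cfun.subspace W" and inv: "\<And>g w. g permutes {1..n} \<Longrightarrow> w \<in> W \<Longrightarrow> tabloid_action g w \<in> W" by auto
  show "W = {0} \<or> W = S"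
  proof (cases "W = {0}")
    case False
    then obtain w where w: "w \<in> W" "w \<noteq> 0" using cfun.subspace_0[OF sub] by blast
    then have wS: "w \<in> S" using W by blast
    obtain t where t: "t \<in> tableaux \<mu>" "form w (polytabloid \<mu> t) \<noteq> 0" using form_nondegenerate[OF wS] w(2) by blast
    interpret t: tableau n \<mu> t by (rule tableauI[OF t(1)])
    have "kappa \<mu> t w \<noteq> 0"
    proof
      assume "kappa \<mu> t w = 0"
      then have "form (kappa \<mu> t w) (tabloid_vector (tabloid \<mu> t)) = 0" by (simp add: form_def)
      then show False using t form_kappa[OF t(1)] t.polytabloid_kappa by metis
    qed
    moreover obtain c where c: "kappa \<mu> t w = cscale c (polytabloid \<mu> t)" using kappa_multiple[OF t(1) wS] by blast
    ultimately have "c \<noteq> 0" by auto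
    then have "polytabloid \<mu> t = cscale (inverse c) (kappa \<mu> t w)" using c by simp
    moreover have "kappa \<mu> t w \<in> W" by (rule kappa_mem[OF sub inv t.tableau_axioms w(1)])
    ultimately have "polytabloid \<mu> t \<in> W" using cfun.subspace_scale[OF sub] by metis
    then show ?thesis using specht_generated[OF sub inv t(1)] W by blast
  qed simp
qed (use specht_rep specht_nonzero in auto)

lemma intertwiner_kappa:
  assumes f: "f \<in> intertwiners (sym_group n) S tabloid_action W tabloid_action" and t: "tableau n \<nu> t" and v: "v \<in> S"
  shows "f (kappa \<nu> t v) = kappa \<nu> t (f v)"
proof -
  interpret fin_dim S by (rule linear_repD(1)[OF specht_rep])
  have lin: "lin_on S f" and com: "\<And>g v. g permutes {1..n} \<Longrightarrow> v \<in> S \<Longrightarrow> f (tabloid_action g v) = tabloid_action g (f v)"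
    using f by (auto simp: intertwiners_def sym_group_simps)
  show ?thesis unfolding kappa_def using tableau.colstab_permutes[OF t] v action_mem com by (subst lin_sum[OF lin]) auto
qed

text \<open>A polytabloid e is an eigenvector of \<open>kappa\<close> with nonzero eigenvalue, and
  the image of \<open>kappa\<close> is the line of e, so f must map e into this line. The eigenspace
  of f containing e is a submodule, hence everything.\<close>

lemma intertwiner_scalar:
  assumes f: "f \<in> intertwiners (sym_group n) S tabloid_action S tabloid_action"
  shows "\<exists>c. \<forall>v\<in>S. f v = cscale c v"
proof -
  obtain t where t: "t \<in> tableaux \<mu>" using ex_tableau by blast
  interpret t: tableau n \<mu> t by (rule tableauI[OF t])
  have lin: "lin_on S f" and mem: "\<And>v. v \<in> S \<Longrightarrow> f v \<in> S" and com: "\<And>g v. g permutes {1..n} \<Longrightarrow> v \<in> S \<Longrightarrow> f (tabloid_action g v) = tabloid_action g (f v)"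
    using f by (auto simp: intertwiners_def sym_group_simps)
  let ?e = "polytabloid \<mu> t" and ?m = "of_nat (card (column_stabilizer \<mu> t)) :: complex"
  have e: "?e \<in> S" by (rule polytabloid_mem[OF t])
  have "kappa \<mu> t ?e = cscale ?m ?e" unfolding t.polytabloid_kappa t.kappa_kappa ..
  then have "cscale ?m (f ?e) = kappa \<mu> t (f ?e)"
    using intertwiner_kappa[OF f t.tableau_axioms e] lin e by (simp add: lin_on_def)
  moreover obtain c where "kappa \<mu> t (f ?e) = cscale c ?e" using kappa_multiple[OF t mem[OF e]] by blast
  ultimately have "cscale (inverse ?m) (cscale ?m (f ?e)) = cscale (inverse ?m) (cscale c ?e)" by simp
  then have fe: "f ?e = cscale (inverse ?m * c) ?e" using t.card_colstab by simp
  define W where "W = {v\<in>S. f v = cscale (inverse ?m * c) v}"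
  have "cfun.subspace W"
    using subspace_S lin unfolding W_def cfun.subspace_def lin_on_def 
    by (auto simp: fin_dim.lin_zero[OF linear_repD(1)[OF specht_rep] lin] cfun.scale_right_distrib mult.commute)
  moreover have "tabloid_action g w \<in> W" if "g permutes {1..n}" "w \<in> W" for g w
    using that com action_mem by (auto simp: W_def tabloid_action_linear)
  ultimately have "S \<subseteq> W" using specht_generated[OF _ _ t] fe e W_def by blast
  then show ?thesis unfolding W_def by blast
qed

lemma specht_absolutely_irreducible: "absolutely_irreducible (sym_group n) S tabloid_action"
  by (rule absolutely_irreducible.intro[OF finite_group_sym], unfold_locales)
     (use specht_rep specht_nonzero intertwiner_scalar in auto)

end

text \<open>The kernel of f is a submodule, so f does not kill a polytabloid e of shape \<mu>. Its
  image is again an eigenvector of \<open>kappa\<close> with nonzero eigenvalue, so some tabloid of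
  shape \<nu> survives \<open>kappa\<close>, and dominance applies.\<close>

lemma specht_intertwiner_dominates:
  assumes \<mu>: "shape n \<mu>" and \<nu>: "shape n \<nu>" 
    and f: "f \<in> intertwiners (sym_group n) (specht_module \<mu>) tabloid_action (specht_module \<nu>) tabloid_action"
    and v: "v \<in> specht_module \<mu>" "f v \<noteq> 0"
  shows "sum_list (take k \<nu>) \<le> sum_list (take k \<mu>)"
proof -
  interpret \<mu>: shape n \<mu> by fact
  interpret \<nu>: shape n \<nu> by fact
  obtain t where t: "t \<in> tableaux \<mu>" using \<mu>.ex_tableau by blast
  interpret t: tableau n \<mu> t by (rule \<mu>.tableauI[OF t])
  have lin: "lin_on \<mu>.S f" and mem: "\<And>v. v \<in> \<mu>.S \<Longrightarrow> f v \<in> \<nu>.S" and com: "\<And>g v. g permutes {1..n} \<Longrightarrow> v \<in> \<mu>.S \<Longrightarrow> f (tabloid_action g v) = tabloid_action g (f v)"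
    using f by (auto simp: intertwiners_def sym_group_simps)
  let ?e = "polytabloid \<mu> t" and ?m = "of_nat (card (column_stabilizer \<mu> t)) :: complex"
  have e: "?e \<in> \<mu>.S" by (rule \<mu>.polytabloid_mem[OF t])
  have "f ?e \<noteq> 0"
  proof
    assume 0: "f ?e = 0"
    have "cfun.subspace {v\<in>\<mu>.S. f v = 0}"
      using \<mu>.subspace_S lin unfolding cfun.subspace_def lin_on_def 
      by (auto simp: fin_dim.lin_zero[OF linear_repD(1)[OF \<mu>.specht_rep] lin])
    moreover have "tabloid_action g w \<in> {v\<in>\<mu>.S. f v = 0}" if "g permutes {1..n}" "w \<in> {v\<in>\<mu>.S. f v = 0}" for g w
      using that com \<mu>.action_mem by (auto simp: tabloid_action_0)
    ultimately have "\<mu>.S \<subseteq> {v\<in>\<mu>.S. f v = 0}" using \<mu>.specht_generated[OF _ _ t] e 0 by blast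
    then show False using v by blast
  qed
  have "kappa \<mu> t ?e = cscale ?m ?e" unfolding t.polytabloid_kappa t.kappa_kappa ..
  then have "kappa \<mu> t (f ?e) = cscale ?m (f ?e)"
    using \<mu>.intertwiner_kappa[OF f t.tableau_axioms e] lin e by (simp add: lin_on_def)
  then have "kappa \<mu> t (f ?e) \<noteq> 0" using \<open>f ?e \<noteq> 0\<close> t.card_colstab by (simp add: cfun.scale_eq_0_iff)
  then obtain T where T: "T \<in> \<nu>.tabloids" "kappa \<mu> t (tabloid_vector T) \<noteq> 0"
    unfolding \<nu>.kappa_expand[OF mem[OF e]] by (metis (no_types, lifting) cscale_simps(4) sum.neutral)
  then obtain s where "s \<in> tableaux \<nu>" "T = tabloid \<nu> s" by (auto simp: \<nu>.tabloids_def)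
  then show ?thesis using t.kappa_dominates[OF \<nu>.tableauI] T(2) by blast
qed

lemma take_sums_eq:
  assumes "\<And>k. sum_list (take k xs) = sum_list (take k (ys :: nat list))" "0 \<notin> set xs" "0 \<notin> set ys"
  shows "xs = ys"
  using assms
proof (induction xs arbitrary: ys)
  case Nil
  then show ?case using Nil(1)[of 1] by (cases ys) auto
next
  case (Cons x xs)
  then obtain y zs where ys: "ys = y # zs" using Cons.prems(1)[of 1] by (cases ys) auto
  have "x = y" using Cons.prems(1)[of 1] ys by simp
  moreover have "xs = zs"
    by (rule Cons.IH) (use Cons.prems(1)[of "Suc k" for k] Cons.prems(2,3) ys \<open>x = y\<close> in auto)
  ultimately show ?case using ys by simp
qed

text \<open>Different shapes violate dominance in at least one direction, but which one depends on
  the shapes. One direction is enough for orthogonality.\<close>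

lemma specht_no_intertwiner:
  assumes \<mu>: "shape n \<mu>" and \<nu>: "shape n \<nu>" and "\<mu> \<noteq> \<nu>"
  obtains "\<And>f v. f \<in> intertwiners (sym_group n) (specht_module \<mu>) tabloid_action (specht_module \<nu>) tabloid_action \<Longrightarrow> v \<in> specht_module \<mu> \<Longrightarrow> f v = 0"
  | "\<And>f v. f \<in> intertwiners (sym_group n) (specht_module \<nu>) tabloid_action (specht_module \<mu>) tabloid_action \<Longrightarrow> v \<in> specht_module \<nu> \<Longrightarrow> f v = 0"
proof -
  obtain k where "sum_list (take k \<mu>) \<noteq> sum_list (take k \<nu>)"
    using take_sums_eq[of \<mu> \<nu>] assms by (auto simp: shape_def partitions_of_def)
  then consider "\<not> sum_list (take k \<nu>) \<le> sum_list (take k \<mu>)" | "\<not> sum_list (take k \<mu>) \<le> sum_list (take k \<nu>)" by linarith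
  then show ?thesis
    using that specht_intertwiner_dominates[OF \<mu> \<nu>] specht_intertwiner_dominates[OF \<nu> \<mu>] by cases metis+
qed

text \<open>Specht modules consist of functions on tabloids, while
  \<open>irreducible_characters\<close> admits only spaces of functions on the naturals; coordinates
  in a basis carry one to the other.\<close>

lemma irreducible_rep_transport:
  fixes V :: "('b \<Rightarrow> complex) set"
  assumes irr: "irreducible_rep G V \<rho>"
  shows "restrict (rep_character V \<rho>) (carrier G) \<in> irreducible_characters G"
proof -
  have rep: "linear_rep G V \<rho>" and ne: "V \<noteq> {0}" using irr by (auto simp: irreducible_rep_def)
  note R = linear_repD[OF rep]
  interpret fin_dim V by (rule R(1))
  let ?B = "basis_of V"
  obtain e where e: "bij_betw e ?B {0..<card ?B}" using ex_bij_betw_finite_nat[OF finite_basis] by blast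
  \<comment> \<open>The coordinate vector of v along the enumeration e of the basis, padded by zero
    beyond the dimension.\<close>
  define T where "T v = (\<lambda>k. if k < card ?B then coord V (inv_into ?B e k) v else 0)" for v
  have Te: "T v (e b) = coord V b v" if "b \<in> ?B" for b v
    using that e bij_betw_apply[OF e that] bij_betw_inv_into_left[OF e that] by (simp add: T_def)
  have lin: "lin_on V T"
  proof -
    have "T (v + w) k = T v k + T w k" if "v \<in> V" "w \<in> V" for v w k
      using that basis by (simp add: T_def coord_def cfun.representation_add)
    moreover have "T (cscale c v) k = c * T v k" if "v \<in> V" for c v k
      using that by (simp add: T_def coord_scale)
    ultimately show ?thesis unfolding lin_on_def fun_eq_iff plus_fun_apply cscale_def[of _ "T _"] by blast
  qed
  have inj: "inj_on T V"
  proof (rule inj_onI)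
    fix v w assume vw: "v \<in> V" "w \<in> V" "T v = T w"
    then have "coord V b v = coord V b w" if "b \<in> ?B" for b using Te[OF that] by metis
    then have "(\<Sum>b\<in>?B. cscale (coord V b v) b) = (\<Sum>b\<in>?B. cscale (coord V b w) b)" by (intro sum.cong refl) simp
    then show "v = w" using expand vw by simp
  qed
  define W where "W = T ` V"
  define S where "S = inv_into V T"
  define \<sigma> where "\<sigma> g w = T (\<rho> g (S w))" for g w
  have ST: "S (T v) = v" if "v \<in> V" for v using inv_into_f_f[OF inj that] by (simp add: S_def)
  have sT: "\<sigma> g (T v) = T (\<rho> g v)" if "v \<in> V" for g v using ST[OF that] by (simp add: \<sigma>_def)
  have T0: "T 0 = 0" by (rule lin_zero[OF lin])
  have Tadd: "T v + T w = T (v + w)" if "v \<in> V" "w \<in> V" for v w using lin that by (simp add: lin_on_def)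
  have Tscale: "cscale c (T v) = T (cscale c v)" if "v \<in> V" for c v using lin that by (simp add: lin_on_def)
  have Vadd: "v + w \<in> V" if "v \<in> V" "w \<in> V" for v w using that cfun.subspace_add[OF subspace] by blast
  have Vscale: "cscale c v \<in> V" if "v \<in> V" for c v using that cfun.subspace_scale[OF subspace] by blast
  have V0: "0 \<in> V" using cfun.subspace_0[OF subspace] .
  have Wsub: "cfun.subspace W"
    unfolding cfun.subspace_def W_def
  proof (intro conjI ballI allI)
    show "0 \<in> T ` V" using V0 T0 by force
  qed (use Tadd Tscale Vadd Vscale in auto)
  have span: "cfun.span (T ` ?B) = W"
  proof (rule cfun.span_subspace[OF _ _ Wsub])
    show "T ` ?B \<subseteq> W" using basis_subset by (auto simp: W_def)
    show "W \<subseteq> cfun.span (T ` ?B)"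
    proof
      fix w assume "w \<in> W"
      then obtain v where v: "v \<in> V" "w = T v" by (auto simp: W_def)
      have "w = T (\<Sum>b\<in>?B. cscale (coord V b v) b)" using expand v by simp
      also have "\<dots> = (\<Sum>b\<in>?B. cscale (coord V b v) (T b))" using basis_subset by (intro lin_sum[OF lin]) auto
      finally show "w \<in> cfun.span (T ` ?B)" 
        by (simp only:) (intro cfun.span_sum cfun.span_scale cfun.span_base imageI)
    qed
  qed
  have lr: "linear_rep G W \<sigma>"
    unfolding linear_rep_def
  proof (intro conjI)
    show "\<exists>B. finite B \<and> cfun.span B = W" using span finite_basis by blast
    show "\<forall>g\<in>carrier G. \<forall>v\<in>W. \<sigma> g v \<in> W" using R(2) sT by (auto simp: W_def)
    show "\<forall>g\<in>carrier G. \<forall>v\<in>W. \<forall>w\<in>W. \<sigma> g (v + w) = \<sigma> g v + \<sigma> g w"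
      using R(2,3) sT Tadd Vadd by (auto simp: W_def lin_on_def)
    show "\<forall>g\<in>carrier G. \<forall>c. \<forall>v\<in>W. \<sigma> g (cscale c v) = cscale c (\<sigma> g v)"
      using R(2,3) sT Tscale Vscale by (auto simp: W_def lin_on_def)
    show "\<forall>v\<in>W. \<sigma> \<one>\<^bsub>G\<^esub> v = v" using R(4) sT by (auto simp: W_def)
    show "\<forall>g\<in>carrier G. \<forall>h\<in>carrier G. \<forall>v\<in>W. \<sigma> (g \<otimes>\<^bsub>G\<^esub> h) v = \<sigma> g (\<sigma> h v)"
      using R(2,5) sT by (auto simp: W_def)
  qed
  have "irreducible_rep G W \<sigma>"
    unfolding irreducible_rep_def
  proof (intro conjI allI impI)
    show "W \<noteq> {0}"
    proof
      assume 0: "W = {0}"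
      obtain v where v: "v \<in> V" "v \<noteq> 0" using ne V0 by blast
      then have "T v = T 0" using 0 T0 by (auto simp: W_def)
      then show False using inj_onD[OF inj] v V0 by blast
    qed
    fix U assume U: "cfun.subspace U \<and> U \<subseteq> W \<and> (\<forall>g\<in>carrier G. \<forall>w\<in>U. \<sigma> g w \<in> U)"
    let ?P = "{v\<in>V. T v \<in> U}"
    have "cfun.subspace ?P" using U V0 Vadd Vscale T0
      unfolding cfun.subspace_def by (auto simp: Tadd[symmetric] Tscale[symmetric])
    moreover have "\<forall>g\<in>carrier G. \<forall>w\<in>?P. \<rho> g w \<in> ?P" using R(2) U sT by (auto simp: sT[symmetric])
    ultimately have "?P = {0} \<or> ?P = V" using irr unfolding irreducible_rep_def by blast
    moreover have "U = T ` ?P" using U by (auto simp: W_def)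
    ultimately show "U = {0} \<or> U = W" using T0 by (auto simp: W_def)
  qed (rule lr)
  moreover have "restrict (rep_character W \<sigma>) (carrier G) = restrict (rep_character V \<rho>) (carrier G)"
  proof (rule restrict_ext)
    fix g assume g: "g \<in> carrier G"
    show "rep_character W \<sigma> g = rep_character V \<rho> g"
      unfolding rep_character_def
      by (rule trace_on_iso[OF R(1) linear_repD(1)[OF lr] lin inj _ R(3)[OF g]]) (use R(2)[OF g] sT in \<open>auto simp: W_def\<close>)
  qed
  ultimately show ?thesis unfolding irreducible_characters_def mem_Collect_eq
    by (intro exI[of _ W] exI[of _ \<sigma>]) simp
qed

section \<open>Cycle types\<close>

abbreviation orb :: "(nat \<Rightarrow> nat) \<Rightarrow> nat \<Rightarrow> nat set" where
  "orb \<equiv> Orbits.orbit"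

text \<open>Cycle types as multisets: splitting and joining cycles become additive equations, and no
  sorting intervenes.\<close>

definition cycles :: "nat \<Rightarrow> (nat \<Rightarrow> nat) \<Rightarrow> nat multiset" where
  "cycles n p = image_mset card (mset_set (orb p ` {1..n}))"

definition parts :: "nat \<Rightarrow> nat multiset set" where
  "parts n = {M. sum_mset M = n \<and> 0 \<notin># M}"

lemma sorted_desc_mset_inj:
  assumes "sorted_wrt (\<ge>) xs" "sorted_wrt (\<ge>) ys" "mset xs = mset (ys :: nat list)"
  shows "xs = ys"
proof -
  have "sorted (rev xs)" "sorted (rev ys)" using assms(1,2) by (simp_all add: sorted_wrt_rev)
  moreover have "mset (rev xs) = mset (rev ys)" using assms(3) by simp
  ultimately have "rev xs = rev ys" by (metis properties_for_sort sorted_sort_id)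
  then show ?thesis by simp
qed

lemma bij_mset_partitions: "bij_betw mset (partitions_of n) (parts n)"
proof (rule bij_betw_imageI)
  show "inj_on mset (partitions_of n)"
    by (rule inj_onI) (auto simp: partitions_of_def intro: sorted_desc_mset_inj)
  show "mset ` partitions_of n = parts n"
  proof (intro equalityI subsetI)
    fix M assume "M \<in> parts n"
    moreover have "sorted_wrt (\<ge>) (rev (sorted_list_of_multiset M))" by (simp add: sorted_wrt_rev)
    moreover have "sum_list (rev (sorted_list_of_multiset M)) = sum_mset M"
      by (metis mset_rev mset_sorted_list_of_multiset sum_mset_sum_list)
    ultimately have "rev (sorted_list_of_multiset M) \<in> partitions_of n" by (simp add: partitions_of_def parts_def)
    then show "M \<in> mset ` partitions_of n" by (rule rev_image_eqI) simp
  qed (auto simp: partitions_of_def parts_def sum_mset_sum_list)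
qed

lemma mset_cycle_type: "mset (cycle_type n p) = cycles n p"
  by (simp add: cycle_type_def cycles_def)

lemma sorted_cycle_type: "sorted_wrt (\<ge>) (cycle_type n p)"
  by (simp add: cycle_type_def sorted_wrt_rev)

lemma cycle_type_eq_iff: "cycle_type n p = cycle_type m q \<longleftrightarrow> cycles n p = cycles m q"
  using sorted_desc_mset_inj sorted_cycle_type mset_cycle_type by metis

lemma count_image_mset_set: "finite A \<Longrightarrow> count (image_mset f (mset_set A)) k = card {a\<in>A. f a = k}"
proof (induction A rule: finite_induct)
  case (insert x A)
  have "{a\<in>insert x A. f a = k} = (if f x = k then insert x {a\<in>A. f a = k} else {a\<in>A. f a = k})" by auto
  then show ?case using insert by simp
qed simp

section \<open>Cycles of a permutation and multiplication by a transposition\<close>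

context
  fixes n :: nat and p :: "nat \<Rightarrow> nat"
  assumes p: "p permutes {1..n}"
begin

lemma perm_p: "permutation p"
  using p permutation_permutes by blast

lemma orb_self: "x \<in> orb p x"
  by (rule permutation_self_in_orbit[OF perm_p])

lemma orb_sub: "x \<in> {1..n} \<Longrightarrow> orb p x \<subseteq> {1..n}"
  by (rule permutes_orbit_subset[OF p])

lemma orb_eq: "y \<in> orb p x \<Longrightarrow> orb p y = orb p x"
  using orbit_cyclic_eq3[OF cyclic_on_orbit'[OF perm_p]] by blast

lemma orb_disjoint: "y \<notin> orb p x \<Longrightarrow> orb p x \<inter> orb p y = {}"
  using orb_eq orb_self by blast

lemma orb_finite: "finite (orb p x)"
  by (rule finite_orbit[OF orb_self])

lemma cycles_mem: "x \<in> {1..n} \<Longrightarrow> card (orb p x) \<in># cycles n p"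
  by (auto simp: cycles_def)

lemma cycles_obtain:
  assumes "a \<in># cycles n p" obtains x where "x \<in> {1..n}" "card (orb p x) = a"
  using assms by (auto simp: cycles_def)

lemma cycles_parts: "cycles n p \<in> parts n"
proof -
  have "sum_mset (cycles n p) = (\<Sum>K\<in>orb p ` {1..n}. card K)" by (simp add: cycles_def sum_unfold_sum_mset)
  also have "\<dots> = card (\<Union>(orb p ` {1..n}))"
  proof (rule card_Union_disjoint[symmetric])
    show "pairwise disjnt (orb p ` {1..n})"
    proof (rule pairwiseI)
      fix K L assume "K \<in> orb p ` {1..n}" "L \<in> orb p ` {1..n}" "K \<noteq> L"
      then obtain x y where xy: "K = orb p x" "L = orb p y" by blast
      then have "y \<notin> orb p x" using orb_eq \<open>K \<noteq> L\<close> by blast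
      then show "disjnt K L" using orb_disjoint xy by (simp add: disjnt_def)
    qed
  qed (use orb_finite in auto)
  also have "\<Union>(orb p ` {1..n}) = {1..n}" using orb_sub orb_self by blast
  finally have "sum_mset (cycles n p) = n" by simp
  moreover have "0 \<notin># cycles n p" using orb_finite orbit_nonempty[of p] by (auto simp: cycles_def)
  ultimately show ?thesis by (simp add: parts_def)
qed

lemma cycle_type_partition: "cycle_type n p \<in> partitions_of n"
  using cycles_parts sorted_cycle_type unfolding partitions_of_def parts_def mset_cycle_type[symmetric]
  by (auto simp: sum_mset_sum_list)

lemma count_cycles: "count (cycles n p) k = card {K \<in> orb p ` {1..n}. card K = k}"
  unfolding cycles_def by (rule count_image_mset_set) simp

lemma count_fixed: "count (cycles n p) 1 = card {x\<in>{1..n}. p x = x}"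
proof -
  have "bij_betw (\<lambda>x. {x}) {x\<in>{1..n}. p x = x} {K \<in> orb p ` {1..n}. card K = 1}"
  proof (rule bij_betw_imageI)
    show "(\<lambda>x. {x}) ` {x\<in>{1..n}. p x = x} = {K \<in> orb p ` {1..n}. card K = 1}"
    proof (intro equalityI subsetI)
      fix K assume "K \<in> {K \<in> orb p ` {1..n}. card K = 1}"
      then obtain x where x: "x \<in> {1..n}" "K = orb p x" "card (orb p x) = 1" by blast
      then have "orb p x = {x}" using orb_self by (metis card_1_singletonE singletonD)
      moreover from this have "p x = x" by (simp only: orbit_eq_singleton_iff)
      ultimately show "K \<in> (\<lambda>x. {x}) ` {x\<in>{1..n}. p x = x}" using x by blast
    next
      fix K assume "K \<in> (\<lambda>x. {x}) ` {x\<in>{1..n}. p x = x}"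
      then obtain x where x: "x \<in> {1..n}" "p x = x" "K = {x}" by blast
      then have "K = orb p x" using orbit_eq_singleton_iff by metis
      moreover have "card K = 1" using x by simp
      ultimately show "K \<in> {K \<in> orb p ` {1..n}. card K = 1}" using x by blast
    qed
  qed auto
  then show ?thesis unfolding count_cycles by (simp add: bij_betw_same_card)
qed

text \<open>The cycles must differ even when b = c, so the first orbit is removed from the set of
  orbits before the second is picked.\<close>

lemma two_cycles:
  assumes "{#b, c#} \<subseteq># cycles n p"
  obtains x y where "x \<in> {1..n}" "y \<in> {1..n}" "y \<notin> orb p x" "card (orb p x) = b" "card (orb p y) = c"
proof -
  let ?A = "orb p ` {1..n}"
  have "b \<in># cycles n p" using assms by (meson insert_subset_eq_iff mset_subset_eqD union_single_eq_member)
  then obtain x where x: "x \<in> {1..n}" "card (orb p x) = b" by (rule cycles_obtain)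
  have "mset_set ?A = add_mset (orb p x) (mset_set (?A - {orb p x}))" using x by (intro mset_set.remove) auto
  then have "cycles n p = add_mset b (image_mset card (mset_set (?A - {orb p x})))" using x by (simp add: cycles_def)
  then have "c \<in># image_mset card (mset_set (?A - {orb p x}))" using assms by (simp add: insert_subset_eq_iff)
  then obtain K where "K \<in> ?A - {orb p x}" "card K = c" by auto
  then obtain y where "y \<in> {1..n}" "orb p y \<noteq> orb p x" "card (orb p y) = c" by blast
  then show ?thesis using that[OF x(1)] x orb_eq by metis
qed

text \<open>The product sends x to p y and y to p x. Starting from x it runs through the orbit of y
  and, on reaching y, continues through the orbit of x. Other orbits contain neither point.\<close>

lemma orb_join:
  assumes "y \<notin> orb p x"
  shows "orb (p \<circ> transpose x y) x = orb p x \<union> orb p y"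
    and "z \<notin> orb p x \<union> orb p y \<Longrightarrow> orb (p \<circ> transpose x y) z = orb p z"
proof -
  have step: "s \<in> orb (p \<circ> transpose u v) u" if uv: "v \<notin> orb p u" and s: "s \<in> orb p v" for u v s
    using s
  proof induction
    case base
    show ?case using orbit.base[of "p \<circ> transpose u v" u] by (simp add: comp_def)
  next
    case (step s)
    show ?case
    proof (cases "s = v")
      case True
      then show ?thesis using orbit.base[of "p \<circ> transpose u v" u] by (simp add: comp_def)
    next
      case False
      have "s \<noteq> u" using step.hyps uv orb_eq orb_self by blast
      then show ?thesis using False orbit.step[OF step.IH] by (simp add: transpose_def)
    qed
  qed
  have xy: "x \<notin> orb p y" using assms orb_eq orb_self by blast
  have a: "orb p y \<subseteq> orb (p \<circ> transpose x y) x" using step[OF assms] by blast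
  then have "y \<in> orb (p \<circ> transpose x y) x" using orb_self by blast
  moreover have "orb p x \<subseteq> orb (p \<circ> transpose x y) y" using step[OF xy] by (auto simp: transpose_commute)
  ultimately have b: "orb p x \<subseteq> orb (p \<circ> transpose x y) x" using orbit_trans by (metis subset_iff)
  have "s \<in> orb p x \<union> orb p y" if "s \<in> orb (p \<circ> transpose x y) x" for s
    using that
  proof induction
    case base
    then show ?case using orbit.base[of p y] by simp
  next
    case (step s)
    then show ?case using orbit.base[of p x] orbit.step[of s p x] orbit.base[of p y] orbit.step[of s p y] by (auto simp: transpose_def)
  qed
  then show "orb (p \<circ> transpose x y) x = orb p x \<union> orb p y" using a b by blast
  show "orb (p \<circ> transpose x y) z = orb p z" if z: "z \<notin> orb p x \<union> orb p y"
  proof (rule orbit_cong[OF orb_self])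
    fix s assume "s \<in> orb p z"
    then have "s \<noteq> x" "s \<noteq> y" using z orb_eq orb_self by blast+
    then show "(p \<circ> transpose x y) s = p s" by (simp add: transpose_def)
  qed
qed

lemma cycles_join:
  assumes x: "x \<in> {1..n}" and y: "y \<in> {1..n}" and xy: "y \<notin> orb p x"
  shows "cycles n (p \<circ> transpose x y) + {#card (orb p x), card (orb p y)#} = cycles n p + {#card (orb p x) + card (orb p y)#}"
proof -
  let ?q = "p \<circ> transpose x y" and ?U = "orb p x \<union> orb p y"
  let ?R = "orb p ` {1..n} - {orb p x, orb p y}"
  have q: "?q permutes {1..n}" using p x y by (auto intro!: permutes_compose permutes_swap_id)
  have permq: "permutation ?q" using q permutation_permutes by blast
  have ne: "orb p x \<noteq> orb p y" using xy orb_self by blast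
  have "orb p ` {1..n} = insert (orb p x) (insert (orb p y) ?R)" using x y by auto
  then have "mset_set (orb p ` {1..n}) = mset_set (insert (orb p x) (insert (orb p y) ?R))" by simp
  also have "\<dots> = add_mset (orb p x) (add_mset (orb p y) (mset_set ?R))"
    using ne by (subst mset_set.insert; simp)+
  finally have 1: "cycles n p = image_mset card (mset_set ?R) + {#card (orb p x), card (orb p y)#}" by (simp add: cycles_def)
  have "orb ?q ` {1..n} = insert ?U ?R"
  proof (intro equalityI subsetI)
    fix K assume "K \<in> orb ?q ` {1..n}"
    then obtain z where z: "z \<in> {1..n}" "K = orb ?q z" by blast
    show "K \<in> insert ?U ?R"
    proof (cases "z \<in> ?U")
      case True
      then have "z \<in> orb ?q x" using orb_join(1)[OF xy] by simp
      then have "orb ?q z = orb ?q x" by (rule orbit_cyclic_eq3[OF cyclic_on_orbit'[OF permq]])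
      then show ?thesis using z orb_join(1)[OF xy] by simp
    next
      case False
      then have "orb p z \<noteq> orb p x" "orb p z \<noteq> orb p y" using orb_self[of z] by auto
      then show ?thesis using z orb_join(2)[OF xy False] by simp
    qed
  next
    fix K assume "K \<in> insert ?U ?R"
    then consider "K = ?U" | z where "z \<in> {1..n}" "K = orb p z" "orb p z \<noteq> orb p x" "orb p z \<noteq> orb p y" by blast
    then show "K \<in> orb ?q ` {1..n}"
    proof cases
      case 1
      then show ?thesis using orb_join(1)[OF xy] x by blast
    next
      case 2
      then have "z \<notin> ?U" using orb_eq by blast
      then show ?thesis using 2 orb_join(2)[OF xy] by blast
    qed
  qed
  moreover have "?U \<notin> ?R"
  proof
    assume "?U \<in> ?R"
    then obtain z where "?U = orb p z" by blast
    then have "orb p x = orb p z" "orb p y = orb p z" using orb_eq orb_self by blast+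
    then show False using ne by simp
  qed
  ultimately have "cycles n ?q = add_mset (card ?U) (image_mset card (mset_set ?R))" by (simp add: cycles_def)
  moreover have "card ?U = card (orb p x) + card (orb p y)"
    using orb_disjoint[OF xy] orb_finite by (simp add: card_Un_disjoint)
  ultimately show ?thesis using 1 by simp
qed

lemma orb_powers:
  shows "orb p x = (\<lambda>i. (p ^^ i) x) ` {..<card (orb p x)}" and "inj_on (\<lambda>i. (p ^^ i) x) {..<card (orb p x)}"
proof -
  have inj: "inj_on (\<lambda>i. (p ^^ i) x) {0..<funpow_dist1 p x x}" by (rule inj_on_funpow_dist1[OF orb_self])
  have o: "orb p x = (\<lambda>i. (p ^^ i) x) ` {0..<funpow_dist1 p x x}" by (rule orbit_conv_funpow_dist1[OF orb_self])
  then have "card (orb p x) = funpow_dist1 p x x" using card_image[OF inj] by simp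
  then show "orb p x = (\<lambda>i. (p ^^ i) x) ` {..<card (orb p x)}" "inj_on (\<lambda>i. (p ^^ i) x) {..<card (orb p x)}"
    using o inj by (simp_all add: lessThan_atLeast0)
qed

text \<open>The product sends y to p x and agrees with p strictly between x and y, so the path p x,
  ..., p^b x = y closes up.\<close>

lemma orb_split:
  assumes b: "0 < b" "b < card (orb p x)"
  defines "y \<equiv> (p ^^ b) x"
  shows "orb (p \<circ> transpose x y) y = (\<lambda>i. (p ^^ i) x) ` {1..b}"
proof -
  let ?z = "\<lambda>i. (p ^^ i) x" and ?q = "p \<circ> transpose x y"
  have inj: "?z i = ?z j \<Longrightarrow> i < card (orb p x) \<Longrightarrow> j < card (orb p x) \<Longrightarrow> i = j" for i j
    using inj_onD[OF orb_powers(2)] by auto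
  have qy: "?q y = ?z 1" by simp
  have qz: "?q (?z i) = ?z (Suc i)" if "0 < i" "i < b" for i
  proof -
    have "?z i \<noteq> x" using inj[of i 0] that b by auto
    moreover have "?z i \<noteq> y" using inj[of i b] that b unfolding y_def by auto
    ultimately show ?thesis by (simp add: transpose_def)
  qed
  show ?thesis
  proof (intro equalityI subsetI)
    fix s assume "s \<in> orb ?q y"
    then show "s \<in> ?z ` {1..b}"
    proof induction
      case base
      then show ?case unfolding qy using b by (intro imageI) auto
    next
      case (step s)
      then obtain i where i: "1 \<le> i" "i \<le> b" "s = ?z i" by auto
      show ?case
      proof (cases "i = b")
        case True
        then have q1: "?q s = ?z 1" using i qy unfolding y_def by simp
        show ?thesis unfolding q1 using b by (intro imageI) auto
      next
        case False
        then have "?q s = ?z (Suc i)" using qz[of i] i by simp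
        then show ?thesis using i False by (intro image_eqI[of _ _ "Suc i"]) auto
      qed
    qed
  next
    fix s assume "s \<in> ?z ` {1..b}"
    then obtain i where i: "1 \<le> i" "i \<le> b" "s = ?z i" by auto
    have "1 \<le> i \<Longrightarrow> i \<le> b \<Longrightarrow> ?z i \<in> orb ?q y" for i
    proof (induction i rule: nat_induct_at_least)
      case base
      then show ?case using orbit.base[of ?q y] unfolding qy by (simp add: comp_def)
    next
      case (Suc i)
      then show ?case using orbit.step[of "?z i" ?q y] qz[of i] by (simp add: comp_def)
    qed
    then show "s \<in> orb ?q y" using i by blast
  qed
qed

end

lemma transpose_permutes: "x \<in> {1..n} \<Longrightarrow> y \<in> {1..n} \<Longrightarrow> transpose x y permutes {1..(n::nat)}"
  by (rule permutes_swap_id)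

text \<open>Cutting is joining read backwards: multiplying by the transposition again restores p, so
  \<open>cycles_join\<close> applies to the product once x and y are known to lie in different
  cycles of it.\<close>

lemma cycles_split:
  assumes p: "p permutes {1..n}" and x: "x \<in> {1..n}" and b: "0 < b" "b < card (orb p x)"
  defines "y \<equiv> (p ^^ b) x"
  shows "x \<noteq> y" "y \<in> {1..n}" "cycles n p + {#card (orb p x) - b, b#} = cycles n (p \<circ> transpose x y) + {#card (orb p x)#}"
    "card (orb (p \<circ> transpose x y) y) = b"
proof -
  let ?q = "p \<circ> transpose x y" and ?z = "\<lambda>i. (p ^^ i) x"
  have inj: "?z i = ?z j \<Longrightarrow> i < card (orb p x) \<Longrightarrow> j < card (orb p x) \<Longrightarrow> i = j" for i j
    using inj_onD[OF orb_powers(2)[OF p]] by auto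
  show "x \<noteq> y" using inj[of 0 b] b unfolding y_def by auto
  have "y \<in> orb p x" unfolding y_def using orb_powers(1)[OF p, of x] b by blast
  then show y: "y \<in> {1..n}" using orb_sub[OF p x] by blast
  have q: "?q permutes {1..n}" using p x y by (intro permutes_compose transpose_permutes)
  have oy: "orb ?q y = ?z ` {1..b}" unfolding y_def by (rule orb_split[OF p b])
  have "inj_on ?z {1..b}" by (rule inj_onI) (use inj b in auto)
  then show cb: "card (orb ?q y) = b" using oy card_image by fastforce
  have "x \<notin> orb ?q y"
  proof
    assume "x \<in> orb ?q y"
    then obtain i where "1 \<le> i" "i \<le> b" "?z 0 = ?z i" unfolding oy by auto
    then show False using inj[of 0 i] b by auto
  qed
  then have xy: "y \<notin> orb ?q x" using orb_eq[OF q] orb_self[OF q] by blast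
  have q_q: "?q \<circ> transpose x y = p" by (simp add: comp_assoc)
  have "orb p x = orb ?q x \<union> orb ?q y" using orb_join(1)[OF q xy] unfolding q_q .
  then have "card (orb p x) = card (orb ?q x) + b"
    using orb_disjoint[OF q xy] orb_finite[OF q] cb by (simp add: card_Un_disjoint)
  then show "cycles n p + {#card (orb p x) - b, b#} = cycles n ?q + {#card (orb p x)#}"
    using cycles_join[OF q x y xy] cb unfolding q_q by simp
qed

text \<open>The relation between cycle types that differ by a transposition factor, directed from
  the coarser to the finer type.\<close>

definition split :: "nat multiset \<Rightarrow> nat multiset \<Rightarrow> bool" where
  "split M M' \<longleftrightarrow> (\<exists>b c. 0 < b \<and> 0 < c \<and> b + c \<in># M \<and> M' + {#b + c#} = M + {#b, c#})"

lemma transpose_split: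
  assumes p: "p permutes {1..n}" and x: "x \<in> {1..n}" and y: "y \<in> {1..n}" and "x \<noteq> y"
  shows "y \<in> orb p x \<Longrightarrow> split (cycles n p) (cycles n (p \<circ> transpose x y))"
    and "y \<notin> orb p x \<Longrightarrow> split (cycles n (p \<circ> transpose x y)) (cycles n p)"
proof -
  assume "y \<in> orb p x"
  then obtain b where b: "b < card (orb p x)" "y = (p ^^ b) x" using orb_powers(1)[OF p, of x] by blast
  then have b0: "0 < b" using \<open>x \<noteq> y\<close> by (cases b) auto
  show "split (cycles n p) (cycles n (p \<circ> transpose x y))"
    unfolding split_def using cycles_split(3)[OF p x b0 b(1)] b b0 cycles_mem[OF p x]
    by (intro exI[of _ "card (orb p x) - b"] exI[of _ b]) auto
next
  assume xy: "y \<notin> orb p x"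
  have q: "p \<circ> transpose x y permutes {1..n}" using p x y by (intro permutes_compose transpose_permutes)
  have pos: "0 < card (orb p z)" for z using orb_finite[OF p] orb_self[OF p] by (auto simp: card_gt_0_iff)
  have "card (orb (p \<circ> transpose x y) x) = card (orb p x) + card (orb p y)"
    unfolding orb_join(1)[OF p xy] using orb_disjoint[OF p xy] orb_finite[OF p] by (simp add: card_Un_disjoint)
  then have "card (orb p x) + card (orb p y) \<in># cycles n (p \<circ> transpose x y)" using cycles_mem[OF q x] by simp
  then show "split (cycles n (p \<circ> transpose x y)) (cycles n p)"
    unfolding split_def using cycles_join[OF p x y xy] pos by metis
qed

text \<open>Converse of \<open>transpose_split\<close>: a cycle of length b + c is cut between x and
  p^c x, and a join uses points of two different cycles of lengths b and c.\<close>

lemma split_transpose: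
  assumes p: "p permutes {1..n}" and s: "split (cycles n p) M \<or> split M (cycles n p)"
  obtains x y where "x \<in> {1..n}" "y \<in> {1..n}" "x \<noteq> y" "cycles n (p \<circ> transpose x y) = M"
  using s
proof
  assume "split (cycles n p) M"
  then obtain b c where bc: "0 < b" "0 < c" "b + c \<in># cycles n p" "M + {#b + c#} = cycles n p + {#b, c#}"
    by (auto simp: split_def)
  obtain x where x: "x \<in> {1..n}" "card (orb p x) = b + c" using bc(3) by (rule cycles_obtain[OF p])
  have c: "c < card (orb p x)" using bc x by simp
  have "cycles n (p \<circ> transpose x ((p ^^ c) x)) = M"
    using cycles_split(3)[OF p x(1) bc(2) c] x(2) bc(4) by simp
  then show thesis using that[OF x(1) cycles_split(2)[OF p x(1) bc(2) c] cycles_split(1)[OF p x(1) bc(2) c]] by blast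
next
  assume "split M (cycles n p)"
  then obtain b c where bc: "0 < b" "0 < c" "b + c \<in># M" "cycles n p + {#b + c#} = M + {#b, c#}"
    by (auto simp: split_def)
  then obtain M0 where M0: "M = add_mset (b + c) M0" by (metis mset_add)
  then have "cycles n p = M0 + {#b, c#}" using bc(4) by simp
  then have "{#b, c#} \<subseteq># cycles n p" by simp
  then obtain x y where xy: "x \<in> {1..n}" "y \<in> {1..n}" "y \<notin> orb p x" "card (orb p x) = b" "card (orb p y) = c"
    by (rule two_cycles[OF p])
  have "cycles n (p \<circ> transpose x y) = M" using cycles_join[OF p xy(1,2,3)] xy(4,5) bc(4) by simp
  moreover have "x \<noteq> y" using xy(3) orb_self[OF p] by blast
  ultimately show thesis using that xy by blast
qed

lemma cycles_id: "cycles n id = replicate_mset n 1"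
proof -
  have "orb id x = {x}" for x :: nat by (simp add: orbit_eq_singleton_iff)
  then have "orb id ` {1..n} = (\<lambda>x. {x}) ` {1..n}" by auto
  then have "cycles n id = image_mset card (image_mset (\<lambda>x. {x}) (mset_set {1..n}))"
    unfolding cycles_def by (subst image_mset_mset_set) auto
  then show ?thesis by (simp add: multiset.map_comp comp_def image_mset_const_eq)
qed

lemma size_parts: "M \<in> parts n \<Longrightarrow> size M \<le> n"
proof (induction M arbitrary: n)
  case (add a M)
  then have "M \<in> parts (n - a)" "0 < a" "a \<le> n" by (auto simp: parts_def)
  then show ?case using add.IH[of "n - a"] by simp
qed (simp add: parts_def)

lemma parts_all_ones: "M \<in> parts n \<Longrightarrow> (\<And>a. a \<in># M \<Longrightarrow> a < 2) \<Longrightarrow> M = replicate_mset n 1"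
proof (induction M arbitrary: n)
  case (add a M)
  then have "a \<noteq> 0" "a < 2" by (auto simp: parts_def)
  then have a: "a = 1" by simp
  then have "M \<in> parts (n - 1)" "n \<ge> 1" using add.prems by (auto simp: parts_def)
  then have "M = replicate_mset (n - 1) 1" using add by simp
  then show ?case using a \<open>n \<ge> 1\<close> by (cases n) auto
qed (simp add: parts_def)

text \<open>Peel a 1 off some part of size at least 2, realise the finer type by induction, and join
  the two cycles by a transposition. If there is no such part, the identity serves.\<close>

lemma ex_cycles: "M \<in> parts n \<Longrightarrow> \<exists>p. p permutes {1..n} \<and> cycles n p = M"
proof (induction "n - size M" arbitrary: M rule: less_induct)
  case less
  show ?case
  proof (cases "\<exists>a. a \<in># M \<and> 2 \<le> a")
    case False
    then have "M = replicate_mset n 1" using parts_all_ones[OF less.prems] by (meson not_less)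
    then show ?thesis using cycles_id permutes_id by blast
  next
    case True
    then obtain a M0 where a: "2 \<le> a" "M = add_mset a M0" by (metis mset_add)
    let ?M = "M0 + {#a - 1, 1#}"
    have M: "?M \<in> parts n" using less.prems a by (auto simp: parts_def)
    then have "size ?M \<le> n" by (rule size_parts)
    then have "n - size ?M < n - size M" using a by simp
    then obtain p where p: "p permutes {1..n}" "cycles n p = ?M" using less.hyps[OF _ M] by blast
    have "split M (cycles n p)" unfolding split_def using p a by (intro exI[of _ "a - 1"] exI[of _ 1]) auto
    then obtain x y where "x \<in> {1..n}" "y \<in> {1..n}" "cycles n (p \<circ> transpose x y) = M"
      using split_transpose[OF p(1)] by metis
    then show ?thesis using p(1) permutes_compose transpose_permutes by blast
  qed
qed

lemma cycles_inv: "p permutes {1..n} \<Longrightarrow> cycles n (inv' p) = cycles n p"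
  using orbit_inv_eq[OF perm_p] by (simp add: cycles_def)

lemma cycles_conj:
  assumes p: "p permutes {1..n}" and z: "z permutes {1..n}"
  shows "cycles n (z \<circ> p \<circ> inv' z) = cycles n p"
proof -
  have o: "orb (z \<circ> p \<circ> inv' z) (z x) = z ` orb p x" for x
    by (rule orbit_inverse[OF orb_self[OF p], symmetric]) (simp add: permutes_inverses[OF z])
  have "orb (z \<circ> p \<circ> inv' z) ` {1..n} = orb (z \<circ> p \<circ> inv' z) ` z ` {1..n}" using permutes_image[OF z] by simp
  also have "\<dots> = (\<lambda>K. z ` K) ` orb p ` {1..n}" by (simp add: image_image o)
  finally have "orb (z \<circ> p \<circ> inv' z) ` {1..n} = (\<lambda>K. z ` K) ` orb p ` {1..n}" .
  moreover have "inj ((`) z)" using permutes_inj[OF z] by (metis inj_image_eq_iff injI)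
  ultimately have "cycles n (z \<circ> p \<circ> inv' z) = image_mset (\<lambda>K. card (z ` K)) (mset_set (orb p ` {1..n}))"
    unfolding cycles_def by (simp add: image_mset_mset_set[symmetric] inj_on_subset[OF _ subset_UNIV] multiset.map_comp comp_def)
  also have "\<dots> = cycles n p" unfolding cycles_def
    using card_image[OF inj_on_subset[OF permutes_inj[OF z] subset_UNIV]] by simp
  finally show ?thesis .
qed

section \<open>Structure constants from a labelled table\<close>

lemma (in absolutely_irreducible) character_mult_commute:
  assumes "g \<in> carrier G" "h \<in> carrier G"
  shows "\<chi> (g \<otimes> h) = \<chi> (h \<otimes> g)"
proof -
  have "\<chi> (g \<otimes> h) = (\<Sum>b\<in>B. \<Sum>c\<in>B. R g b c * R h c b)" using assms by (simp add: chi_R R_mult)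
  also have "\<dots> = (\<Sum>c\<in>B. \<Sum>b\<in>B. R h c b * R g b c)" by (subst sum.swap) (simp add: mult.commute)
  also have "\<dots> = \<chi> (h \<otimes> g)" using assms by (simp add: chi_R R_mult)
  finally show ?thesis .
qed

text \<open>Isolates the converse of \<open>cycles_conj\<close>. It is supplied later from the size
  of the table, in \<open>same_type_conjugate_if_card\<close>.\<close>

locale same_type_conjugate =
  fixes n :: nat
  assumes conj: "\<And>p q. p permutes {1..n} \<Longrightarrow> q permutes {1..n} \<Longrightarrow> cycles n p = cycles n q \<Longrightarrow>
    \<exists>z. z permutes {1..n} \<and> q = z \<circ> p \<circ> inv' z"
begin

lemma ai: "\<mu> \<in> partitions_of n \<Longrightarrow> absolutely_irreducible (sym_group n) (specht_module \<mu>) tabloid_action"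
  by (intro shape.specht_absolutely_irreducible shape.intro)

lemma specht_conj:
  assumes \<mu>: "\<mu> \<in> partitions_of n" and p: "p permutes {1..n}" and z: "z permutes {1..n}"
  shows "specht_character \<mu> (z \<circ> p \<circ> inv' z) = specht_character \<mu> p"
proof -
  interpret absolutely_irreducible "sym_group n" "specht_module \<mu>" tabloid_action by (rule ai[OF \<mu>])
  have "inv' z \<circ> (z \<circ> p) = p" by (simp add: fun_eq_iff permutes_inverses[OF z])
  then show ?thesis
    using character_mult_commute[of "z \<circ> p" "inv' z"] p z
    by (simp add: sym_group_simps permutes_compose permutes_inv specht_character_def)
qed

lemma specht_same_type:
  assumes "\<mu> \<in> partitions_of n" "p permutes {1..n}" "q permutes {1..n}" "cycles n p = cycles n q"
  shows "specht_character \<mu> p = specht_character \<mu> q"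
  using conj[OF assms(2-4)] specht_conj[OF assms(1,2)] by metis

lemma chi_eq:
  assumes \<mu>: "\<mu> \<in> partitions_of n" and p: "p permutes {1..n}" and \<nu>: "cycle_type n p = \<nu>"
  shows "chi \<mu> \<nu> = specht_character \<mu> p"
proof -
  have sum: "sum_list \<nu> = n" using cycle_type_partition[OF p] \<nu> by (auto simp: partitions_of_def)
  define q where "q = (SOME p. p \<in> carrier (sym_group n) \<and> cycle_type n p = \<nu>)"
  have "q \<in> carrier (sym_group n) \<and> cycle_type n q = \<nu>"
    unfolding q_def by (rule someI[of _ p]) (use p \<nu> in \<open>simp add: sym_group_simps\<close>)
  then have "q permutes {1..n}" "cycles n q = cycles n p" using \<nu> cycle_type_eq_iff by (auto simp: sym_group_simps)
  then show ?thesis unfolding chi_def sum q_def[symmetric] using specht_same_type[OF \<mu>] p by blast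
qed

text \<open>A permutation and its inverse have the same type, so no inverse remains in the formula.
  The sum is then symmetric in the two shapes, and whichever direction of
  \<open>specht_no_intertwiner\<close> holds can be used.\<close>

lemma specht_orthogonal:
  assumes \<mu>: "\<mu> \<in> partitions_of n" and \<nu>: "\<nu> \<in> partitions_of n"
  shows "(\<Sum>g | g permutes {1..n}. specht_character \<mu> g * specht_character \<nu> g) = (if \<mu> = \<nu> then fact n else 0)"
proof -
  interpret M: absolutely_irreducible "sym_group n" "specht_module \<mu>" tabloid_action by (rule ai[OF \<mu>])
  interpret N: absolutely_irreducible "sym_group n" "specht_module \<nu>" tabloid_action by (rule ai[OF \<nu>])
  have inv: "specht_character \<mu> (inv' g) = specht_character \<mu> g" if "g permutes {1..n}" "\<mu> \<in> partitions_of n" for g \<mu>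
    using specht_same_type[OF that(2) permutes_inv[OF that(1)] that(1)] cycles_inv[OF that(1)] by blast
  have *: "(\<Sum>g | g permutes {1..n}. specht_character \<mu> g * specht_character \<nu> g) = 
      (\<Sum>g\<in>carrier (sym_group n). rep_character (specht_module \<mu>) tabloid_action g * rep_character (specht_module \<nu>) tabloid_action (inv\<^bsub>sym_group n\<^esub> g))"
    if "\<mu> \<in> partitions_of n" "\<nu> \<in> partitions_of n" for \<mu> \<nu>
    using inv[OF _ that(2)] by (intro sum.cong) (auto simp: sym_group_simps sym_group_inv specht_character_def)
  show ?thesis
  proof (cases "\<mu> = \<nu>")
    case True
    then show ?thesis using *[OF \<mu> \<mu>] M.character_norm order_sym_group by simp
  next
    case False
    have s: "shape n \<mu>" "shape n \<nu>" using \<mu> \<nu> by (auto intro: shape.intro)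
    have comm: "(\<Sum>g | g permutes {1..n}. specht_character \<mu> g * specht_character \<nu> g) = 
        (\<Sum>g | g permutes {1..n}. specht_character \<nu> g * specht_character \<mu> g)" by (simp add: mult.commute)
    have "(\<Sum>g | g permutes {1..n}. specht_character \<mu> g * specht_character \<nu> g) = 0"
      using s False
    proof (rule specht_no_intertwiner)
      assume "\<And>f v. f \<in> intertwiners (sym_group n) (specht_module \<mu>) tabloid_action (specht_module \<nu>) tabloid_action \<Longrightarrow> v \<in> specht_module \<mu> \<Longrightarrow> f v = 0"
      then show ?thesis unfolding comm *[OF \<nu> \<mu>] by (rule M.character_orthogonal[OF N.rep M.rep])
    next
      assume "\<And>f v. f \<in> intertwiners (sym_group n) (specht_module \<nu>) tabloid_action (specht_module \<mu>) tabloid_action \<Longrightarrow> v \<in> specht_module \<nu> \<Longrightarrow> f v = 0"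
      then show ?thesis unfolding *[OF \<mu> \<nu>] by (rule M.character_orthogonal[OF M.rep N.rep])
    qed
    then show ?thesis using False by simp
  qed
qed

lemma specht_id:
  assumes \<mu>: "\<mu> \<in> partitions_of n"
  shows "\<exists>d>0. specht_character \<mu> id = of_nat d"
proof -
  interpret M: absolutely_irreducible "sym_group n" "specht_module \<mu>" tabloid_action by (rule ai[OF \<mu>])
  show ?thesis
    using M.chi_one M.d_nonzero by (auto simp: M.d_def sym_group_simps specht_character_def intro!: exI[of _ "card M.B"])
qed

lemma specht_conjugate_average:
  assumes \<mu>: "\<mu> \<in> partitions_of n" and x: "x permutes {1..n}" and y: "y permutes {1..n}"
  shows "(\<Sum>z | z permutes {1..n}. specht_character \<mu> (x \<circ> (z \<circ> y \<circ> inv' z))) =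
    fact n * specht_character \<mu> x * specht_character \<mu> y / specht_character \<mu> id"
proof -
  interpret M: absolutely_irreducible "sym_group n" "specht_module \<mu>" tabloid_action by (rule ai[OF \<mu>])
  have "(\<Sum>z | z permutes {1..n}. specht_character \<mu> (x \<circ> (z \<circ> y \<circ> inv' z))) =
    (\<Sum>z\<in>carrier (sym_group n). rep_character (specht_module \<mu>) tabloid_action
       (x \<otimes>\<^bsub>sym_group n\<^esub> (z \<otimes>\<^bsub>sym_group n\<^esub> y \<otimes>\<^bsub>sym_group n\<^esub> inv\<^bsub>sym_group n\<^esub> z)))"
    by (intro sum.cong) (auto simp: sym_group_simps sym_group_inv specht_character_def)
  then show ?thesis using M.character_conjugate_average[of x y] x y order_sym_group
    by (simp add: sym_group_simps specht_character_def)
qed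

end

locale labelled = same_type_conjugate +
  fixes X :: "complex mat" and \<alpha> \<beta> :: "nat \<Rightarrow> nat list" and k :: nat
  defines "k \<equiv> card (partitions_of n)"
  assumes X: "X \<in> carrier_mat k k" and lab: "(\<alpha>, \<beta>) \<in> labellings n X"
begin

lemma dims: "dim_row X = k" "dim_col X = k" using X by auto

lemma bij_\<alpha>: "bij_betw \<alpha> {..<k} (partitions_of n)" and bij_\<beta>: "bij_betw \<beta> {..<k} (partitions_of n)"
  and entry_chi: "i < k \<Longrightarrow> j < k \<Longrightarrow> X $$ (i, j) = chi (\<alpha> i) (\<beta> j)"
  using lab dims by (auto simp: labellings_def)

lemma \<alpha>_mem: "i < k \<Longrightarrow> \<alpha> i \<in> partitions_of n" and \<beta>_mem: "j < k \<Longrightarrow> \<beta> j \<in> partitions_of n"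
  using bij_\<alpha> bij_\<beta> bij_betw_apply by fastforce+

lemma \<alpha>_inj: "i < k \<Longrightarrow> i' < k \<Longrightarrow> \<alpha> i = \<alpha> i' \<longleftrightarrow> i = i'" and \<beta>_inj: "j < k \<Longrightarrow> j' < k \<Longrightarrow> \<beta> j = \<beta> j' \<longleftrightarrow> j = j'"
  using bij_\<alpha> bij_\<beta> unfolding bij_betw_def inj_on_def by auto

lemma \<beta>_surj: "\<nu> \<in> partitions_of n \<Longrightarrow> \<exists>j<k. \<beta> j = \<nu>"
  using bij_\<beta> unfolding bij_betw_def by (metis image_iff lessThan_iff)

text \<open>The permutations that this particular labelling attaches to column j; another labelling
  of the same matrix may attach others.\<close>

definition cl where "cl j = {g. g permutes {1..n} \<and> cycle_type n g = \<beta> j}"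

lemma entry: "i < k \<Longrightarrow> j < k \<Longrightarrow> g \<in> cl j \<Longrightarrow> X $$ (i, j) = specht_character (\<alpha> i) g"
  using entry_chi chi_eq[OF \<alpha>_mem] by (simp add: cl_def)

lemma finite_cl: "finite (cl j)"
  by (rule finite_subset[OF _ finite_permutations[of "{1..n}"]]) (auto simp: cl_def)

lemma cl_nonempty:
  assumes "j < k" shows "cl j \<noteq> {}"
proof -
  have "mset (\<beta> j) \<in> parts n" using bij_betw_apply[OF bij_mset_partitions \<beta>_mem[OF assms]] .
  then obtain p where p: "p permutes {1..n}" "cycles n p = mset (\<beta> j)" using ex_cycles by blast
  then have "cycle_type n p = \<beta> j"
    using sorted_desc_mset_inj[OF sorted_cycle_type] mset_cycle_type \<beta>_mem[OF assms] by (auto simp: partitions_of_def)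
  then show ?thesis using p by (auto simp: cl_def)
qed

lemma card_cl: "j < k \<Longrightarrow> card (cl j) > 0"
  using cl_nonempty finite_cl by (simp add: card_gt_0_iff)

lemma sum_classes: "(\<Sum>g | g permutes {1..n}. F g) = (\<Sum>j<k. \<Sum>g\<in>cl j. F g)"
proof -
  have "{g. g permutes {1..n}} = (\<Union>j\<in>{..<k}. cl j)"
  proof (intro equalityI subsetI)
    fix g assume g: "g \<in> {g. g permutes {1..n}}"
    then obtain j where "j < k" "\<beta> j = cycle_type n g" using \<beta>_surj[OF cycle_type_partition] by blast
    then have "g \<in> cl j" using g by (simp add: cl_def)
    then show "g \<in> (\<Union>j\<in>{..<k}. cl j)" using \<open>j < k\<close> by blast
  qed (auto simp: cl_def)
  moreover have "cl j \<inter> cl j' = {}" if "j < k" "j' < k" "j \<noteq> j'" for j j'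
    using \<beta>_inj that by (auto simp: cl_def)
  ultimately show ?thesis using finite_cl by (simp add: sum.UNION_disjoint)
qed

lemma row_orthogonal:
  assumes "i < k" "i' < k"
  shows "(\<Sum>j<k. of_nat (card (cl j)) * X $$ (i, j) * X $$ (i', j)) = (if i = i' then fact n else 0)"
proof -
  have "(\<Sum>j<k. of_nat (card (cl j)) * X $$ (i, j) * X $$ (i', j)) =
      (\<Sum>j<k. \<Sum>g\<in>cl j. specht_character (\<alpha> i) g * specht_character (\<alpha> i') g)"
  proof (intro sum.cong refl)
    fix j assume "j \<in> {..<k}"
    then have "(\<Sum>g\<in>cl j. specht_character (\<alpha> i) g * specht_character (\<alpha> i') g) = (\<Sum>g\<in>cl j. X $$ (i, j) * X $$ (i', j))"
      using entry assms by (intro sum.cong refl) simp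
    then show "of_nat (card (cl j)) * X $$ (i, j) * X $$ (i', j) = (\<Sum>g\<in>cl j. specht_character (\<alpha> i) g * specht_character (\<alpha> i') g)"
      by (simp add: mult.assoc)
  qed
  also have "\<dots> = (\<Sum>g | g permutes {1..n}. specht_character (\<alpha> i) g * specht_character (\<alpha> i') g)"
    by (rule sum_classes[symmetric])
  finally show ?thesis using specht_orthogonal[OF \<alpha>_mem \<alpha>_mem] \<alpha>_inj assms by simp
qed

text \<open>Row orthogonality says that X times a weighted transpose is the identity matrix. For a
  square matrix the reversed product is the identity too, and its entries are the column
  relations.\<close>

lemma column_orthogonal:
  assumes j: "j < k" "j' < k"
  shows "of_nat (card (cl j)) * (\<Sum>i<k. X $$ (i, j) * X $$ (i, j')) = (if j = j' then fact n else 0)"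
proof -
  define Y where "Y = mat k k (\<lambda>(j, i). of_nat (card (cl j)) / fact n * X $$ (i, j))"
  have Y: "Y \<in> carrier_mat k k" by (simp add: Y_def)
  have "X * Y = 1\<^sub>m k"
  proof (rule eq_matI)
    fix i i' assume "i < dim_row (1\<^sub>m k :: complex mat)" "i' < dim_col (1\<^sub>m k :: complex mat)"
    then have i: "i < k" "i' < k" by auto
    have "(X * Y) $$ (i, i') = (\<Sum>j<k. X $$ (i, j) * (of_nat (card (cl j)) / fact n * X $$ (i', j)))"
      using i X by (simp add: scalar_prod_def Y_def lessThan_atLeast0)
    also have "\<dots> = (\<Sum>j<k. of_nat (card (cl j)) * X $$ (i, j) * X $$ (i', j)) / fact n"
      by (simp add: sum_divide_distrib mult_ac)
    also have "\<dots> = 1\<^sub>m k $$ (i, i')" using row_orthogonal[OF i] i by simp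
    finally show "(X * Y) $$ (i, i') = 1\<^sub>m k $$ (i, i')" .
  qed (use X Y in auto)
  then have YX: "Y * X = 1\<^sub>m k" by (rule mat_mult_left_right_inverse[OF X Y])
  have "(Y * X) $$ (j, j') = (\<Sum>i<k. of_nat (card (cl j)) / fact n * X $$ (i, j) * X $$ (i, j'))"
    using j X by (simp add: scalar_prod_def Y_def lessThan_atLeast0)
  then have "(\<Sum>i<k. of_nat (card (cl j)) / fact n * X $$ (i, j) * X $$ (i, j')) = (if j = j' then 1 else 0)"
    unfolding YX using j by simp
  moreover have "(\<Sum>i<k. of_nat (card (cl j)) / fact n * X $$ (i, j) * X $$ (i, j')) =
      of_nat (card (cl j)) * (\<Sum>i<k. X $$ (i, j) * X $$ (i, j')) / fact n"
    by (simp add: sum_distrib_left sum_divide_distrib mult_ac)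
  ultimately show ?thesis by (auto simp: field_simps split: if_splits)
qed

definition j0 where "j0 = (THE j. j < k \<and> \<beta> j = cycle_type n id)"

lemma j0: "j0 < k" "\<beta> j0 = cycle_type n id"
proof -
  have "\<exists>!j. j < k \<and> \<beta> j = cycle_type n id"
    using \<beta>_surj[OF cycle_type_partition[OF permutes_id]] \<beta>_inj by metis
  then have "j0 < k \<and> \<beta> j0 = cycle_type n id" unfolding j0_def by (rule theI')
  then show "j0 < k" "\<beta> j0 = cycle_type n id" by auto
qed

lemma entry_j0: "i < k \<Longrightarrow> X $$ (i, j0) = specht_character (\<alpha> i) id"
  using entry j0 permutes_id by (simp add: cl_def)

lemma degree_column: "i < k \<Longrightarrow> \<exists>d>0. X $$ (i, j0) = of_nat d"
  using entry_j0 specht_id[OF \<alpha>_mem] by simp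

text \<open>Two different columns of positive integers cannot be orthogonal. This recognises the
  identity column without using labels.\<close>

lemma degree_column_unique:
  assumes j: "j < k" and pos: "\<And>i. i < k \<Longrightarrow> \<exists>d>0. X $$ (i, j) = of_nat d"
  shows "j = j0"
proof (rule ccontr)
  assume "j \<noteq> j0"
  obtain d where d: "\<And>i. i < k \<Longrightarrow> d i > 0 \<and> X $$ (i, j) = of_nat (d i)" using pos by metis
  obtain e where e: "\<And>i. i < k \<Longrightarrow> e i > 0 \<and> X $$ (i, j0) = of_nat (e i)" using degree_column by metis
  have "of_nat (card (cl j)) * (\<Sum>i<k. X $$ (i, j) * X $$ (i, j0)) = of_nat (card (cl j) * (\<Sum>i<k. d i * e i))"
    using d e by simp
  then have "card (cl j) * (\<Sum>i<k. d i * e i) = 0"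
    using column_orthogonal[OF j j0(1)] \<open>j \<noteq> j0\<close> by (metis of_nat_eq_0_iff)
  \<comment> \<open>Any row would do; as the table is square, the column index j serves as a row
    index.\<close>
  then have "d j * e j = 0" using card_cl[OF j] j by simp
  then show False using d[OF j] e[OF j] by simp
qed

text \<open>Counts conjugating elements z instead of conjugates of y, to match
  \<open>specht_conjugate_average\<close>. It is the class multiplication constant times the order
  of the centralizer of y.\<close>

definition class_mult where "class_mult x y j = card {z. z permutes {1..n} \<and> cycle_type n (x \<circ> (z \<circ> y \<circ> inv' z)) = \<beta> j}"

text \<open>Column orthogonality writes the indicator of class j3 as a combination of characters,
  whose averages over z are known. The right-hand side mentions only X and \<open>j0\<close>, so it
  is the same for all labellings.\<close>

lemma class_mult_formula:
  assumes j: "j1 < k" "j2 < k" "j3 < k" and x: "x \<in> cl j1" and y: "y \<in> cl j2"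
  shows "of_nat (class_mult x y j3) =
    (\<Sum>i<k. X $$ (i, j1) * X $$ (i, j2) * X $$ (i, j3) / X $$ (i, j0)) * fact n / (\<Sum>i<k. X $$ (i, j3) * X $$ (i, j3))"
proof -
  let ?w = "\<lambda>z. x \<circ> (z \<circ> y \<circ> inv' z)" and ?c = "of_nat (card (cl j3)) :: complex"
  let ?P = "{z. z permutes {1..n}}"
  have xp: "x permutes {1..n}" and yp: "y permutes {1..n}" using x y by (auto simp: cl_def)
  have w: "?w z permutes {1..n}" if "z permutes {1..n}" for z
    using that xp yp by (intro permutes_compose permutes_inv)
  \<comment> \<open>The indicator function of the class j3, scaled by n!.\<close>
  have "?c * (\<Sum>i<k. X $$ (i, j3) * specht_character (\<alpha> i) (?w z)) = (if cycle_type n (?w z) = \<beta> j3 then fact n else 0)"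
    if z: "z permutes {1..n}" for z
  proof -
    obtain j where jj: "j < k" "\<beta> j = cycle_type n (?w z)" using \<beta>_surj[OF cycle_type_partition[OF w[OF z]]] by blast
    then have "?w z \<in> cl j" using w[OF z] by (simp add: cl_def)
    then have "?c * (\<Sum>i<k. X $$ (i, j3) * specht_character (\<alpha> i) (?w z)) = ?c * (\<Sum>i<k. X $$ (i, j3) * X $$ (i, j))"
      using entry jj(1) by simp
    also have "\<dots> = (if cycle_type n (?w z) = \<beta> j3 then fact n else 0)"
      using column_orthogonal[OF j(3) jj(1)] \<beta>_inj[OF jj(1) j(3)] jj(2) by auto
    finally show ?thesis .
  qed
  then have "(\<Sum>z\<in>?P. ?c * (\<Sum>i<k. X $$ (i, j3) * specht_character (\<alpha> i) (?w z))) = 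
      (\<Sum>z\<in>?P. if cycle_type n (?w z) = \<beta> j3 then fact n else 0)" by (intro sum.cong) auto
  also have "\<dots> = of_nat (class_mult x y j3) * fact n"
    unfolding class_mult_def using finite_permutations[of "{1..n}"]
    by (simp add: sum.If_cases Collect_conj_eq)
  finally have 1: "(\<Sum>z\<in>?P. ?c * (\<Sum>i<k. X $$ (i, j3) * specht_character (\<alpha> i) (?w z))) = of_nat (class_mult x y j3) * fact n" .
  have "(\<Sum>z\<in>?P. ?c * (\<Sum>i<k. X $$ (i, j3) * specht_character (\<alpha> i) (?w z))) =
      ?c * (\<Sum>i<k. X $$ (i, j3) * (\<Sum>z\<in>?P. specht_character (\<alpha> i) (?w z)))"
    unfolding sum_distrib_left by (rule sum.swap)
  also have "\<dots> = ?c * (\<Sum>i<k. X $$ (i, j3) * (fact n * X $$ (i, j1) * X $$ (i, j2) / X $$ (i, j0)))"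
    using specht_conjugate_average[OF \<alpha>_mem xp yp] entry x y j entry_j0 by simp
  also have "\<dots> = ?c * fact n * (\<Sum>i<k. X $$ (i, j1) * X $$ (i, j2) * X $$ (i, j3) / X $$ (i, j0))"
    by (simp add: sum_distrib_left mult_ac)
  finally have 2: "of_nat (class_mult x y j3) = ?c * (\<Sum>i<k. X $$ (i, j1) * X $$ (i, j2) * X $$ (i, j3) / X $$ (i, j0))"
    using 1 by simp
  \<comment> \<open>The class size is a priori tied to the labelling; the sum of squares of column
    j3 eliminates it.\<close>
  have c: "?c * (\<Sum>i<k. X $$ (i, j3) * X $$ (i, j3)) = fact n" using column_orthogonal[OF j(3) j(3)] by simp
  then have "(\<Sum>i<k. X $$ (i, j3) * X $$ (i, j3)) \<noteq> 0" by (metis fact_nonzero mult_zero_right)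
  then have "?c = fact n / (\<Sum>i<k. X $$ (i, j3) * X $$ (i, j3))" using c by (simp add: field_simps)
  then show ?thesis using 2 by simp
qed

end

section \<open>Comparison of two labellings of one table\<close>

locale two_labellings = L: labelled n X \<alpha> \<beta> + L': labelled n X \<alpha>' \<beta>' for n X \<alpha> \<beta> \<alpha>' \<beta>'
begin

lemma j0_eq: "L.j0 = L'.j0"
  using L'.degree_column_unique[OF L.j0(1)] L.degree_column by blast

lemma class_mult_eq:
  assumes "j1 < k" "j2 < k" "j3 < k" "x \<in> L.cl j1" "y \<in> L.cl j2" "x' \<in> L'.cl j1" "y' \<in> L'.cl j2"
  shows "L.class_mult x y j3 = L'.class_mult x' y' j3"
proof -
  have "(of_nat (L.class_mult x y j3) :: complex) = of_nat (L'.class_mult x' y' j3)"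
    unfolding L.class_mult_formula[OF assms(1-5)] L'.class_mult_formula[OF assms(1-3,6,7)] j0_eq ..
  then show ?thesis by (simp only: of_nat_eq_iff)
qed

text \<open>With equal column labels, the two Specht characters of a row agree on all permutations,
  and orthogonality separates characters of different shapes.\<close>

lemma eq_if_columns_eq:
  assumes \<beta>: "\<And>j. j < k \<Longrightarrow> \<beta> j = \<beta>' j"
  shows "(\<alpha>, \<beta>) = (\<alpha>', \<beta>')"
proof -
  have ext: "\<alpha> \<in> extensional {..<k}" "\<alpha>' \<in> extensional {..<k}" "\<beta> \<in> extensional {..<k}" "\<beta>' \<in> extensional {..<k}"
    using L.lab L'.lab L.dims by (auto simp: labellings_def)
  have "\<alpha> i = \<alpha>' i" if i: "i < k" for i
  proof (rule ccontr)
    assume ne: "\<alpha> i \<noteq> \<alpha>' i"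
    have "specht_character (\<alpha> i) g = specht_character (\<alpha>' i) g" if g: "g permutes {1..n}" for g
    proof -
      obtain j where j: "j < k" "\<beta> j = cycle_type n g" using L.\<beta>_surj[OF cycle_type_partition[OF g]] by blast
      then have "g \<in> L.cl j" "g \<in> L'.cl j" using g \<beta>[OF j(1)] by (auto simp: L.cl_def L'.cl_def)
      then show ?thesis using L.entry[OF i j(1)] L'.entry[OF i j(1)] by simp
    qed
    then have "(\<Sum>g | g permutes {1..n}. specht_character (\<alpha> i) g * specht_character (\<alpha>' i) g) =
        (\<Sum>g | g permutes {1..n}. specht_character (\<alpha> i) g * specht_character (\<alpha> i) g)" by (intro sum.cong) auto
    then show False using L.specht_orthogonal[OF L.\<alpha>_mem[OF i] L'.\<alpha>_mem[OF i]]
      L.specht_orthogonal[OF L.\<alpha>_mem[OF i] L.\<alpha>_mem[OF i]] ne by simp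
  qed
  then show ?thesis using ext \<beta> by (auto intro: extensionalityI)
qed

end

section \<open>Cycle types are determined by how they split\<close>

lemma splitI: "0 < b \<Longrightarrow> 0 < c \<Longrightarrow> split (add_mset (b + c) M) (M + {#b, c#})"
  unfolding split_def by (intro exI[of _ b] exI[of _ c]) auto

lemma split_one: "2 \<le> a \<Longrightarrow> split (add_mset a M) (M + {#a - 1, 1#})"
  using splitI[of "a - 1" 1 M] by simp

lemma splitE:
  assumes "split M N"
  obtains b c M0 where "0 < b" "0 < c" "M = add_mset (b + c) M0" "N = M0 + {#b, c#}"
proof -
  obtain b c where bc: "0 < b" "0 < c" "b + c \<in># M" "N + {#b + c#} = M + {#b, c#}" using assms by (auto simp: split_def)
  obtain M0 where "M = add_mset (b + c) M0" using bc(3) by (metis mset_add)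
  then show ?thesis using that bc by auto
qed

lemma split_size: "split M N \<Longrightarrow> size N = Suc (size M)"
  by (auto elim: splitE)

lemma split_parts: "split M N \<Longrightarrow> M \<in> parts n \<Longrightarrow> N \<in> parts n"
  by (auto elim!: splitE simp: parts_def)

text \<open>A maximal part cannot arise as a proper piece of another part, and only one part is
  cut.\<close>

lemma split_count_top:
  assumes "split M N" "\<And>b. b \<in># M \<Longrightarrow> b \<le> a"
  shows "count N a \<le> count M a" "count M a \<le> Suc (count N a)"
proof -
  obtain b c M0 where "0 < b" "0 < c" "M = add_mset (b + c) M0" "N = M0 + {#b, c#}" using assms(1) by (rule splitE)
  moreover from this have "b + c \<le> a" using assms(2) by simp
  ultimately show "count N a \<le> count M a" "count M a \<le> Suc (count N a)" by auto
qed

text \<open>Compare the multiplicities of the largest part a. If they agree, splitting off a 1 from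
  an a must also cut an a in the other multiset, and counting ones matches the remainders. If M has
  more, its other parts are all ones, and M' must be {a - 1, 2} with ones; comparing further splits
  leaves a = 3 and a = 4, which are genuine exceptions.\<close>

lemma same_splits_aux:
  assumes M: "M \<in> parts n" and M': "M' \<in> parts n" and size: "size M = size M'"
    and S: "\<And>N. split M N \<longleftrightarrow> split M' N"
    and a: "2 \<le> a" "a \<in># M" and top: "\<And>b. b \<in># M \<Longrightarrow> b \<le> a" "\<And>b. b \<in># M' \<Longrightarrow> b \<le> a"
    and le: "count M' a \<le> count M a"
  shows "M = M' \<or> (\<exists>k. (a = 3 \<or> a = 4) \<and> M = add_mset a (replicate_mset (Suc k) 1) \<and>
    M' = {#a - 1, 2#} + replicate_mset k 1)"
proof -
  obtain u where u: "M = add_mset a u" using a(2) by (metis mset_add)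
  let ?N = "u + {#a - 1, 1#}"
  have N: "split M ?N" "split M' ?N" using S split_one[OF a(1)] u by auto
  have cN: "Suc (count ?N a) = count M a" using a u by auto
  show ?thesis
  proof (cases "count M' a = count M a")
    case True
    then have "a \<in># M'" using a(2) by (metis count_greater_zero_iff)
    then obtain u' where u': "M' = add_mset a u'" by (metis mset_add)
    let ?N' = "u' + {#a - 1, 1#}"
    have N': "split M ?N'" using S split_one[OF a(1)] u' by auto
    have cN': "Suc (count ?N' a) = count M' a" using a u' by auto
    \<comment> \<open>The split has one a fewer than the multiset that was split, so the part cut
      was an a.\<close>
    have key: "\<exists>b c. 0 < b \<and> 0 < c \<and> b + c = a \<and> x + {#a - 1, 1#} = y + {#b, c#}"
      if sp: "split (add_mset a y) (x + {#a - 1, 1#})" and c: "Suc (count (x + {#a - 1, 1#}) a) = count (add_mset a y) a"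
        and t: "\<And>b. b \<in># add_mset a y \<Longrightarrow> b \<le> a" for x y
    proof -
      obtain b c M0 where bc: "0 < b" "0 < c" "add_mset a y = add_mset (b + c) M0" "x + {#a - 1, 1#} = M0 + {#b, c#}" 
        using sp by (rule splitE)
      have le: "b + c \<le> a" using t[of "b + c"] bc(3) by simp
      have "b + c = a"
      proof (rule ccontr)
        assume "b + c \<noteq> a"
        then have e1: "count (add_mset a y) a = count M0 a" using bc(3) by simp
        have e2: "count (x + {#a - 1, 1#}) a = count M0 a" unfolding bc(4) using bc(1,2) le by auto
        show False using c unfolding e1 e2 by simp
      qed
      then show ?thesis using bc by auto
    qed
    obtain b c where bc: "0 < b" "0 < c" "b + c = a" "?N = u' + {#b, c#}"
      using key[of u' u] N(2) cN True u u' top(2) by auto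
    obtain b' c' where bc': "0 < b'" "0 < c'" "b' + c' = a" "?N' = u + {#b', c'#}"
      using key[of u u'] N' cN' True u u' top(1) by auto
    have "u = u'"
    proof (cases "b = 1 \<or> c = 1")
      case True
      then have "{#b, c#} = {#a - 1, 1#}" using bc by (auto simp: add_mset_commute)
      then show ?thesis using bc(4) by simp
    next
      case False
      \<comment> \<open>Here \<open>u'\<close> must contain one 1 more than \<open>u\<close>, while
        the symmetric split of M into \<open>?N'\<close> leaves it no more ones than
        \<open>u\<close>.\<close>
      then have "4 \<le> a" using bc by auto
      have "count ?N 1 = count u' 1" using False bc(4) by simp
      moreover have "count ?N 1 = Suc (count u 1)" using \<open>4 \<le> a\<close> by auto
      ultimately have 1: "count u' 1 = Suc (count u 1)" by simp
      have "count ?N' 1 \<le> Suc (count u 1)" unfolding bc'(4) using bc' \<open>4 \<le> a\<close> by auto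
      moreover have "count ?N' 1 = Suc (count u' 1)" using \<open>4 \<le> a\<close> by auto
      ultimately show ?thesis using 1 by simp
    qed
    then show ?thesis using u u' by simp
  next
    case False
    then have lt: "count M' a < count M a" using le by simp
    \<comment> \<open>A second part b of M with 1 < b < a could be cut while keeping all copies of
      a, more than M' has. If b = a, then M' has just one a fewer; cutting one of these leaves two
      fewer than M, but a split of M loses at most one.\<close>
    have small: "b < 2" if b: "b \<in># u" for b
    proof (rule ccontr)
      assume "\<not> b < 2"
      then have b2: "2 \<le> b" by simp
      show False
      proof (cases "b = a")
        case True
        then obtain v where v: "u = add_mset a v" using b by (metis mset_add)
        have "count ?N a \<le> count M' a" using split_count_top(1)[OF N(2) top(2)] by blast
        then have m: "Suc (count M' a) = count M a" using lt cN by simp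
        then have "a \<in># M'" using u v by (auto simp: count_greater_zero_iff[symmetric] simp del: count_greater_zero_iff)
        then obtain u' where u': "M' = add_mset a u'" by (metis mset_add)
        have "split M (u' + {#a - 1, 1#})" using S split_one[OF a(1)] u' by auto
        then have "count M a \<le> Suc (count (u' + {#a - 1, 1#}) a)" using split_count_top(2) top(1) by blast
        moreover have "count (u' + {#a - 1, 1#}) a = count u' a" using a(1) by auto
        ultimately show False using m u' by simp
      next
        case False
        obtain v where v: "u = add_mset b v" using b by (metis mset_add)
        have ba: "b < a" using top(1)[of b] b u False by auto
        have "split M (add_mset a v + {#b - 1, 1#})" using split_one[OF b2, of "add_mset a v"] u v by (simp add: add_mset_commute)
        then have "count (add_mset a v + {#b - 1, 1#}) a \<le> count M' a" using S split_count_top(1) top(2) by blast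
        moreover have "count (add_mset a v + {#b - 1, 1#}) a = Suc (count v a)" using a(1) ba by auto
        moreover have "count M a = Suc (count v a)" using u v ba by simp
        ultimately show False using lt by simp
      qed
    qed
    have "u \<in> parts (n - a)" using M u by (auto simp: parts_def)
    then obtain k where k: "u = replicate_mset k 1" using parts_all_ones small by metis
    then have Mk: "M = add_mset a (replicate_mset k 1)" using u by simp
    have cM': "a \<notin># M'" using lt Mk a by (auto simp: not_in_iff)
    have a3: "3 \<le> a"
    proof (rule ccontr)
      assume "\<not> 3 \<le> a"
      then have a2: "a = 2" using a by simp
      have "b < 2" if "b \<in># M'" for b using top(2)[OF that] cM' that a2 by (cases "b = 2") auto
      then have "M' = replicate_mset n 1" using parts_all_ones[OF M'] by blast
      moreover have "n = k + 2" using M Mk a2 by (simp add: parts_def)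
      ultimately show False using size Mk by simp
    qed
    obtain e f M0 where ef: "0 < e" "0 < f" "M' = add_mset (e + f) M0" "?N = M0 + {#e, f#}" using N(2) by (rule splitE)
    \<comment> \<open>\<open>?N\<close> consists of a - 1 and ones, and e + f < a with positive
      pieces, so both pieces are ones.\<close>
    have "e + f < a" using top(2)[of "e + f"] cM' ef(3) by (metis le_neq_implies_less union_single_eq_member add_mset_add_single union_commute)
    have "e \<in># ?N" "f \<in># ?N" using ef(4) by auto
    then have "e = 1" "f = 1" using k \<open>e + f < a\<close> ef(1,2) by (auto split: if_splits)
    then have M0: "M0 + {#1, 1#} = replicate_mset k 1 + {#a - 1, 1#}" using ef(4) k by simp
    have "count (replicate_mset k 1 + {#a - 1, 1#}) 1 = Suc k" using a3 by auto
    then have "count (M0 + {#1, 1#}) 1 = Suc k" unfolding M0 .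
    then have "k \<noteq> 0" by (intro notI) simp
    then obtain l where l: "k = Suc l" by (cases k) auto
    then have "M0 = add_mset (a - 1) (replicate_mset l 1)" using M0 by (simp add: add_mset_commute)
    then have Ml: "M' = {#a - 1, 2#} + replicate_mset l 1" using ef(3) \<open>e = 1\<close> \<open>f = 1\<close> by (simp add: add_mset_commute)
    \<comment> \<open>For larger a, cutting a - 1 into 2 and a - 3 gives three parts above 1, but a
      split of M has at most two.\<close>
    have "a < 5"
    proof (rule ccontr)
      assume "\<not> a < 5"
      then have a5: "5 \<le> a" by simp
      let ?N3 = "add_mset 2 (replicate_mset l 1) + {#2, a - 3#}"
      have "a - 1 = 2 + (a - 3)" using a5 by simp
      then have Ml': "M' = add_mset (2 + (a - 3)) (add_mset 2 (replicate_mset l 1))" unfolding Ml by simp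
      have "split M' ?N3" unfolding Ml' by (rule splitI) (use a5 in auto)
      then have "split M ?N3" using S by blast
      then obtain e f M0 where ef: "0 < e" "0 < f" "M = add_mset (e + f) M0" "?N3 = M0 + {#e, f#}" by (rule splitE)
      have "e + f \<in># M" using ef(3) by simp
      then have "e + f = a" using Mk ef(1,2) by (auto split: if_splits)
      then have "M0 = replicate_mset k 1" using ef(3) Mk by simp
      then have "size (filter_mset (\<lambda>x. 2 \<le> x) ?N3) = size (filter_mset (\<lambda>x. 2 \<le> x) (replicate_mset k 1 + {#e, f#}))"
        using ef(4) by simp
      moreover have z: "size (filter_mset ((\<le>) 2) (replicate_mset m (Suc 0))) = 0" for m by (induction m) auto
      ultimately show False using a5 by (simp add: z split: if_splits)
    qed
    then have "a = 3 \<or> a = 4" using a3 by auto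
    then show ?thesis using Mk Ml l by blast
  qed
qed

lemma same_splits:
  assumes M: "M \<in> parts n" and M': "M' \<in> parts n" and size: "size M = size M'"
    and S: "\<And>N. split M N \<longleftrightarrow> split M' N"
  shows "M = M' \<or> (\<exists>a k. (a = 3 \<or> a = 4) \<and>
    {M, M'} = {add_mset a (replicate_mset (Suc k) 1), {#a - 1, 2#} + replicate_mset k 1})"
proof (cases "\<exists>b. b \<in># M + M' \<and> 2 \<le> b")
  case False
  then have "M = replicate_mset n 1" "M' = replicate_mset n 1"
    using parts_all_ones[OF M] parts_all_ones[OF M'] by (auto simp: not_le)
  then show ?thesis by simp
next
  case True
  define a where "a = Max (set_mset (M + M'))"
  have top: "b \<le> a" if "b \<in># M + M'" for b unfolding a_def using that by (intro Max_ge) auto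
  have a2: "2 \<le> a" using True top le_trans by blast
  have "set_mset (M + M') \<noteq> {}" using True by blast
  then have amem: "a \<in># M + M'" unfolding a_def using Max_in[of "set_mset (M + M')"] by blast
  show ?thesis
  proof (cases "count M' a \<le> count M a")
    case le: True
    then have "a \<in># M" using amem by (metis count_greater_zero_iff less_le_trans union_iff)
    from same_splits_aux[OF M M' size S a2 this _ _ le] show ?thesis using top by auto
  next
    case False
    then have le: "count M a \<le> count M' a" by simp
    then have "a \<in># M'" using amem by (metis count_greater_zero_iff less_le_trans union_iff)
    from same_splits_aux[OF M' M size[symmetric] S[symmetric] a2 this _ _ le] show ?thesis using top by auto
  qed
qed

text \<open>Induction from the finest type downwards: once all types with more parts are known to be
  fixed, the type at j is constrained by its splits, and \<open>same_splits\<close> leaves only the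
  exceptional pairs. These are excluded by \<open>exc\<close>, which the caller proves by
  counting.\<close>

lemma labels_unique:
  fixes f f' :: "'j \<Rightarrow> nat multiset"
  assumes bij: "bij_betw f J (parts n)" "bij_betw f' J (parts n)"
    and adj: "\<And>i j. i \<in> J \<Longrightarrow> j \<in> J \<Longrightarrow> split (f i) (f j) \<or> split (f j) (f i) \<longleftrightarrow> split (f' i) (f' j) \<or> split (f' j) (f' i)"
    and one: "\<And>j. j \<in> J \<Longrightarrow> f j = replicate_mset n 1 \<Longrightarrow> f' j = replicate_mset n 1"
    and exc: "\<And>i j a k. i \<in> J \<Longrightarrow> j \<in> J \<Longrightarrow> a = 3 \<or> a = 4 \<Longrightarrow> f j = add_mset (a - 1) (replicate_mset (Suc (Suc k)) 1) \<Longrightarrow> f' j = f j \<Longrightarrow>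
      {f i, f' i} = {add_mset a (replicate_mset (Suc k) 1), {#a - 1, 2#} + replicate_mset k 1} \<Longrightarrow> False"
    and j: "j \<in> J"
  shows "f j = f' j"
  using j
proof (induction "n - size (f j)" arbitrary: j rule: less_induct)
  case (less j)
  have P: "f i \<in> parts n" "f' i \<in> parts n" if "i \<in> J" for i using bij that bij_betw_apply by metis+
  have sz: "size (f i) \<le> n" "size (f' i) \<le> n" if "i \<in> J" for i using size_parts P that by blast+
  have surj: "\<exists>i\<in>J. f i = M" if "M \<in> parts n" for M using bij(1) that unfolding bij_betw_def by (metis imageE)
  have IH: "f i = f' i" if "i \<in> J" "size (f j) < size (f i)" for i
    using less.hyps[of i] that sz(1)[OF that(1)] by simp
  show ?case
  proof (cases "\<exists>a. a \<in># f j \<and> 2 \<le> a")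
    case False
    then have "f j = replicate_mset n 1" using parts_all_ones[OF P(1)[OF less.prems]] by (meson not_le)
    then show ?thesis using one less.prems by metis
  next
    case True
    then obtain a M0 where a: "2 \<le> a" "f j = add_mset a M0" by (metis mset_add)
    let ?N = "M0 + {#a - 1, 1#}"
    have sN: "split (f j) ?N" using split_one a by simp
    obtain j2 where j2: "j2 \<in> J" "f j2 = ?N" using surj split_parts[OF sN P(1)[OF less.prems]] by blast
    have "size (f j2) = Suc (size (f j))" using split_size[OF sN] j2 by simp
    then have fj2: "f' j2 = f j2" "size (f j2) = Suc (size (f j))" using IH j2 by auto
    have "split (f' j) (f j2) \<or> split (f j2) (f' j)" using adj[OF less.prems j2(1)] sN j2(2) fj2 by auto
    then show ?thesis
    proof
      \<comment> \<open>Then \<open>f' j\<close> has two parts more than \<open>f j\<close> and, by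
        induction, is already the second label of some j3; injectivity forces j3 = j.\<close>
      assume "split (f j2) (f' j)"
      then have s: "size (f' j) = Suc (Suc (size (f j)))" using split_size fj2 by auto
      obtain j3 where j3: "j3 \<in> J" "f j3 = f' j" using surj P(2)[OF less.prems] by blast
      then have "f' j3 = f' j" using IH s by simp
      then have "j3 = j" using bij(2) j3(1) less.prems unfolding bij_betw_def inj_on_def by blast
      then show ?thesis using j3 by simp
    next
      assume "split (f' j) (f j2)"
      then have size: "size (f j) = size (f' j)" using split_size fj2 by fastforce
      have S: "split (f j) N \<longleftrightarrow> split (f' j) N" for N
      proof -
        have "split (f j) N \<longleftrightarrow> split (f' j) N" if N: "N \<in> parts n" "size N = Suc (size (f j))"
        proof -
          obtain i where i: "i \<in> J" "f i = N" using surj N by blast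
          then have "f' i = N" using IH N by auto
          moreover have "\<not> split N (f j)" "\<not> split N (f' j)" using split_size[of N "f j"] split_size[of N "f' j"] size N by auto
          ultimately show ?thesis using adj[OF less.prems i(1)] i by auto
        qed
        then show ?thesis using split_parts split_size size P less.prems by metis
      qed
      from same_splits[OF P[OF less.prems] size S] show ?thesis
      proof
        assume "\<exists>a k. (a = 3 \<or> a = 4) \<and> {f j, f' j} = {add_mset a (replicate_mset (Suc k) 1), {#a - 1, 2#} + replicate_mset k 1}"
        then obtain a k where e: "a = 3 \<or> a = 4" "{f j, f' j} = {add_mset a (replicate_mset (Suc k) 1), {#a - 1, 2#} + replicate_mset k 1}" by blast
        let ?A = "add_mset a (replicate_mset (Suc k) 1)" and ?T = "add_mset (a - 1) (replicate_mset (Suc (Suc k)) 1)"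
        have "split ?A ?T" using split_one[of a "replicate_mset (Suc k) 1"] e(1) by (auto simp: add_mset_commute)
        moreover have "?A = f j \<or> ?A = f' j" using e(2) by (metis insertCI insertE singletonD)
        ultimately have spl: "split (f j) ?T" by (metis S)
        obtain i where i: "i \<in> J" "f i = ?T" using surj split_parts[OF spl P(1)[OF less.prems]] by blast
        have "size (f j) < size (f i)" unfolding i(2) using split_size[OF spl] by linarith
        then have "f' i = f i" using IH[OF i(1)] by metis
        then show ?thesis using exc[OF less.prems i(1) e(1) i(2) _ e(2)] by blast
      qed
    qed
  qed
qed

section \<open>Recognising transpositions\<close>

text \<open>A new point is inserted into a cycle by composing with a transposition.\<close>

lemma ex_derangement: "finite (A :: nat set) \<Longrightarrow> 2 \<le> card A \<Longrightarrow> \<exists>h. h permutes A \<and> (\<forall>x\<in>A. h x \<noteq> x)"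
proof (induction A rule: finite_induct)
  case (insert c A)
  show ?case
  proof (cases "2 \<le> card A")
    case False
    then have "card A = 1" using insert by simp
    then obtain a where "A = {a}" by (auto simp: card_1_singleton_iff)
    then show ?thesis using insert.hyps
      by (intro exI[of _ "transpose a c"] conjI permutes_swap_id) (auto simp: transpose_def)
  next
    case True
    then obtain h where h: "h permutes A" "\<And>x. x \<in> A \<Longrightarrow> h x \<noteq> x" using insert.IH by blast
    obtain a where a: "a \<in> A" using True by fastforce
    have hA: "h permutes insert c A" using h(1) by (rule permutes_subset) blast
    have hc: "h c = c" "h a \<in> A" "a \<noteq> c" using h(1) insert.hyps a by (auto simp: permutes_not_in permutes_in_image)
    have "(h \<circ> transpose a c) permutes insert c A" using hA a by (intro permutes_compose permutes_swap_id) auto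
    moreover have "(h \<circ> transpose a c) x \<noteq> x" if "x \<in> insert c A" for x
      using that h(2) hc insert.hyps(2) by (auto simp: transpose_def)
    ultimately show ?thesis by blast
  qed
qed simp

text \<open>The size of the support. It depends only on the cycle type
  (\<open>moved_cycles\<close>), so four support sizes mean four cycle types.\<close>

definition moved :: "nat \<Rightarrow> (nat \<Rightarrow> nat) \<Rightarrow> nat" where
  "moved n p = card {x\<in>{1..n}. p x \<noteq> x}"

lemma moved_cycles: "p permutes {1..n} \<Longrightarrow> moved n p = n - count (cycles n p) 1"
proof -
  assume p: "p permutes {1..n}"
  have "{x\<in>{1..n}. p x \<noteq> x} = {1..n} - {x\<in>{1..n}. p x = x}" by auto
  then have "moved n p = card ({1..n} - {x\<in>{1..n}. p x = x})" by (simp only: moved_def)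
  also have "\<dots> = card {1..n} - card {x\<in>{1..n}. p x = x}" by (rule card_Diff_subset) auto
  finally have "moved n p = card {1..n} - card {x\<in>{1..n}. p x = x}" .
  then show ?thesis using count_fixed[OF p] by simp
qed

lemma cycles_transpose:
  assumes "x \<in> {1..n}" "y \<in> {1..n}" "x \<noteq> y"
  shows "cycles n (transpose x y) + {#1, 1#} = replicate_mset n 1 + {#2#}"
proof -
  have o: "orb id z = {z}" for z :: nat by (simp add: orbit_eq_singleton_iff)
  show ?thesis using cycles_join[OF permutes_id assms(1,2)] assms(3) by (simp add: o cycles_id numeral_2_eq_2)
qed

lemma conj_transpose:
  assumes "z permutes S"
  shows "z \<circ> transpose x y \<circ> inv' z = transpose (z x) (z y)"
proof
  fix w
  define v where "v = inv' z w"
  have w: "w = z v" unfolding v_def using permutes_inverses(1)[OF assms] by simp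
  have "(z \<circ> transpose x y \<circ> inv' z) w = z (transpose x y v)" by (simp add: v_def)
  also have "\<dots> = transpose (z x) (z y) (z v)" using inj_eq[OF permutes_inj[OF assms]] by (simp add: transpose_def)
  finally show "(z \<circ> transpose x y \<circ> inv' z) w = transpose (z x) (z y) w" unfolding w[symmetric] .
qed

lemma fixed_point_free_involution:
  assumes p: "p permutes {1..n}" and inv: "\<And>x. x \<in> {1..n} \<Longrightarrow> p x \<noteq> x \<and> p (p x) = x"
  shows "\<exists>m. n = 2 * m \<and> cycles n p = replicate_mset m 2"
proof -
  have o: "orb p x = {x, p x}" if x: "x \<in> {1..n}" for x
  proof (intro equalityI subsetI)
    fix y assume "y \<in> orb p x"
    then show "y \<in> {x, p x}" by induction (use inv[OF x] in auto)
  qed (use orb_self[OF p] orbit.base[of p x] in auto)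
  have "a = 2" if "a \<in># cycles n p" for a
  proof -
    obtain x where x: "x \<in> {1..n}" "card (orb p x) = a" using cycles_obtain[OF p \<open>a \<in># cycles n p\<close>] by blast
    moreover have "x \<noteq> p x" using inv[OF x(1)] by metis
    ultimately show ?thesis using o[OF x(1)] by simp
  qed
  then have M: "cycles n p = replicate_mset (size (cycles n p)) 2" by (metis set_mset_subset_singletonD subsetI singletonI)
  have "sum_mset (cycles n p) = n" using cycles_parts[OF p] by (simp add: parts_def)
  then have "n = 2 * size (cycles n p)" by (subst (asm) M) simp
  then show ?thesis using M by blast
qed

context same_type_conjugate
begin

text \<open>As g^-1 is conjugate to g, the commutator of g with h is a product of g with one of its
  conjugates. It is a derangement of g A after a derangement of A; an overlap of at most one point
  leaves no room for cancellation.\<close>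

lemma commutator_moved:
  assumes g: "g permutes {1..n}" and A: "A \<subseteq> {1..n}" "2 \<le> card A" "card (A \<inter> g ` A) \<le> 1"
  shows "\<exists>z. z permutes {1..n} \<and> moved n (g \<circ> (z \<circ> g \<circ> inv' z)) = 2 * card A - card (A \<inter> g ` A)"
proof -
  have fA: "finite A" using A(1) finite_subset by blast
  obtain h where h: "h permutes A" "\<And>x. x \<in> A \<Longrightarrow> h x \<noteq> x" using ex_derangement[OF fA A(2)] by blast
  have hn: "h permutes {1..n}" using h(1) A(1) by (rule permutes_subset)
  obtain z0 where z0: "z0 permutes {1..n}" "inv' g = z0 \<circ> g \<circ> inv' z0"
    using conj[OF g permutes_inv[OF g]] cycles_inv[OF g] by metis
  let ?w = "g \<circ> ((h \<circ> z0) \<circ> g \<circ> inv' (h \<circ> z0))"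
  have "(h \<circ> z0) \<circ> g \<circ> inv' (h \<circ> z0) = h \<circ> (z0 \<circ> g \<circ> inv' z0) \<circ> inv' h"
    using hn z0(1) by (simp add: o_inv_distrib permutes_bij comp_assoc)
  then have w: "?w x = g (h (inv' g (inv' h x)))" for x using z0(2) by simp
  have zp: "h \<circ> z0 permutes {1..n}" using hn z0(1) by (rule permutes_compose[rotated])
  note gi = permutes_inverses[OF g] and hi = permutes_inverses[OF h(1)]
  \<comment> \<open>u = g h g^-1 deranges g A, and \<open>?w\<close> is u after h^-1.\<close>
  define u where "u y = g (h (inv' g y))" for y
  have u_fix: "u y = y" if "y \<notin> g ` A" for y
  proof -
    have "inv' g y \<notin> A" using that gi(1)[of y] by (metis imageI)
    then show ?thesis unfolding u_def using h(1) gi(1) by (simp add: permutes_not_in)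
  qed
  have u_in: "u y \<in> g ` A" "u y \<noteq> y" if yA: "y \<in> g ` A" for y
  proof -
    obtain a where a: "a \<in> A" "y = g a" using yA by blast
    then have uy: "u y = g (h a)" unfolding u_def using gi(2) by simp
    then show "u y \<in> g ` A" using a h(1) permutes_in_image by fastforce
    show "u y \<noteq> y" using uy a h(2)[OF a(1)] permutes_inj[OF g] by (auto dest: injD)
  qed
  have hA: "inv' h x \<in> A" "inv' h x \<noteq> x" if "x \<in> A" for x
    using that hi(1)[of x] h permutes_in_image[OF permutes_inv[OF h(1)]] by metis+
  have hnot: "inv' h x = x" if "x \<notin> A" for x using that permutes_not_in[OF permutes_inv[OF h(1)]] by blast
  have one: "a = b" if "a \<in> A \<inter> g ` A" "b \<in> A \<inter> g ` A" for a b
    using A(3) that fA by (metis card_le_Suc0_iff_eq finite_Int One_nat_def)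
  have gA: "g ` A \<subseteq> {1..n}" using A(1) permutes_image[OF g] by blast
  have "{x\<in>{1..n}. ?w x \<noteq> x} = A \<union> g ` A"
  proof (intro equalityI subsetI)
    fix x assume x: "x \<in> {x\<in>{1..n}. ?w x \<noteq> x}"
    show "x \<in> A \<union> g ` A"
    proof (rule ccontr)
      assume "x \<notin> A \<union> g ` A"
      then have "inv' h x = x" "u x = x" using hnot u_fix by auto
      then show False using x w u_def by simp
    qed
  next
    fix x assume x: "x \<in> A \<union> g ` A"
    have "u (inv' h x) \<noteq> x"
    proof
      assume e: "u (inv' h x) = x"
      show False
      proof (cases "x \<in> A")
        case True
        \<comment> \<open>For u to undo the move of x inside A, both x and \<open>inv' h x\<close>
          must lie in A and g A, but these are different points.\<close>
        then have y: "inv' h x \<in> A" "inv' h x \<noteq> x" using hA by auto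
        then have "inv' h x \<in> g ` A" using e u_fix by metis
        then have "x \<in> g ` A" using u_in(1) e by metis
        then show False using one[of x "inv' h x"] y True \<open>inv' h x \<in> g ` A\<close> by (metis IntI)
      next
        case False
        then show False using e x hnot u_in(2) by auto
      qed
    qed
    then have "?w x \<noteq> x" using w u_def by simp
    then show "x \<in> {x\<in>{1..n}. ?w x \<noteq> x}" using x A(1) gA by blast
  qed
  then have "moved n ?w = card (A \<union> g ` A)" by (simp add: moved_def)
  also have "\<dots> = card A + card (g ` A) - card (A \<inter> g ` A)"
    using card_Un_Int[of A "g ` A"] fA by simp
  also have "card (g ` A) = card A" using card_image[OF inj_on_subset[OF permutes_inj[OF g] subset_UNIV]] .
  finally have "moved n ?w = card A + card A - card (A \<inter> g ` A)" .
  then show ?thesis using zp unfolding mult_2 by blast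
qed

text \<open>
  If \<open>A\<close> and \<open>g A\<close> share at most one point, a commutator of \<open>g\<close> with a derangement of \<open>A\<close> moves
  exactly \<open>A \<union> g A\<close>.  For most \<open>g\<close> this produces four different supports among the products of two
  conjugates of \<open>g\<close>, whereas products of two transpositions form at most three classes.
\<close>

lemma transposition_or_exceptional:
  assumes g: "g permutes {1..n}" and nid: "g \<noteq> id"
    and few: "card {cycles n (g \<circ> (z \<circ> g \<circ> inv' z)) | z. z permutes {1..n}} \<le> 3"
    and noself: "\<And>z. z permutes {1..n} \<Longrightarrow> cycles n (g \<circ> (z \<circ> g \<circ> inv' z)) \<noteq> cycles n g"
  shows "(\<exists>x\<in>{1..n}. \<exists>y\<in>{1..n}. x \<noteq> y \<and> g = transpose x y) \<or> n = 4 \<and> cycles n g = {#4#} \<or> n = 6 \<and> cycles n g = {#2, 2, 2#}"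
proof -
  define SF where "SF = {moved n (g \<circ> (z \<circ> g \<circ> inv' z)) | z. z permutes {1..n}}"
  let ?C = "{cycles n (g \<circ> (z \<circ> g \<circ> inv' z)) | z. z permutes {1..n}}"
  have "?C = (\<lambda>z. cycles n (g \<circ> (z \<circ> g \<circ> inv' z))) ` {z. z permutes {1..n}}" by auto
  then have fC: "finite ?C" by (simp add: finite_permutations)
  have "SF \<subseteq> (\<lambda>M. n - count M 1) ` ?C"
  proof
    fix m assume "m \<in> SF"
    then obtain z where z: "z permutes {1..n}" "m = moved n (g \<circ> (z \<circ> g \<circ> inv' z))" by (auto simp: SF_def)
    then have "g \<circ> (z \<circ> g \<circ> inv' z) permutes {1..n}" using g by (intro permutes_compose permutes_inv)
    then show "m \<in> (\<lambda>M. n - count M 1) ` ?C" using moved_cycles z by auto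
  qed
  then have cSF: "card SF \<le> 3" "finite SF"
    using surj_card_le[OF fC] few fC finite_surj by (blast intro: le_trans)+
  \<comment> \<open>Every branch below aims at four sizes in \<open>SF\<close>, one of them 0 from g
    g^-1, or at a contradiction to \<open>noself\<close>.\<close>
  have four: False if "{a, b, c, d} \<subseteq> SF" "a < b" "b < c" "c < d" for a b c d
  proof -
    have "card {a, b, c, d} \<le> 3" using card_mono[OF cSF(2) that(1)] cSF(1) by simp
    then show False using that by simp
  qed
  have P: "2 * card A - card (A \<inter> g ` A) \<in> SF" if "A \<subseteq> {1..n}" "2 \<le> card A" "card (A \<inter> g ` A) \<le> 1" for A
    using commutator_moved[OF g that] unfolding SF_def by (metis (mono_tags, lifting) mem_Collect_eq)
  obtain z0 where z0: "z0 permutes {1..n}" "inv' g = z0 \<circ> g \<circ> inv' z0"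
    using conj[OF g permutes_inv[OF g]] cycles_inv[OF g] by metis
  have SF0: "0 \<in> SF"
  proof -
    have "g \<circ> (z0 \<circ> g \<circ> inv' z0) = id" unfolding z0(2)[symmetric] using g by (simp add: permutes_inv_o)
    moreover have "moved n id = 0" by (simp add: moved_def)
    ultimately show ?thesis using z0(1) unfolding SF_def by (metis (mono_tags, lifting) mem_Collect_eq)
  qed
  have inN: "g x \<in> {1..n} \<longleftrightarrow> x \<in> {1..n}" for x using permutes_in_image[OF g] by blast
  have mv: "x \<in> {1..n}" if "g x \<noteq> x" for x using that permutes_not_in[OF g] by blast
  have inj: "g x = g y \<longleftrightarrow> x = y" for x y using permutes_inj[OF g] by (auto dest: injD)
  show ?thesis
  proof (cases "\<forall>x. g (g x) = x")
    case True
    then have gg: "g (g x) = x" for x by blast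
    obtain a where a: "g a \<noteq> a" using nid by (auto simp: fun_eq_iff)
    define b where "b = g a"
    have ab: "a \<in> {1..n}" "b \<in> {1..n}" "a \<noteq> b" "g a = b" "g b = a" using a mv[OF a] inN gg by (auto simp: b_def)
    show ?thesis
    proof (cases "g = transpose a b")
      case True
      then show ?thesis using ab by blast
    next
      case False
      then obtain c where c: "g c \<noteq> transpose a b c" by (auto simp: fun_eq_iff)
      then have cab: "c \<noteq> a" "c \<noteq> b" "g c \<noteq> c" using ab by (auto simp: transpose_def split: if_splits)
      define d where "d = g c"
      have cd: "c \<in> {1..n}" "d \<in> {1..n}" "g c = d" "g d = c" "d \<noteq> c" "d \<noteq> a" "d \<noteq> b"
        using cab mv[OF cab(3)] inN gg ab unfolding d_def by (auto, metis+)
      have ac: "4 \<in> SF" using P[of "{a, c}"] ab cab cd by simp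
      show ?thesis
      proof (cases "\<exists>e\<in>{1..n}. g e = e")
        case True
        then obtain e where e: "e \<in> {1..n}" "g e = e" by blast
        then have ne: "e \<noteq> a" "e \<noteq> b" "e \<noteq> c" "e \<noteq> d" using ab cd by auto
        have "{a, e} \<inter> g ` {a, e} = {e}" "{a, c, e} \<inter> g ` {a, c, e} = {e}" using ab cd cab ne e by auto
        \<comment> \<open>A fixed point e lies in both A and g A, which lowers the support size by
          one and yields odd sizes.\<close>
        then have "3 \<in> SF" "5 \<in> SF" using P[of "{a, e}"] P[of "{a, c, e}"] ab cd cab ne e by simp_all
        then show ?thesis using four[of 0 3 4 5] SF0 ac by auto
      next
        case False
        then have fpf: "x \<in> {1..n} \<Longrightarrow> g x \<noteq> x \<and> g (g x) = x" for x using gg by blast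
        show ?thesis
        proof (cases "{1..n} \<subseteq> {a, b, c, d}")
          case True
          \<comment> \<open>For n = 4, conjugating a double transposition by (b c) and multiplying
            gives the third double transposition, which has the type of g and contradicts
            \<open>noself\<close>.\<close>
          define z where "z = transpose b c"
          have zp: "z permutes {1..n}" unfolding z_def using ab cd by (intro transpose_permutes)
          have zi: "inv' z = z" by (simp add: z_def)
          let ?w = "g \<circ> (z \<circ> g \<circ> inv' z)"
          have wp: "?w permutes {1..n}" using g zp by (intro permutes_compose permutes_inv)
          have w: "?w a = d" "?w b = c" "?w c = b" "?w d = a"
            using ab cd cab by (auto simp: zi z_def transpose_def)
          have "?w x \<noteq> x \<and> ?w (?w x) = x" if xN: "x \<in> {1..n}" for x
          proof -
            consider "x = a" | "x = b" | "x = c" | "x = d" using xN True by blast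
            then show ?thesis using w ab cd cab by cases metis+
          qed
          then obtain m where m: "n = 2 * m" "cycles n ?w = replicate_mset m 2" using fixed_point_free_involution[OF wp] by blast
          obtain m' where "n = 2 * m'" "cycles n g = replicate_mset m' 2" using fixed_point_free_involution[OF g fpf] by blast
          then show ?thesis using m noself[OF zp] by simp
        next
          case False
          then obtain e where e: "e \<in> {1..n}" "e \<noteq> a" "e \<noteq> b" "e \<noteq> c" "e \<noteq> d" by blast
          define e' where "e' = g e"
          have e'1: "e' \<in> {1..n}" "g e = e'" "g e' = e" "e' \<noteq> e"
            using e fpf[OF e(1)] inN by (auto simp: e'_def)
          then have "e' \<noteq> a" "e' \<noteq> b" "e' \<noteq> c" "e' \<noteq> d" using e ab cd by metis+
          note e' = e'1 this
          have "{a, c, e} \<inter> g ` {a, c, e} = {}" using ab cd cab e e' by auto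
          then have six: "6 \<in> SF" using P[of "{a, c, e}"] ab cd cab e by simp
          show ?thesis
          proof (cases "{1..n} \<subseteq> {a, b, c, d, e, e'}")
            case True
            then have "{1..n} = {a, b, c, d, e, e'}" using ab(1,2) cd(1,2) e(1) e'(1) by blast
            moreover have "card {a, b, c, d, e, e'} = 6" using ab cd cab e e' by auto
            ultimately have "n = 6" by (metis card_atLeastAtMost diff_Suc_1 One_nat_def)
            moreover obtain m' where "n = 2 * m'" "cycles n g = replicate_mset m' 2" using fixed_point_free_involution[OF g fpf] by blast
            ultimately have "n = 6" "cycles n g = replicate_mset 3 2" by auto
            then show ?thesis by (simp add: numeral_3_eq_3)
          next
            case False
            then obtain r where r: "r \<in> {1..n}" "r \<noteq> a" "r \<noteq> b" "r \<noteq> c" "r \<noteq> d" "r \<noteq> e" "r \<noteq> e'" by blast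
            define s where "s = g r"
            have s1: "g r = s" "s \<noteq> r" "g s = r" using fpf[OF r(1)] by (auto simp: s_def)
            then have "s \<noteq> a" "s \<noteq> b" "s \<noteq> c" "s \<noteq> d" "s \<noteq> e" "s \<noteq> e'" using r ab cd e' by metis+
            note s = s1 this
            have "{a, c, e, r} \<inter> g ` {a, c, e, r} = {}" using ab cd cab e e' r s by auto
            then have "8 \<in> SF" using P[of "{a, c, e, r}"] ab cd cab e r by simp
            then show ?thesis using four[of 0 4 6 8] SF0 ac six by auto
          qed
        qed
      qed
    qed
  next
    case False
    then obtain x where x: "g (g x) \<noteq> x" by blast
    define y where "y = g x" define z where "z = g y"
    have "g x \<noteq> x" using x by auto
    then have xyz: "x \<in> {1..n}" "y \<in> {1..n}" "z \<in> {1..n}" "g x = y" "g y = z" "y \<noteq> x" "z \<noteq> y" "z \<noteq> x"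
      using x mv inN inj unfolding y_def z_def by auto
    \<comment> \<open>From here on g has a cycle x, y, z, ... of length at least 3.\<close>
    have "{x, y} \<inter> g ` {x, y} = {y}" using xyz by auto
    then have three: "3 \<in> SF" using P[of "{x, y}"] xyz by simp
    show ?thesis
    proof (cases "g z = x")
      case True
      show ?thesis
      proof (cases "\<exists>u. u \<notin> {x, y, z} \<and> g u \<noteq> u")
        case True
        then obtain u where u: "u \<noteq> x" "u \<noteq> y" "u \<noteq> z" "g u \<noteq> u" by auto
        define v where "v = g u"
        have v1: "u \<in> {1..n}" "g u = v" "v \<noteq> u" using u(4) mv[OF u(4)] by (simp_all add: v_def)
        then have "v \<noteq> x" "v \<noteq> y" "v \<noteq> z" using u xyz \<open>g z = x\<close> inj by metis+
        note v = v1 this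
        have "{x, u} \<inter> g ` {x, u} = {}" "{x, u, z} \<inter> g ` {x, u, z} = {x}" using u v xyz \<open>g z = x\<close> by auto
        then have "4 \<in> SF" "5 \<in> SF" using P[of "{x, u}"] P[of "{x, u, z}"] u v xyz by simp_all
        then show ?thesis using four[of 0 3 4 5] SF0 three by auto
      next
        case False
        \<comment> \<open>A single 3-cycle: its square is its inverse, hence of the same type,
          contradicting \<open>noself\<close>.\<close>
        have "g (g (g t)) = t" for t
        proof (cases "t \<in> {x, y, z}")
          case True
          then show ?thesis using xyz \<open>g z = x\<close> by auto
        next
          case F: False
          then have "g t = t" using False by blast
          then show ?thesis by simp
        qed
        then have "g \<circ> g = inv' g" using permutes_inverses[OF g] by (metis comp_apply ext)
        then have "cycles n (g \<circ> (id \<circ> g \<circ> inv' id)) = cycles n g" using cycles_inv[OF g] by simp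
        then show ?thesis using noself[OF permutes_id] by blast
      qed
    next
      case False
      define w where "w = g z"
      have w1: "w \<in> {1..n}" "g z = w" "w \<noteq> x" using xyz False inN[of z] by (simp_all add: w_def)
      then have "w \<noteq> y" "w \<noteq> z" using xyz inj by metis+
      note w = w1 this
      have "{x, z} \<inter> g ` {x, z} = {}" using xyz w by auto
      then have four': "4 \<in> SF" using P[of "{x, z}"] xyz by simp
      show ?thesis
      proof (cases "{1..n} \<subseteq> {x, y, z, w}")
        case True
        then have N: "{1..n} = {x, y, z, w}" using xyz(1-3) w(1) by blast
        moreover have "card {x, y, z, w} = 4" using xyz w by auto
        ultimately have "n = 4" by (metis card_atLeastAtMost diff_Suc_1 One_nat_def)
        have "{x, y, z, w} \<subseteq> orb g x"
        proof -
          have "x \<in> orb g x" by (rule orb_self[OF g])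
          moreover have "y \<in> orb g x" using orbit.base[of g x] xyz by simp
          moreover from this have "z \<in> orb g x" using orbit.step[of y g x] xyz by simp
          moreover from this have "w \<in> orb g x" using orbit.step[of z g x] w by simp
          ultimately show ?thesis by blast
        qed
        moreover have "orb g x \<subseteq> {1..n}" by (rule orb_sub[OF g xyz(1)])
        ultimately have o: "orb g x = {1..n}" using N by blast
        have "orb g ` {1..n} = {{1..n}}"
        proof (intro equalityI subsetI)
          fix K assume "K \<in> orb g ` {1..n}"
          then obtain t where "t \<in> orb g x" "K = orb g t" using o by blast
          then have "K = {1..n}" using orb_eq[OF g, of t x] o by metis
          then show "K \<in> {{1..n}}" by blast
        qed (use o xyz(1) in auto)
        then have "cycles n g = {#4#}" using \<open>n = 4\<close> by (simp add: cycles_def)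
        then show ?thesis using \<open>n = 4\<close> by blast
      next
        case False
        then obtain u where u: "u \<in> {1..n}" "u \<noteq> x" "u \<noteq> y" "u \<noteq> z" "u \<noteq> w" by blast
        \<comment> \<open>g A is {y, w, g u}, so only g u can lie in the overlap and the support
          size is 5 or 6.\<close>
        let ?A = "{x, z, u}"
        have sub: "?A \<inter> g ` ?A \<subseteq> {g u}" using xyz w u by auto
        then have c1: "card (?A \<inter> g ` ?A) \<le> 1" using card_mono[OF _ sub] by simp
        have "card ?A = 3" using u xyz by auto
        define m where "m = card (?A \<inter> g ` ?A)"
        have "?A \<subseteq> {1..n}" using u(1) xyz(1,3) by blast
        then have "2 * card ?A - m \<in> SF" unfolding m_def using \<open>card ?A = 3\<close> by (intro P c1) simp_all
        then have m: "m \<le> 1" "6 - m \<in> SF" using c1 \<open>card ?A = 3\<close> by (simp_all add: m_def)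
        then have "4 < 6 - m" by simp
        then show ?thesis using four[of 0 3 4 "6 - m"] m SF0 three four' by simp
      qed
    qed
  qed
qed

end

section \<open>Rigidity of labellings\<close>

definition transp :: "nat \<Rightarrow> (nat \<Rightarrow> nat) set" where
  "transp n = {s. \<exists>u\<in>{1..n}. \<exists>v\<in>{1..n}. u \<noteq> v \<and> s = transpose u v}"

lemma transpE:
  assumes "s \<in> transp n" obtains u v where "u \<in> {1..n}" "v \<in> {1..n}" "u \<noteq> v" "s = transpose u v"
  using assms by (auto simp: transp_def)

lemma transpI: "u \<in> {1..n} \<Longrightarrow> v \<in> {1..n} \<Longrightarrow> u \<noteq> v \<Longrightarrow> transpose u v \<in> transp n"
  unfolding transp_def by blast

lemma transp_permutes: "s \<in> transp n \<Longrightarrow> s permutes {1..n}"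
  using transpose_permutes by (metis transpE)

lemma finite_transp: "finite (transp n)"
  by (rule finite_subset[OF _ finite_permutations[of "{1..n}"]]) (auto dest: transp_permutes)

lemma cycles_transp: "s \<in> transp n \<Longrightarrow> cycles n s + {#1, 1#} = replicate_mset n 1 + {#2#}"
  by (auto elim!: transpE dest: cycles_transpose)

lemma conj_transp: "s \<in> transp n \<Longrightarrow> z permutes {1..n} \<Longrightarrow> z \<circ> s \<circ> inv' z \<in> transp n"
proof (elim transpE)
  fix u v assume "z permutes {1..n}" "u \<in> {1..n}" "v \<in> {1..n}" "u \<noteq> v" "s = transpose u v"
  then show ?thesis using permutes_in_image[of z "{1..n}"] inj_eq[OF permutes_inj[of z "{1..n}"]]
    by (simp only: conj_transpose) (intro transpI, auto)
qed

text \<open>The conjugators from t to a given conjugate form a left coset of the centralizer of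
  t.\<close>

lemma card_conjugators:
  assumes w: "w permutes {1..n}"
  shows "card {z. z permutes {1..n} \<and> z \<circ> t \<circ> inv' z = w \<circ> t \<circ> inv' w} = card {z. z permutes {1..n} \<and> z \<circ> t \<circ> inv' z = t}"
proof -
  let ?F = "\<lambda>s. {z. z permutes {1..n} \<and> z \<circ> t \<circ> inv' z = s}"
  have ww: "inv' w \<circ> w = id" "w \<circ> inv' w = id" using permutes_inv_o[OF w] by auto
  have wi: "inv' w permutes {1..n}" by (rule permutes_inv[OF w])
  have "bij_betw (\<lambda>z. w \<circ> z) (?F t) (?F (w \<circ> t \<circ> inv' w))"
  proof (rule bij_betwI[of _ _ _ "\<lambda>z. inv' w \<circ> z"])
    show "(\<lambda>z. w \<circ> z) \<in> ?F t \<rightarrow> ?F (w \<circ> t \<circ> inv' w)"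
    proof clarify
      fix z assume z: "z permutes {1..n}" "z \<circ> t \<circ> inv' z = t"
      have "(w \<circ> z) \<circ> t \<circ> inv' (w \<circ> z) = w \<circ> (z \<circ> t \<circ> inv' z) \<circ> inv' w"
        using z(1) w by (simp add: o_inv_distrib permutes_bij comp_assoc)
      then show "w \<circ> z permutes {1..n} \<and> (w \<circ> z) \<circ> t \<circ> inv' (w \<circ> z) = w \<circ> t \<circ> inv' w"
        using z w permutes_compose by metis
    qed
    show "(\<lambda>z. inv' w \<circ> z) \<in> ?F (w \<circ> t \<circ> inv' w) \<rightarrow> ?F t"
    proof clarify
      fix z assume z: "z permutes {1..n}" "z \<circ> t \<circ> inv' z = w \<circ> t \<circ> inv' w"
      have "(inv' w \<circ> z) \<circ> t \<circ> inv' (inv' w \<circ> z) = inv' w \<circ> (z \<circ> t \<circ> inv' z) \<circ> w"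
        using z(1) w by (simp add: o_inv_distrib permutes_bij comp_assoc bij_imp_bij_inv inv_inv_eq)
      also have "\<dots> = inv' w \<circ> (w \<circ> t \<circ> inv' w) \<circ> w" using z(2) by simp
      also have "\<dots> = t" by (simp add: fun_eq_iff permutes_inverses[OF w])
      finally show "inv' w \<circ> z permutes {1..n} \<and> (inv' w \<circ> z) \<circ> t \<circ> inv' (inv' w \<circ> z) = t"
        using z wi permutes_compose by metis
    qed
  qed (simp_all add: ww comp_assoc[symmetric])
  then show ?thesis by (simp add: bij_betw_same_card)
qed

context same_type_conjugate
begin

lemma transp_conj:
  assumes "s \<in> transp n" "t \<in> transp n"
  shows "\<exists>z. z permutes {1..n} \<and> t = z \<circ> s \<circ> inv' z"
  using conj[of s t] cycles_transp[OF assms(1)] cycles_transp[OF assms(2)] transp_permutes assms by (metis add_right_imp_eq)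

lemma cycles_transp_iff:
  assumes "t \<in> transp n" "g permutes {1..n}"
  shows "cycles n g = cycles n t \<longleftrightarrow> g \<in> transp n"
proof
  assume "cycles n g = cycles n t"
  then obtain z where "z permutes {1..n}" "g = z \<circ> t \<circ> inv' z" using conj[of t g] transp_permutes assms by metis
  then show "g \<in> transp n" using conj_transp assms(1) by blast
next
  assume "g \<in> transp n"
  then show "cycles n g = cycles n t" using cycles_transp[of g n] cycles_transp[OF assms(1)] by (metis add_right_imp_eq)
qed

text \<open>With a transposition as second factor, a class multiplication number is nonzero exactly
  for types one splitting or joining away.\<close>

lemma neighbours_iff:
  assumes x: "x permutes {1..n}" and t: "t \<in> transp n"
  shows "(\<exists>z. z permutes {1..n} \<and> cycles n (x \<circ> (z \<circ> t \<circ> inv' z)) = M) \<longleftrightarrow> split (cycles n x) M \<or> split M (cycles n x)"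
proof
  assume "\<exists>z. z permutes {1..n} \<and> cycles n (x \<circ> (z \<circ> t \<circ> inv' z)) = M"
  then obtain z where z: "z permutes {1..n}" "cycles n (x \<circ> (z \<circ> t \<circ> inv' z)) = M" by blast
  obtain u v where uv: "u \<in> {1..n}" "v \<in> {1..n}" "u \<noteq> v" "z \<circ> t \<circ> inv' z = transpose u v"
    using conj_transp[OF t z(1)] by (rule transpE)
  then show "split (cycles n x) M \<or> split M (cycles n x)" using transpose_split[OF x uv(1-3)] z(2) by auto
next
  assume "split (cycles n x) M \<or> split M (cycles n x)"
  then obtain u v where uv: "u \<in> {1..n}" "v \<in> {1..n}" "u \<noteq> v" "cycles n (x \<circ> transpose u v) = M"
    using split_transpose[OF x] by metis
  then obtain z where "z permutes {1..n}" "transpose u v = z \<circ> t \<circ> inv' z" using transp_conj[OF t transpI] by metis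
  then show "\<exists>z. z permutes {1..n} \<and> cycles n (x \<circ> (z \<circ> t \<circ> inv' z)) = M" using uv(4) by metis
qed

text \<open>Each transposition s arises from equally many z. Thus class multiplication numbers
  record the number of suitable transpositions, not merely their existence.\<close>

lemma count_neighbours:
  assumes t: "t \<in> transp n"
  shows "card {z. z permutes {1..n} \<and> cycles n (x \<circ> (z \<circ> t \<circ> inv' z)) = M} =
    card {z. z permutes {1..n} \<and> z \<circ> t \<circ> inv' z = t} * card {s \<in> transp n. cycles n (x \<circ> s) = M}"
proof -
  let ?F = "\<lambda>s. {z. z permutes {1..n} \<and> z \<circ> t \<circ> inv' z = s}"
  have fin: "finite (?F s)" for s by (rule finite_subset[OF _ finite_permutations[of "{1..n}"]]) auto
  have c: "card (?F s) = card (?F t)" if s: "s \<in> transp n" for s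
  proof -
    obtain w where w: "w permutes {1..n}" "s = w \<circ> t \<circ> inv' w" using transp_conj[OF t s] by blast
    show ?thesis unfolding w(2) by (rule card_conjugators[OF w(1)])
  qed
  have "{z. z permutes {1..n} \<and> cycles n (x \<circ> (z \<circ> t \<circ> inv' z)) = M} = (\<Union>s\<in>{s \<in> transp n. cycles n (x \<circ> s) = M}. ?F s)"
    using conj_transp[OF t] by auto
  moreover have "card (\<Union>s\<in>{s \<in> transp n. cycles n (x \<circ> s) = M}. ?F s) = (\<Sum>s\<in>{s \<in> transp n. cycles n (x \<circ> s) = M}. card (?F s))"
    by (rule card_UN_disjoint) (use finite_transp fin in auto)
  ultimately show ?thesis using c by simp
qed

lemma centralizer_pos: "card {z. z permutes {1..n} \<and> z \<circ> t \<circ> inv' z = t} > 0"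
proof -
  have "finite {z. z permutes {1..n} \<and> z \<circ> t \<circ> inv' z = t}" by (rule finite_subset[OF _ finite_permutations[of "{1..n}"]]) auto
  moreover have "id \<in> {z. z permutes {1..n} \<and> z \<circ> t \<circ> inv' z = t}" by (simp add: permutes_id)
  ultimately show ?thesis unfolding card_gt_0_iff by blast
qed

end

text \<open>For each q on the cycle of length a, the transposition of q and x q cuts off a cycle of
  length 1; for a \<ge> 3 these transpositions are distinct.\<close>

lemma count_splitting_cycle:
  assumes x: "x permutes {1..n}" and a: "a = 3 \<or> a = 4" and M: "cycles n x = add_mset a (replicate_mset (Suc k) 1)"
  shows "3 \<le> card {s \<in> transp n. cycles n (x \<circ> s) = add_mset (a - 1) (replicate_mset (Suc (Suc k)) 1)}"
proof -
  let ?S = "{s \<in> transp n. cycles n (x \<circ> s) = add_mset (a - 1) (replicate_mset (Suc (Suc k)) 1)}"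
  obtain p where p: "p \<in> {1..n}" "card (orb x p) = a" using cycles_obtain[OF x, of a] M by auto
  let ?s = "\<lambda>q. transpose q (x q)"
  have in_orb: "q \<in> {1..n}" "card (orb x q) = a" if "q \<in> orb x p" for q
    using that orb_sub[OF x p(1)] orb_eq[OF x] p(2) by auto
  have "?s q \<in> ?S" if q: "q \<in> orb x p" for q
  proof -
    have b: "0 < (1::nat)" "1 < card (orb x q)" using in_orb(2)[OF q] a by auto
    from cycles_split[OF x in_orb(1)[OF q] b] 
    have "q \<noteq> x q" "x q \<in> {1..n}" "cycles n x + {#a - 1, 1#} = cycles n (x \<circ> ?s q) + {#a#}" using in_orb(2)[OF q] by simp_all
    then show ?thesis using M in_orb(1)[OF q] transpI by (simp add: add_mset_commute)
  qed
  moreover have "inj_on ?s (orb x p)"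
  proof (rule inj_onI)
    fix q r assume qr: "q \<in> orb x p" "r \<in> orb x p" "?s q = ?s r"
    show "q = r"
    proof (rule ccontr)
      assume ne: "q \<noteq> r"
      have i: "i < a \<Longrightarrow> j < a \<Longrightarrow> (x ^^ i) q = (x ^^ j) q \<Longrightarrow> i = j" for i j
        using inj_onD[OF orb_powers(2)[OF x, of q]] in_orb(2)[OF qr(1)] by auto
      have "x q \<noteq> q" using i[of 1 0] a by auto
      then have "?s r q = x q" using qr(3) by (metis transpose_apply_first)
      have qx: "q = x r"
      proof (rule ccontr)
        assume "q \<noteq> x r"
        then have "?s r q = q" using ne by (simp add: transpose_def)
        then show False using \<open>?s r q = x q\<close> \<open>x q \<noteq> q\<close> by simp
      qed
      then have "r = x q" using \<open>?s r q = x q\<close> by (metis transpose_apply_second)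
      \<comment> \<open>Coinciding transpositions would make x exchange q and r, a cycle of length
        2.\<close>
      then have "(x ^^ 2) q = (x ^^ 0) q" using qx by (simp add: numeral_2_eq_2)
      then show False using i[of 2 0] a by auto
    qed
  qed
  ultimately have "card (orb x p) \<le> card ?S"
    using finite_transp by (intro card_inj_on_le[of ?s]) auto
  then show ?thesis using p(2) a by auto
qed

text \<open>The target is reached only by cutting a cycle of length 2, each in one way. There are
  two such cycles if a = 3 and one if a = 4.\<close>

lemma count_splitting_pair:
  assumes x: "x permutes {1..n}" and a: "a = 3 \<or> a = 4" and M: "cycles n x = {#a - 1, 2#} + replicate_mset k 1"
  shows "card {s \<in> transp n. cycles n (x \<circ> s) = add_mset (a - 1) (replicate_mset (Suc (Suc k)) 1)} \<le> 2"
proof -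
  let ?S = "{s \<in> transp n. cycles n (x \<circ> s) = add_mset (a - 1) (replicate_mset (Suc (Suc k)) 1)}"
  let ?K = "{K \<in> orb x ` {1..n}. card K = 2}"
  have "?S \<subseteq> (\<lambda>K. transpose (Min K) (Max K)) ` ?K"
  proof
    fix s assume "s \<in> ?S"
    then obtain u v where uv: "u \<in> {1..n}" "v \<in> {1..n}" "u \<noteq> v" "s = transpose u v"
      and c: "cycles n (x \<circ> transpose u v) = add_mset (a - 1) (replicate_mset (Suc (Suc k)) 1)" 
      by (auto elim: transpE)
    have "v \<in> orb x u"
    proof (rule ccontr)
      assume "v \<notin> orb x u"
      then have "size (cycles n x) = Suc (size (cycles n (x \<circ> transpose u v)))"
        using transpose_split(2)[OF x uv(1-3)] split_size by blast
      then show False using c M by simp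
    qed
    then obtain b where b: "b < card (orb x u)" "v = (x ^^ b) u" using orb_powers(1)[OF x, of u] by blast
    then have b0: "0 < b" using uv(3) by (cases b) auto
    define m where "m = card (orb x u)"
    have eq: "{#a - 1, 2#} + replicate_mset k 1 + {#m - b, b#} = add_mset (a - 1) (replicate_mset (Suc (Suc k)) 1) + {#m#}"
      using cycles_split(3)[OF x uv(1) b0 b(1)] b(2) c M by (simp add: m_def)
    have "m \<in># {#a - 1, 2#} + replicate_mset k 1" using cycles_mem[OF x uv(1)] M by (simp add: m_def)
    moreover have "2 \<le> m" using b b0 by (simp add: m_def)
    ultimately have "m = a - 1 \<or> m = 2" by (auto split: if_splits)
    \<comment> \<open>Cutting a longer cycle would leave the part 2 in place, but the target has
      none.\<close>
    have "m = 2"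
    proof (rule ccontr)
      assume "m \<noteq> 2"
      then have "2 \<in># add_mset (a - 1) (replicate_mset (Suc (Suc k)) 1) + {#m#}" using eq
        by (metis union_iff add_mset_add_single union_single_eq_member)
      then show False using \<open>m \<noteq> 2\<close> \<open>m = a - 1 \<or> m = 2\<close> by (auto split: if_splits)
    qed
    then have "card (orb x u) = 2" by (simp add: m_def)
    moreover have "{u, v} \<subseteq> orb x u" using \<open>v \<in> orb x u\<close> orb_self[OF x] by blast
    ultimately have o: "orb x u = {u, v}" using uv(3) card_seteq[OF orb_finite[OF x], of "{u, v}" u] by auto
    have "s = transpose (Min (orb x u)) (Max (orb x u))"
      using uv(3,4) unfolding o by (auto simp: min_def max_def transpose_commute)
    then show "s \<in> (\<lambda>K. transpose (Min K) (Max K)) ` ?K" using uv(1) \<open>card (orb x u) = 2\<close> by blast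
  qed
  then have "card ?S \<le> card ?K" by (rule surj_card_le[rotated]) simp
  also have "\<dots> = count (cycles n x) 2" by (rule count_cycles[OF x, symmetric])
  also have "\<dots> \<le> 2" unfolding M using a by auto
  finally show ?thesis .
qed

context labelled
begin

lemma type_iff: "j < k \<Longrightarrow> cycle_type n g = \<beta> j \<longleftrightarrow> cycles n g = mset (\<beta> j)"
  using sorted_desc_mset_inj[OF sorted_cycle_type, of "\<beta> j" n g] \<beta>_mem[of j] mset_cycle_type[of n g] by (auto simp: partitions_of_def)

lemma cl_iff: "j < k \<Longrightarrow> g \<in> cl j \<longleftrightarrow> g permutes {1..n} \<and> cycles n g = mset (\<beta> j)"
  using type_iff by (simp add: cl_def)

lemma bij_types: "bij_betw (\<lambda>j. mset (\<beta> j)) {..<k} (parts n)"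
  using bij_betw_trans[OF bij_\<beta> bij_mset_partitions] by (simp add: comp_def)

lemma ex_class: "g permutes {1..n} \<Longrightarrow> \<exists>j<k. g \<in> cl j"
  using \<beta>_surj[OF cycle_type_partition, of g] by (auto simp: cl_def)

lemma class_mult_cycles:
  "j < k \<Longrightarrow> class_mult x y j = card {z. z permutes {1..n} \<and> cycles n (x \<circ> (z \<circ> y \<circ> inv' z)) = mset (\<beta> j)}"
  unfolding class_mult_def by (simp add: type_iff)

lemma class_mult_nonzero:
  assumes "j < k"
  shows "class_mult x y j \<noteq> 0 \<longleftrightarrow> (\<exists>z. z permutes {1..n} \<and> cycles n (x \<circ> (z \<circ> y \<circ> inv' z)) = mset (\<beta> j))"
proof -
  have "finite {z. z permutes {1..n} \<and> cycles n (x \<circ> (z \<circ> y \<circ> inv' z)) = mset (\<beta> j)}"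
    by (rule finite_subset[OF _ finite_permutations[of "{1..n}"]]) auto
  then show ?thesis unfolding class_mult_cycles[OF assms] by (simp add: card_eq_0_iff)
qed

lemma products_image:
  assumes g: "g permutes {1..n}"
  shows "{cycles n (g \<circ> (z \<circ> g \<circ> inv' z)) | z. z permutes {1..n}} = (\<lambda>j. mset (\<beta> j)) ` {j\<in>{..<k}. class_mult g g j \<noteq> 0}"
proof (intro equalityI subsetI)
  fix M assume "M \<in> {cycles n (g \<circ> (z \<circ> g \<circ> inv' z)) | z. z permutes {1..n}}"
  then obtain z where z: "z permutes {1..n}" "M = cycles n (g \<circ> (z \<circ> g \<circ> inv' z))" by blast
  then have "g \<circ> (z \<circ> g \<circ> inv' z) permutes {1..n}" using g by (intro permutes_compose permutes_inv)
  then obtain j where j: "j < k" "g \<circ> (z \<circ> g \<circ> inv' z) \<in> cl j" using ex_class by blast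
  then have "M = mset (\<beta> j)" using cl_iff z(2) by simp
  moreover from this have "class_mult g g j \<noteq> 0" using class_mult_nonzero[OF j(1)] z by metis
  ultimately show "M \<in> (\<lambda>j. mset (\<beta> j)) ` {j\<in>{..<k}. class_mult g g j \<noteq> 0}" using j(1) by blast
next
  fix M assume "M \<in> (\<lambda>j. mset (\<beta> j)) ` {j\<in>{..<k}. class_mult g g j \<noteq> 0}"
  then obtain j where j: "j < k" "class_mult g g j \<noteq> 0" "M = mset (\<beta> j)" by blast
  obtain z where "z permutes {1..n}" "cycles n (g \<circ> (z \<circ> g \<circ> inv' z)) = mset (\<beta> j)"
    using j(2) unfolding class_mult_nonzero[OF j(1)] by blast
  then show "M \<in> {cycles n (g \<circ> (z \<circ> g \<circ> inv' z)) | z. z permutes {1..n}}" unfolding j(3) by (metis (mono_tags, lifting) mem_Collect_eq)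
qed

lemma card_products:
  assumes g: "g permutes {1..n}"
  shows "card {cycles n (g \<circ> (z \<circ> g \<circ> inv' z)) | z. z permutes {1..n}} = card {j\<in>{..<k}. class_mult g g j \<noteq> 0}"
  unfolding products_image[OF g]
  by (rule card_image, rule inj_on_subset[OF bij_betw_imp_inj_on[OF bij_types]]) auto

lemma class_id: "j < k \<Longrightarrow> mset (\<beta> j) = replicate_mset n 1 \<longleftrightarrow> j = j0"
proof -
  assume j: "j < k"
  have "mset (\<beta> j0) = replicate_mset n 1" using j0(2) mset_cycle_type cycles_id by metis
  then show ?thesis using inj_onD[OF bij_betw_imp_inj_on[OF bij_types], of j j0] j j0(1) by auto
qed

end

text \<open>The neighbours of the type of a transposition are at most the identity, two disjoint
  transpositions, and a 3-cycle. The list is only an upper bound, so multiset subtraction is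
  harmless for small n.\<close>

lemma transposition_products:
  fixes M :: "nat multiset"
  assumes M: "M + {#1, 1#} = replicate_mset n 1 + {#2#}"
  shows "card {N. split M N \<or> split N M} \<le> 3" "finite {N. split M N \<or> split N M}"
proof -
  have sub: "{N. split M N \<or> split N M} \<subseteq> {replicate_mset n 1, add_mset 2 (M - {#1, 1#}), add_mset 3 (M - {#1, 2#})}"
  proof
    have cM: "c = 1 \<or> c = 2" "count M (2::nat) = 1" if "c \<in># M" for c
    proof -
      have "c \<in># replicate_mset n 1 + {#2#}" using that M by (metis union_iff)
      then show "c = 1 \<or> c = 2" by (auto split: if_splits)
      have "count (M + {#1, 1#}) (2::nat) = count (replicate_mset n 1 + {#2#}) (2::nat)" unfolding M ..
      then show "count M (2::nat) = 1" by simp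
    qed
    fix N assume "N \<in> {N. split M N \<or> split N M}"
    then consider "split M N" | "split N M" by blast
    then show "N \<in> {replicate_mset n 1, add_mset 2 (M - {#1, 1#}), add_mset 3 (M - {#1, 2#})}"
    proof cases
      case 1
      then obtain b c M0 where bc: "0 < b" "0 < c" "M = add_mset (b + c) M0" "N = M0 + {#b, c#}" by (rule splitE)
      then have "b + c = 2" using cM(1)[of "b + c"] by auto
      then have "b = 1" "c = 1" using bc by auto
      have "M = add_mset 2 M0" unfolding bc(3) \<open>b + c = 2\<close> ..
      moreover have "N = M0 + {#1, 1#}" unfolding bc(4) \<open>b = 1\<close> \<open>c = 1\<close> ..
      ultimately have "N + {#2#} = M + {#1, 1#}" by simp
      then have "N = replicate_mset n 1" unfolding M by (rule add_right_imp_eq)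
      then show ?thesis by simp
    next
      case 2
      then obtain b c M0 where bc: "0 < b" "0 < c" "N = add_mset (b + c) M0" "M = M0 + {#b, c#}" by (rule splitE)
      have "\<not> (b = 2 \<and> c = 2)" using bc(4) cM(2)[of b] by auto
      moreover have "b = 1 \<or> b = 2" "c = 1 \<or> c = 2" using cM(1) bc(4) by auto
      ultimately consider "b = 1" "c = 1" | "b = 1" "c = 2" | "b = 2" "c = 1" by blast
      then show ?thesis using bc(3,4) by cases (simp_all add: add_mset_commute numeral_2_eq_2 numeral_3_eq_3)
    qed
  qed
  then show "finite {N. split M N \<or> split N M}" by (rule finite_subset) simp
  have "card {N. split M N \<or> split N M} \<le> card {replicate_mset n 1, add_mset 2 (M - {#1, 1#}), add_mset 3 (M - {#1, 2#})}"
    by (rule card_mono[OF _ sub]) simp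
  also have "\<dots> \<le> 3" by (simp add: card_insert_if)
  finally show "card {N. split M N \<or> split N M} \<le> 3" .
qed

context two_labellings
begin

text \<open>Class multiplication numbers carry both recognising properties of transpositions over to
  the second labelling, where \<open>transposition_or_exceptional\<close> applies.\<close>

lemma transposition_column:
  assumes t: "t \<in> transp n" and j: "j < k" "t \<in> L.cl j" and g: "g \<in> L'.cl j"
  shows "g \<in> transp n \<or> n = 4 \<and> cycles n g = {#4#} \<or> n = 6 \<and> cycles n g = {#2, 2, 2#}"
proof -
  have tp: "t permutes {1..n}" and gp: "g permutes {1..n}" using t transp_permutes g j L'.cl_iff by auto
  note T = cycles_transp[OF t]
  have eq: "L.class_mult t t i = L'.class_mult g g i" if "i < k" for i
    using class_mult_eq[OF j(1) j(1) that j(2) j(2) g g] .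
  have Tne: "cycles n t \<noteq> replicate_mset n 1"
  proof
    assume "cycles n t = replicate_mset n 1"
    then have "(2::nat) \<in># replicate_mset n 1 + {#1, 1#}" using T by (metis union_iff union_single_eq_member add_mset_add_single)
    then show False by (auto split: if_splits)
  qed
  have nid: "g \<noteq> id"
  proof
    assume "g = id"
    then have "j = L'.j0" using L'.class_id[OF j(1)] L'.cl_iff[OF j(1)] g cycles_id by metis
    then have "cycles n t = replicate_mset n 1" using L.class_id[OF j(1)] L.cl_iff[OF j(1)] j(2) j0_eq by metis
    then show False using Tne by simp
  qed
  have P: "{cycles n (t \<circ> (z \<circ> t \<circ> inv' z)) | z. z permutes {1..n}} \<subseteq> {N. split (cycles n t) N \<or> split N (cycles n t)}"
    using L.neighbours_iff[OF tp t] by blast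
  have "card {cycles n (g \<circ> (z \<circ> g \<circ> inv' z)) | z. z permutes {1..n}} = card {cycles n (t \<circ> (z \<circ> t \<circ> inv' z)) | z. z permutes {1..n}}"
    unfolding L.card_products[OF tp] L'.card_products[OF gp] using eq by (intro arg_cong[of _ _ card]) auto
  also have "\<dots> \<le> 3" using card_mono[OF transposition_products(2)[OF T] P] transposition_products(1)[OF T] by simp
  finally have few: "card {cycles n (g \<circ> (z \<circ> g \<circ> inv' z)) | z. z permutes {1..n}} \<le> 3" .
  have noself: "cycles n (g \<circ> (z \<circ> g \<circ> inv' z)) \<noteq> cycles n g" if z: "z permutes {1..n}" for z
  proof
    assume "cycles n (g \<circ> (z \<circ> g \<circ> inv' z)) = cycles n g"
    then have "L'.class_mult g g j \<noteq> 0" using L'.class_mult_nonzero[OF j(1)] L'.cl_iff[OF j(1)] g z by metis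
    then have "L.class_mult t t j \<noteq> 0" using eq j(1) by simp
    then have "split (cycles n t) (cycles n t)"
      using L.class_mult_nonzero[OF j(1)] L.cl_iff[OF j(1)] j(2) L.neighbours_iff[OF tp t] by metis
    then show False using split_size by fastforce
  qed
  show ?thesis using L.transposition_or_exceptional[OF gp nid few noself] by (auto simp: transp_def)
qed

text \<open>With the transpositions at the same column, both labellings induce the same splitting
  graph on columns, so \<open>labels_unique\<close> applies; the exceptional pairs are separated by
  multiplicities.\<close>

theorem labellings_equal:
  assumes t: "t \<in> transp n" and j: "j < k" "t \<in> L.cl j" "t \<in> L'.cl j"
  shows "(\<alpha>, \<beta>) = (\<alpha>', \<beta>')"
proof (rule eq_if_columns_eq)
  have rep: "\<exists>x. x \<in> L.cl i" "\<exists>x. x \<in> L'.cl i" if "i < k" for i using L.cl_nonempty[OF that] L'.cl_nonempty[OF that] by blast+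
  have perm: "x permutes {1..n}" "cycles n x = mset (\<beta> i)" if "x \<in> L.cl i" "i < k" for x i using that L.cl_iff by auto
  have perm': "x permutes {1..n}" "cycles n x = mset (\<beta>' i)" if "x \<in> L'.cl i" "i < k" for x i using that L'.cl_iff by auto
  have "mset (\<beta> i) = mset (\<beta>' i)" if i: "i \<in> {..<k}" for i
  proof (rule labels_unique[OF L.bij_types L'.bij_types _ _ _ i])
    fix i l assume "i \<in> {..<k}" "l \<in> {..<k}"
    then have il: "i < k" "l < k" by auto
    obtain x x' where x: "x \<in> L.cl i" "x' \<in> L'.cl i" using rep[OF il(1)] by blast
    have "L.class_mult x t l = L'.class_mult x' t l" using class_mult_eq[OF il(1) j(1) il(2) x(1) j(2) x(2) j(3)] .
    then show "split (mset (\<beta> i)) (mset (\<beta> l)) \<or> split (mset (\<beta> l)) (mset (\<beta> i)) \<longleftrightarrow>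
        split (mset (\<beta>' i)) (mset (\<beta>' l)) \<or> split (mset (\<beta>' l)) (mset (\<beta>' i))"
      using L.class_mult_nonzero[OF il(2), of x t] L'.class_mult_nonzero[OF il(2), of x' t]
        L.neighbours_iff[OF perm(1)[OF x(1) il(1)] t] L.neighbours_iff[OF perm'(1)[OF x(2) il(1)] t]
        perm(2)[OF x(1) il(1)] perm'(2)[OF x(2) il(1)] by metis
  next
    fix i assume "i \<in> {..<k}" "mset (\<beta> i) = replicate_mset n 1"
    then show "mset (\<beta>' i) = replicate_mset n 1" using L.class_id L'.class_id j0_eq by auto
  next
    fix i l a m assume "i \<in> {..<k}" "l \<in> {..<k}" and a: "a = 3 \<or> a = 4"
      and l: "mset (\<beta> l) = add_mset (a - 1) (replicate_mset (Suc (Suc m)) 1)" "mset (\<beta>' l) = mset (\<beta> l)"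
      and e: "{mset (\<beta> i), mset (\<beta>' i)} = {add_mset a (replicate_mset (Suc m) 1), {#a - 1, 2#} + replicate_mset m 1}"
    then have il: "i < k" "l < k" by auto
    obtain x x' where x: "x \<in> L.cl i" "x' \<in> L'.cl i" using rep[OF il(1)] by blast
    note px = perm[OF x(1) il(1)] and px' = perm'[OF x(2) il(1)]
    have "L.class_mult x t l = L'.class_mult x' t l" using class_mult_eq[OF il(1) j(1) il(2) x(1) j(2) x(2) j(3)] .
    \<comment> \<open>Cancelling the order of the centralizer of t leaves counts of transpositions,
      which are at least 3 on one side and at most 2 on the other.\<close>
    then have "card {s \<in> transp n. cycles n (x \<circ> s) = mset (\<beta> l)} = card {s \<in> transp n. cycles n (x' \<circ> s) = mset (\<beta> l)}"
      unfolding L.class_mult_cycles[OF il(2)] L'.class_mult_cycles[OF il(2)] L.count_neighbours[OF t] l(2)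
      using L.centralizer_pos[of t] by simp
    note c = this[unfolded l(1)]
    have "add_mset a (replicate_mset (Suc m) 1) \<noteq> {#a - 1, 2#} + replicate_mset m 1"
    proof
      assume "add_mset a (replicate_mset (Suc m) 1) = {#a - 1, 2#} + replicate_mset m 1"
      then have "a \<in># {#a - 1, 2#} + replicate_mset m 1" by (metis union_single_eq_member)
      then show False using a by (auto split: if_splits)
    qed
    then consider "cycles n x = add_mset a (replicate_mset (Suc m) 1)" "cycles n x' = {#a - 1, 2#} + replicate_mset m 1"
      | "cycles n x' = add_mset a (replicate_mset (Suc m) 1)" "cycles n x = {#a - 1, 2#} + replicate_mset m 1"
      using e px(2) px'(2) by (metis doubleton_eq_iff)
    then show False
    proof cases
      case 1
      then show ?thesis using count_splitting_cycle[OF px(1) a 1(1)] count_splitting_pair[OF px'(1) a 1(2)] c by simp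
    next
      case 2
      then show ?thesis using count_splitting_cycle[OF px'(1) a 2(1)] count_splitting_pair[OF px(1) a 2(2)] c by simp
    qed
  qed
  then show "\<beta> i = \<beta>' i" if "i < k" for i
    using that sorted_desc_mset_inj L.\<beta>_mem[OF that] L'.\<beta>_mem[OF that] by (auto simp: partitions_of_def)
qed

end

section \<open>Labellings from conjugacy classes\<close>

definition cclass :: "nat \<Rightarrow> (nat \<Rightarrow> nat) \<Rightarrow> (nat \<Rightarrow> nat) set" where
  "cclass n x = {z \<circ> x \<circ> inv' z | z. z permutes {1..n}}"

lemma cclassE:
  assumes "y \<in> cclass n x" obtains z where "z permutes {1..n}" "y = z \<circ> x \<circ> inv' z"
  using assms by (auto simp: cclass_def)

lemma cclassI: "z permutes {1..n} \<Longrightarrow> z \<circ> x \<circ> inv' z \<in> cclass n x"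
  by (auto simp: cclass_def)

lemma conj_conj:
  assumes "z permutes S" "w permutes S"
  shows "w \<circ> (z \<circ> x \<circ> inv' z) \<circ> inv' w = (w \<circ> z) \<circ> x \<circ> inv' (w \<circ> z)"
  using assms by (simp add: o_inv_distrib permutes_bij comp_assoc)

lemma conj_cancel:
  assumes "z permutes S"
  shows "inv' z \<circ> (z \<circ> x \<circ> inv' z) \<circ> z = x"
  by (simp add: fun_eq_iff permutes_inverses[OF assms])

lemma cclass_self: "x \<in> cclass n x"
  using cclassI[OF permutes_id, of x n] by simp

lemma cclass_permutes: "x permutes {1..n} \<Longrightarrow> y \<in> cclass n x \<Longrightarrow> y permutes {1..n}"
  by (auto elim!: cclassE intro!: permutes_compose permutes_inv)

lemma cclass_cycles: "x permutes {1..n} \<Longrightarrow> y \<in> cclass n x \<Longrightarrow> cycles n y = cycles n x"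
  by (auto elim!: cclassE simp only: cycles_conj)

lemma cclass_eq:
  assumes "y \<in> cclass n x" shows "cclass n y = cclass n x"
proof -
  have sub: "cclass n y \<subseteq> cclass n x" if yx: "y \<in> cclass n x" for x y
  proof
    fix u assume "u \<in> cclass n y"
    then obtain w where w: "w permutes {1..n}" "u = w \<circ> y \<circ> inv' w" by (rule cclassE)
    obtain z where z: "z permutes {1..n}" "y = z \<circ> x \<circ> inv' z" using yx by (rule cclassE)
    have "u = (w \<circ> z) \<circ> x \<circ> inv' (w \<circ> z)" unfolding w(2) z(2) by (rule conj_conj[OF z(1) w(1)])
    then show "u \<in> cclass n x" using cclassI[OF permutes_compose[OF z(1) w(1)]] by simp
  qed
  obtain z where z: "z permutes {1..n}" "y = z \<circ> x \<circ> inv' z" using assms by (rule cclassE)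
  have "x = inv' z \<circ> y \<circ> inv' (inv' z)" unfolding z(2) permutes_inv_inv[OF z(1)] by (rule conj_cancel[OF z(1), symmetric])
  then have "x \<in> cclass n y" using cclassI[OF permutes_inv[OF z(1)]] by metis
  then show ?thesis using sub assms by blast
qed

lemma conjugacy_classes_sym: "conjugacy_classes (sym_group n) = cclass n ` {x. x permutes {1..n}}"
proof -
  let ?\<phi> = "\<lambda>g. \<lambda>h\<in>carrier (sym_group n). g \<otimes>\<^bsub>sym_group n\<^esub> h \<otimes>\<^bsub>sym_group n\<^esub> inv\<^bsub>sym_group n\<^esub> g"
  have o: "Group_Action.orbit (sym_group n) ?\<phi> x = cclass n x" if x: "x permutes {1..n}" for x
  proof -
    have eq: "?\<phi> g x = g \<circ> x \<circ> inv' g" if "g permutes {1..n}" for g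
      using that x by (simp add: sym_group_simps sym_group_inv)
    show ?thesis unfolding Group_Action.orbit_def cclass_def
    proof (intro Collect_cong iffI)
      fix u assume "\<exists>g. u = ?\<phi> g x \<and> g \<in> carrier (sym_group n)"
      then obtain g where g: "g \<in> carrier (sym_group n)" "u = ?\<phi> g x" by blast
      then have "g permutes {1..n}" by (simp add: sym_group_simps)
      then show "\<exists>z. u = z \<circ> x \<circ> inv' z \<and> z permutes {1..n}" using eq[of g] g(2) by metis
    next
      fix u assume "\<exists>z. u = z \<circ> x \<circ> inv' z \<and> z permutes {1..n}"
      then obtain g where g: "g permutes {1..n}" "u = g \<circ> x \<circ> inv' g" by blast
      then have "g \<in> carrier (sym_group n)" by (simp add: sym_group_simps)
      then show "\<exists>g. u = ?\<phi> g x \<and> g \<in> carrier (sym_group n)" using eq[of g] g by metis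
    qed
  qed
  have "conjugacy_classes (sym_group n) = (\<lambda>x. Group_Action.orbit (sym_group n) ?\<phi> x) ` {x. x permutes {1..n}}"
    unfolding conjugacy_classes_def Group_Action.orbits_def by (auto simp: sym_group_simps)
  also have "\<dots> = cclass n ` {x. x permutes {1..n}}" using o by (intro image_cong) auto
  finally show ?thesis .
qed

text \<open>The choice does not matter, since cycle types are constant on a class.\<close>

definition class_type :: "nat \<Rightarrow> (nat \<Rightarrow> nat) set \<Rightarrow> nat list" where
  "class_type n K = cycle_type n (SOME g. g \<in> K)"

lemma classD:
  assumes "K \<in> conjugacy_classes (sym_group n)" "g \<in> K"
  shows "g permutes {1..n}" "K = cclass n g" "class_type n K = cycle_type n g"
proof -
  obtain x where x: "x permutes {1..n}" "K = cclass n x" using assms(1) conjugacy_classes_sym by auto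
  show "g permutes {1..n}" using x assms(2) cclass_permutes by blast
  show "K = cclass n g" using x assms(2) cclass_eq by blast
  have "(SOME g. g \<in> K) \<in> K" using assms(2) by (rule someI[of "\<lambda>g. g \<in> K"])
  then show "class_type n K = cycle_type n g"
    unfolding class_type_def cycle_type_eq_iff using cclass_cycles[OF x(1)] x(2) assms(2) by simp
qed

lemma class_nonempty: "K \<in> conjugacy_classes (sym_group n) \<Longrightarrow> \<exists>g. g \<in> K"
  unfolding conjugacy_classes_sym using cclass_self by blast

lemma class_type_onto: "class_type n ` conjugacy_classes (sym_group n) = partitions_of n"
proof (intro equalityI subsetI)
  fix \<nu> assume "\<nu> \<in> class_type n ` conjugacy_classes (sym_group n)"
  then obtain K where K: "K \<in> conjugacy_classes (sym_group n)" "\<nu> = class_type n K" by blast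
  then obtain g where "g \<in> K" using class_nonempty by blast
  then show "\<nu> \<in> partitions_of n" using classD[OF K(1)] cycle_type_partition K(2) by auto
next
  fix \<nu> assume \<nu>: "\<nu> \<in> partitions_of n"
  then obtain p where p: "p permutes {1..n}" "cycles n p = mset \<nu>" 
    using ex_cycles bij_betw_apply[OF bij_mset_partitions] by metis
  then have "cycle_type n p = \<nu>"
    using sorted_desc_mset_inj[OF sorted_cycle_type] mset_cycle_type \<nu> by (auto simp: partitions_of_def)
  moreover have K: "cclass n p \<in> conjugacy_classes (sym_group n)" using p conjugacy_classes_sym by auto
  ultimately have "\<nu> = class_type n (cclass n p)" using classD(3)[OF K cclass_self] by simp
  then show "\<nu> \<in> class_type n ` conjugacy_classes (sym_group n)" using K by blast
qed

lemma finite_classes: "finite (conjugacy_classes (sym_group n))"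
  unfolding conjugacy_classes_sym using finite_permutations[of "{1..n}"] by simp

text \<open>
  Squareness of the table makes the surjection from classes to cycle types a bijection; in other
  words, permutations of the same cycle type are conjugate.
\<close>

lemma same_type_conjugate_if_card:
  assumes "card (conjugacy_classes (sym_group n)) = card (partitions_of n)"
  shows "same_type_conjugate n" "bij_betw (class_type n) (conjugacy_classes (sym_group n)) (partitions_of n)"
proof -
  have inj: "inj_on (class_type n) (conjugacy_classes (sym_group n))"
    by (rule eq_card_imp_inj_on[OF finite_classes]) (simp add: class_type_onto assms)
  then show "bij_betw (class_type n) (conjugacy_classes (sym_group n)) (partitions_of n)"
    using class_type_onto by (simp add: bij_betw_def)
  show "same_type_conjugate n"
  proof
    fix p q assume pq: "p permutes {1..n}" "q permutes {1..n}" "cycles n p = cycles n q"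
    have K: "cclass n p \<in> conjugacy_classes (sym_group n)" "cclass n q \<in> conjugacy_classes (sym_group n)"
      using pq conjugacy_classes_sym by auto
    have "class_type n (cclass n p) = class_type n (cclass n q)"
      using classD(3)[OF K(1) cclass_self] classD(3)[OF K(2) cclass_self] pq(3) cycle_type_eq_iff by simp
    then have "cclass n p = cclass n q" using inj_onD[OF inj _ K] by blast
    then have "q \<in> cclass n p" using cclass_self by blast
    then show "\<exists>z. z permutes {1..n} \<and> q = z \<circ> p \<circ> inv' z" by (metis cclassE)
  qed
qed

text \<open>A character table with its row and column orderings exposed. The same matrix may carry
  several such orderings, and each gives a labelling.\<close>

definition table_data :: "nat \<Rightarrow> complex mat \<Rightarrow> (nat \<Rightarrow> (nat \<Rightarrow> nat) \<Rightarrow> complex) \<Rightarrow> (nat \<Rightarrow> (nat \<Rightarrow> nat) set) \<Rightarrow> bool" where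
  "table_data n X \<psi> C \<longleftrightarrow>
     bij_betw \<psi> {..<card (partitions_of n)} (irreducible_characters (sym_group n)) \<and>
     bij_betw C {..<card (partitions_of n)} (conjugacy_classes (sym_group n)) \<and>
     (\<forall>i<card (partitions_of n). \<forall>j<card (partitions_of n). \<forall>g\<in>C j. X $$ (i, j) = \<psi> i g)"

text \<open>Distinct shapes give distinct irreducible characters, and there are as many shapes as
  rows, so every row is a Specht character. The column labels are explicit, so that different class
  orderings can be compared.\<close>

lemma table_data_labelling:
  assumes d: "table_data n X \<psi> C" and X: "X \<in> carrier_mat (card (partitions_of n)) (card (partitions_of n))"
  obtains \<alpha> where "(\<alpha>, \<lambda>j\<in>{..<card (partitions_of n)}. class_type n (C j)) \<in> labellings n X"
    "\<And>i g. i < card (partitions_of n) \<Longrightarrow> g permutes {1..n} \<Longrightarrow> \<psi> i g = specht_character (\<alpha> i) g"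
proof -
  define k where "k = card (partitions_of n)"
  let ?Irr = "irreducible_characters (sym_group n)" and ?Cls = "conjugacy_classes (sym_group n)"
  have \<psi>: "bij_betw \<psi> {..<k} ?Irr" and C: "bij_betw C {..<k} ?Cls"
    and ent: "\<And>i j g. i < k \<Longrightarrow> j < k \<Longrightarrow> g \<in> C j \<Longrightarrow> X $$ (i, j) = \<psi> i g"
    using d by (auto simp: table_data_def k_def)
  have "card ?Cls = card (partitions_of n)" using bij_betw_same_card[OF C] by (simp add: k_def)
  note stc = same_type_conjugate_if_card[OF this]
  interpret same_type_conjugate n by (rule stc(1))
  define A where "A \<mu> = restrict (specht_character \<mu>) (carrier (sym_group n))" for \<mu>
  have A_mem: "A \<mu> \<in> ?Irr" if "\<mu> \<in> partitions_of n" for \<mu>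
    unfolding A_def specht_character_def
    by (rule irreducible_rep_transport, rule shape.specht_irreducible, rule shape.intro[OF that])
  have A_inj: "inj_on A (partitions_of n)"
  proof (rule inj_onI, rule ccontr)
    fix \<mu> \<nu> assume \<mu>: "\<mu> \<in> partitions_of n" and \<nu>: "\<nu> \<in> partitions_of n" and eq: "A \<mu> = A \<nu>" and ne: "\<mu> \<noteq> \<nu>"
    have "specht_character \<mu> g = specht_character \<nu> g" if "g permutes {1..n}" for g
      using fun_cong[OF eq, of g] that by (simp add: A_def sym_group_simps)
    then have "(\<Sum>g | g permutes {1..n}. specht_character \<mu> g * specht_character \<nu> g) =
        (\<Sum>g | g permutes {1..n}. specht_character \<mu> g * specht_character \<mu> g)" by (intro sum.cong) auto
    then show False using specht_orthogonal[OF \<mu> \<nu>] specht_orthogonal[OF \<mu> \<mu>] ne by simp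
  qed
  have "finite ?Irr" "card ?Irr = k" using bij_betw_finite[OF \<psi>] bij_betw_same_card[OF \<psi>] by auto
  \<comment> \<open>An injection between finite sets of equal size is onto.\<close>
  then have "A ` partitions_of n = ?Irr"
    using A_mem card_image[OF A_inj] by (intro card_subset_eq) (auto simp: k_def)
  then have A: "bij_betw A (partitions_of n) ?Irr" using A_inj by (simp add: bij_betw_def)
  define \<alpha> where "\<alpha> = restrict (inv_into (partitions_of n) A \<circ> \<psi>) {..<k}"
  have b\<alpha>: "bij_betw \<alpha> {..<k} (partitions_of n)"
    unfolding \<alpha>_def using bij_betw_trans[OF \<psi> bij_betw_inv_into[OF A]] by (simp add: bij_betw_restrict_eq)
  have A\<alpha>: "A (\<alpha> i) = \<psi> i" if "i < k" for i
    using that bij_betw_inv_into_right[OF A] bij_betw_apply[OF \<psi>] by (simp add: \<alpha>_def)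
  have val: "\<psi> i g = specht_character (\<alpha> i) g" if "i < k" "g permutes {1..n}" for i g
    using fun_cong[OF A\<alpha>[OF that(1)], of g] that(2) by (simp add: A_def sym_group_simps)
  define \<beta> where "\<beta> = restrict (class_type n \<circ> C) {..<k}"
  have b\<beta>: "bij_betw \<beta> {..<k} (partitions_of n)"
    unfolding \<beta>_def using bij_betw_trans[OF C stc(2)] by (simp add: bij_betw_restrict_eq)
  have "X $$ (i, j) = chi (\<alpha> i) (\<beta> j)" if i: "i < k" and j: "j < k" for i j
  proof -
    have Cj: "C j \<in> ?Cls" using bij_betw_apply[OF C] j by simp
    then obtain g where g: "g \<in> C j" using class_nonempty by blast
    have "chi (\<alpha> i) (\<beta> j) = specht_character (\<alpha> i) g"
      using classD[OF Cj g] j bij_betw_apply[OF b\<alpha>] i by (intro chi_eq) (auto simp: \<beta>_def)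
    then show ?thesis using ent[OF i j g] val[OF i] classD(1)[OF Cj g] by simp
  qed
  then have "(\<alpha>, \<beta>) \<in> labellings n X"
    using X b\<alpha> b\<beta> by (auto simp: labellings_def \<alpha>_def \<beta>_def k_def[symmetric])
  moreover have "\<beta> = (\<lambda>j\<in>{..<card (partitions_of n)}. class_type n (C j))" by (auto simp: \<beta>_def k_def)
  ultimately show thesis using that val k_def by blast
qed

text \<open>The rows of X are pairwise different because its first ordering uses different
  characters. Hence the new characters are different too, and counting makes them all of
  them.\<close>

lemma table_data_relabel:
  assumes d: "table_data n X \<psi> C" and C': "bij_betw C' {..<card (partitions_of n)} (conjugacy_classes (sym_group n))"
    and \<psi>': "\<And>i. i < card (partitions_of n) \<Longrightarrow> \<psi>' i \<in> irreducible_characters (sym_group n)"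
    and ent': "\<And>i j g. i < card (partitions_of n) \<Longrightarrow> j < card (partitions_of n) \<Longrightarrow> g \<in> C' j \<Longrightarrow> X $$ (i, j) = \<psi>' i g"
  shows "table_data n X \<psi>' C'"
proof -
  define k where "k = card (partitions_of n)"
  let ?Irr = "irreducible_characters (sym_group n)" and ?Cls = "conjugacy_classes (sym_group n)"
  have \<psi>: "bij_betw \<psi> {..<k} ?Irr" and C: "bij_betw C {..<k} ?Cls"
    and ent: "\<And>i j g. i < k \<Longrightarrow> j < k \<Longrightarrow> g \<in> C j \<Longrightarrow> X $$ (i, j) = \<psi> i g"
    using d by (auto simp: table_data_def k_def)
  have ext: "f \<in> extensional (carrier (sym_group n))" if "f \<in> ?Irr" for f
    using that by (auto simp: irreducible_characters_def)
  have "inj_on \<psi>' {..<k}"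
  proof (rule inj_onI)
    fix i i' assume i: "i \<in> {..<k}" "i' \<in> {..<k}" and eq: "\<psi>' i = \<psi>' i'"
    have row: "X $$ (i, j) = X $$ (i', j)" if "j < k" for j
    proof -
      have "C' j \<in> ?Cls" using bij_betw_apply[OF C'] that by (simp add: k_def)
      then obtain g where "g \<in> C' j" using class_nonempty by blast
      then show ?thesis using ent'[of i j g] ent'[of i' j g] i that eq by (simp add: k_def)
    qed
    have "\<psi> i = \<psi> i'"
    proof (rule extensionalityI[OF ext ext])
      fix g assume "g \<in> carrier (sym_group n)"
      then have "cclass n g \<in> ?Cls" by (auto simp: conjugacy_classes_sym sym_group_simps)
      then obtain j where "j < k" "C j = cclass n g" using C unfolding bij_betw_def by (metis imageE lessThan_iff)
      then show "\<psi> i g = \<psi> i' g" using row ent[of i j g] ent[of i' j g] i cclass_self by simp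
    qed (use bij_betw_apply[OF \<psi>] i in auto)
    then show "i = i'" using inj_onD[OF bij_betw_imp_inj_on[OF \<psi>]] i by blast
  qed
  moreover have "\<psi>' ` {..<k} = ?Irr"
  proof (rule card_subset_eq)
    show "finite ?Irr" using bij_betw_finite[OF \<psi>] by simp
    show "\<psi>' ` {..<k} \<subseteq> ?Irr" using \<psi>' by (auto simp: k_def)
    show "card (\<psi>' ` {..<k}) = card ?Irr" using card_image[OF \<open>inj_on \<psi>' {..<k}\<close>] bij_betw_same_card[OF \<psi>] by simp
  qed
  ultimately have "bij_betw \<psi>' {..<k} ?Irr" by (simp add: bij_betw_def)
  then show ?thesis using C' ent' by (simp add: table_data_def k_def)
qed

text \<open>Precomposition with a surjective endomorphism f and multiplication by a linear character
  c leave the invariant subspaces unchanged. Used with c = 1 for the outer automorphism and with f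
  the identity for the sign.\<close>

lemma irreducible_rep_twist:
  assumes irr: "irreducible_rep G V \<rho>" and hom: "\<And>g. g \<in> carrier G \<Longrightarrow> f g \<in> carrier G"
    and onto: "\<And>g. g \<in> carrier G \<Longrightarrow> \<exists>h\<in>carrier G. f h = g"
    and mult: "\<And>g h. g \<in> carrier G \<Longrightarrow> h \<in> carrier G \<Longrightarrow> f (g \<otimes>\<^bsub>G\<^esub> h) = f g \<otimes>\<^bsub>G\<^esub> f h" and one: "f \<one>\<^bsub>G\<^esub> = \<one>\<^bsub>G\<^esub>"
    and c: "\<And>g. g \<in> carrier G \<Longrightarrow> c g \<noteq> 0" "\<And>g h. g \<in> carrier G \<Longrightarrow> h \<in> carrier G \<Longrightarrow> c (g \<otimes>\<^bsub>G\<^esub> h) = c g * c h" "c \<one>\<^bsub>G\<^esub> = 1"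
  shows "irreducible_rep G V (\<lambda>g v. cscale (c g) (\<rho> (f g) v))"
proof -
  have rep: "linear_rep G V \<rho>" and ne: "V \<noteq> {0}" using irr by (auto simp: irreducible_rep_def)
  note R = linear_repD[OF rep]
  have Vs: "cfun.subspace V" by (rule fin_dim.subspace[OF R(1)])
  have R3: "\<rho> g (v + w) = \<rho> g v + \<rho> g w" "\<rho> g (cscale a v) = cscale a (\<rho> g v)" if "g \<in> carrier G" "v \<in> V" "w \<in> V" for g v w a
    using R(3)[OF that(1)] that by (auto simp: lin_on_def)
  have "linear_rep G V (\<lambda>g v. cscale (c g) (\<rho> (f g) v))"
    unfolding linear_rep_def
  proof (intro conjI)
    show "\<exists>B. finite B \<and> cfun.span B = V" using R(1) by (simp add: fin_dim_def)
    show "\<forall>g\<in>carrier G. \<forall>v\<in>V. cscale (c g) (\<rho> (f g) v) \<in> V" using R(2) hom Vs by (simp add: cfun.subspace_scale)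
    show "\<forall>g\<in>carrier G. \<forall>v\<in>V. \<forall>w\<in>V. cscale (c g) (\<rho> (f g) (v + w)) = cscale (c g) (\<rho> (f g) v) + cscale (c g) (\<rho> (f g) w)"
      using R3 hom cfun.scale_right_distrib by metis
    show "\<forall>g\<in>carrier G. \<forall>a. \<forall>v\<in>V. cscale (c g) (\<rho> (f g) (cscale a v)) = cscale a (cscale (c g) (\<rho> (f g) v))"
      using R3(2) hom by (simp add: mult.commute)
    show "\<forall>v\<in>V. cscale (c \<one>\<^bsub>G\<^esub>) (\<rho> (f \<one>\<^bsub>G\<^esub>) v) = v" using R(4) one c(3) by simp
    show "\<forall>g\<in>carrier G. \<forall>h\<in>carrier G. \<forall>v\<in>V. cscale (c (g \<otimes>\<^bsub>G\<^esub> h)) (\<rho> (f (g \<otimes>\<^bsub>G\<^esub> h)) v) =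
        cscale (c g) (\<rho> (f g) (cscale (c h) (\<rho> (f h) v)))"
      using R(2,5) R3(2) hom mult c(2) by simp
  qed
  moreover have "W = {0} \<or> W = V" if W: "cfun.subspace W" "W \<subseteq> V" and inv: "\<And>g w. g \<in> carrier G \<Longrightarrow> w \<in> W \<Longrightarrow> cscale (c g) (\<rho> (f g) w) \<in> W" for W
  proof -
    have "\<rho> g w \<in> W" if g: "g \<in> carrier G" and w: "w \<in> W" for g w
    proof -
      obtain h where h: "h \<in> carrier G" "f h = g" using onto[OF g] by blast
      then have "cscale (inverse (c h)) (cscale (c h) (\<rho> g w)) \<in> W" using inv[OF h(1) w] W(1) cfun.subspace_scale by metis
      then show ?thesis using c(1)[OF h(1)] by simp
    qed
    then show ?thesis using irr W unfolding irreducible_rep_def by blast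
  qed
  ultimately show ?thesis using ne unfolding irreducible_rep_def by blast
qed

lemma irreducible_character_twist:
  assumes \<psi>: "\<psi> \<in> irreducible_characters G" and hom: "\<And>g. g \<in> carrier G \<Longrightarrow> f g \<in> carrier G"
    and onto: "\<And>g. g \<in> carrier G \<Longrightarrow> \<exists>h\<in>carrier G. f h = g"
    and mult: "\<And>g h. g \<in> carrier G \<Longrightarrow> h \<in> carrier G \<Longrightarrow> f (g \<otimes>\<^bsub>G\<^esub> h) = f g \<otimes>\<^bsub>G\<^esub> f h" and one: "f \<one>\<^bsub>G\<^esub> = \<one>\<^bsub>G\<^esub>"
    and c: "\<And>g. g \<in> carrier G \<Longrightarrow> c g \<noteq> 0" "\<And>g h. g \<in> carrier G \<Longrightarrow> h \<in> carrier G \<Longrightarrow> c (g \<otimes>\<^bsub>G\<^esub> h) = c g * c h" "c \<one>\<^bsub>G\<^esub> = 1"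
  shows "restrict (\<lambda>g. c g * \<psi> (f g)) (carrier G) \<in> irreducible_characters G"
proof -
  obtain V :: "(nat \<Rightarrow> complex) set" and \<rho> where V: "irreducible_rep G V \<rho>" "\<psi> = restrict (rep_character V \<rho>) (carrier G)"
    using \<psi> unfolding irreducible_characters_def by blast
  have rep: "linear_rep G V \<rho>" using V(1) by (simp add: irreducible_rep_def)
  interpret fin_dim V by (rule linear_repD(1)[OF rep])
  let ?\<sigma> = "\<lambda>g v. cscale (c g) (\<rho> (f g) v)"
  have "rep_character V ?\<sigma> g = c g * rep_character V \<rho> (f g)" if "g \<in> carrier G" for g
    unfolding rep_character_def trace_on_coord sum_distrib_left
    using linear_repD(2)[OF rep hom[OF that]] basis_subset by (intro sum.cong refl coord_scale) auto
  then have "restrict (\<lambda>g. c g * \<psi> (f g)) (carrier G) = restrict (rep_character V ?\<sigma>) (carrier G)"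
    unfolding V(2) using hom by (intro restrict_ext) simp
  then show ?thesis using irreducible_rep_transport[OF irreducible_rep_twist[OF V(1) hom onto mult one c]] by simp
qed

section \<open>Counting labellings\<close>

lemma two_labellingsI:
  assumes "same_type_conjugate n" "X \<in> carrier_mat (card (partitions_of n)) (card (partitions_of n))"
    "(\<alpha>, \<beta>) \<in> labellings n X" "(\<alpha>', \<beta>') \<in> labellings n X"
  shows "two_labellings n X \<alpha> \<beta> \<alpha>' \<beta>'"
  using assms by (simp add: two_labellings_def labelled_def labelled_axioms_def)

text \<open>If the transpositions of the first labelling kept their column, the labellings would be
  equal by \<open>labellings_equal\<close>.\<close>

lemma (in two_labellings) exceptional_column:
  assumes t: "t \<in> transp n" and j: "j < k" "t \<in> L.cl j" and ne: "(\<alpha>, \<beta>) \<noteq> (\<alpha>', \<beta>')"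
  shows "n = 4 \<and> mset (\<beta>' j) = {#4#} \<or> n = 6 \<and> mset (\<beta>' j) = {#2, 2, 2#}"
proof -
  obtain g where g: "g \<in> L'.cl j" using L'.cl_nonempty[OF j(1)] by blast
  have "g \<notin> transp n"
  proof
    assume "g \<in> transp n"
    then have "cycles n g = cycles n t" using L.cycles_transp_iff[OF t] transp_permutes by blast
    then have "t \<in> L'.cl j" using g L'.cl_iff[OF j(1)] transp_permutes[OF t] by simp
    then show False using labellings_equal[OF t j] ne by blast
  qed
  then show ?thesis using transposition_column[OF t j g] L'.cl_iff[OF j(1)] g by auto
qed

text \<open>n = 1 is separate because there is no transposition; there is then only one
  partition.\<close>

lemma labelling_unique:
  assumes stc: "same_type_conjugate n" and X: "X \<in> carrier_mat (card (partitions_of n)) (card (partitions_of n))"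
    and L: "L \<in> labellings n X" "L' \<in> labellings n X" and n: "1 \<le> n" "n \<noteq> 4" "n \<noteq> 6"
  shows "L = L'"
proof -
  obtain \<alpha> \<beta> \<alpha>' \<beta>' where LL: "L = (\<alpha>, \<beta>)" "L' = (\<alpha>', \<beta>')" by (cases L, cases L')
  interpret two_labellings "card (partitions_of n)" n X \<alpha> \<beta> \<alpha>' \<beta>' using two_labellingsI[OF stc X] L LL by blast
  show ?thesis
  proof (cases "n = 1")
    case True
    have one: "\<nu> = [1]" if "\<nu> \<in> partitions_of n" for \<nu>
    proof -
      have P: "mset \<nu> \<in> parts 1" using bij_betw_apply[OF bij_mset_partitions that] True by simp
      have "mset \<nu> = replicate_mset 1 1"
        by (rule parts_all_ones[OF P]) (use P member_le_sum_list in \<open>auto simp: parts_def sum_mset_sum_list dest!: member_le_sum_list\<close>)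
      then show ?thesis by simp
    qed
    have "\<beta> j = \<beta>' j" if "j < card (partitions_of n)" for j using one[OF L.\<beta>_mem[OF that]] one[OF L'.\<beta>_mem[OF that]] by simp
    then show ?thesis unfolding LL by (rule eq_if_columns_eq)
  next
    case False
    have t: "transpose 1 2 \<in> transp n" using False n(1) by (intro transpI) auto
    then obtain j where "j < card (partitions_of n)" "transpose 1 2 \<in> L.cl j" using L.ex_class transp_permutes by blast
    then show ?thesis unfolding LL using exceptional_column[OF t] n by blast
  qed
qed

text \<open>Any labelling other than \<open>L0\<close> places the transpositions at the column that
  \<open>L0\<close> marks with the exceptional type. There is just one such column, so a third
  labelling would agree with \<open>L1\<close>.\<close>

lemma card_labellings_exceptional:
  assumes stc: "same_type_conjugate n" and X: "X \<in> carrier_mat (card (partitions_of n)) (card (partitions_of n))"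
    and n: "n = 4 \<or> n = 6" and L0: "L0 \<in> labellings n X" and L1: "L1 \<in> labellings n X" and ne: "L0 \<noteq> L1"
  shows "card (labellings n X) = 2"
proof -
  have t: "transpose 1 2 \<in> transp n" using n by (intro transpI) auto
  let ?t = "transpose 1 (2::nat)"
  obtain a0 b0 where p0: "L0 = (a0, b0)" by (cases L0)
  have col: "\<exists>j<card (partitions_of n). cycles n ?t = mset (b j) \<and> mset (b0 j) = (if n = 4 then {#4#} else {#2, 2, 2#})"
    if ab: "(a, b) \<in> labellings n X" "(a, b) \<noteq> L0" for a b
  proof -
    interpret two_labellings "card (partitions_of n)" n X a b a0 b0 using two_labellingsI[OF stc X ab(1)] L0 p0 by blast
    obtain j where j: "j < card (partitions_of n)" "?t \<in> L.cl j" using L.ex_class transp_permutes[OF t] by blast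
    then show ?thesis using exceptional_column[OF t j] ab(2) p0 n L.cl_iff[OF j(1)] by (intro exI[of _ j]) auto
  qed
  have "L = L0 \<or> L = L1" if L: "L \<in> labellings n X" for L
  proof (rule ccontr)
    assume "\<not> (L = L0 \<or> L = L1)"
    then have neL: "L \<noteq> L0" "L \<noteq> L1" by auto
    obtain a b a1 b1 where p: "L = (a, b)" "L1 = (a1, b1)" by (cases L, cases L1)
    interpret two_labellings "card (partitions_of n)" n X a b a1 b1 using two_labellingsI[OF stc X] L L1 p by blast
    interpret L0: labelled n X a0 b0 "card (partitions_of n)" using two_labellingsI[OF stc X] L0 p0 by (simp add: two_labellings_def)
    obtain j where j: "j < card (partitions_of n)" "cycles n ?t = mset (b j)" "mset (b0 j) = (if n = 4 then {#4#} else {#2, 2, 2#})"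
      using col[of a b] L neL(1) p by auto
    obtain j' where j': "j' < card (partitions_of n)" "cycles n ?t = mset (b1 j')" "mset (b0 j') = (if n = 4 then {#4#} else {#2, 2, 2#})"
      using col[of a1 b1] L1 ne p by auto
    have "j = j'" using inj_onD[OF bij_betw_imp_inj_on[OF L0.bij_types], of j j'] j j' by auto
    then have "?t \<in> L.cl j" "?t \<in> L'.cl j" using j j' L.cl_iff L'.cl_iff transp_permutes[OF t] by auto
    then have "(a, b) = (a1, b1)" by (rule labellings_equal[OF t j(1)])
    then show False using neL p by simp
  qed
  then have "labellings n X = {L0, L1}" using L0 L1 by blast
  then show ?thesis using ne by simp
qed

lemma card_labellings_two_data:
  assumes stc: "same_type_conjugate n" and X: "X \<in> carrier_mat (card (partitions_of n)) (card (partitions_of n))"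
    and n: "n = 4 \<or> n = 6" and d: "table_data n X \<psi> C" "table_data n X \<psi>' C'"
    and j: "j < card (partitions_of n)" "class_type n (C j) \<noteq> class_type n (C' j)"
  shows "card (labellings n X) = 2"
proof -
  let ?b = "\<lambda>C. \<lambda>j\<in>{..<card (partitions_of n)}. class_type n (C j)"
  obtain a where a: "(a, ?b C) \<in> labellings n X" using table_data_labelling[OF d(1) X] by blast
  obtain a' where a': "(a', ?b C') \<in> labellings n X" using table_data_labelling[OF d(2) X] by blast
  have "?b C j \<noteq> ?b C' j" using j by simp
  then have "?b C \<noteq> ?b C'" by metis
  then show ?thesis by (intro card_labellings_exceptional[OF stc X n a a']) blast
qed

section \<open>The outer automorphism of the symmetric group of degree six\<close>

text \<open>
  Row \<open>i\<close>, column \<open>j\<close> (with \<open>i < j\<close>) of the table lists the values of a fixed-point-free involution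
  \<open>\<sigma>\<^sub>i\<^sub>j\<close>: the syntheme shared by the \<open>i\<close>-th and \<open>j\<close>-th total.  The six totals are numbered so that the duad
  \<open>{a, b}\<close> lies in \<open>\<sigma>\<^sub>i\<^sub>j\<close> iff the duad \<open>{i, j}\<close> lies in \<open>\<sigma>\<^sub>a\<^sub>b\<close>.
\<close>

definition syntheme_table :: "nat list list list" where
  "syntheme_table =
    [[], [[], [], [0, 2, 1, 4, 3, 6, 5], [0, 4, 6, 5, 1, 3, 2], [0, 3, 5, 1, 6, 2, 4], [0, 6, 3, 2, 5, 4, 1], [0, 5, 4, 6, 2, 1, 3]],
     [[], [], [], [0, 5, 3, 2, 6, 1, 4], [0, 6, 4, 5, 2, 3, 1], [0, 4, 5, 6, 1, 2, 3], [0, 3, 6, 1, 5, 4, 2]],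
     [[], [], [], [], [0, 2, 1, 6, 5, 4, 3], [0, 3, 4, 1, 2, 6, 5], [0, 6, 5, 4, 3, 2, 1]],
     [[], [], [], [], [], [0, 5, 6, 4, 3, 1, 2], [0, 4, 3, 2, 1, 6, 5]],
     [[], [], [], [], [], [], [0, 2, 1, 5, 6, 3, 4]]]"

definition syn :: "nat \<Rightarrow> nat \<Rightarrow> nat \<Rightarrow> nat" where
  "syn i j x = syntheme_table ! min i j ! max i j ! x"

text \<open>An executable copy of \<open>transpose\<close>, for evaluating the table
  identities.\<close>

definition swap_val :: "nat \<Rightarrow> nat \<Rightarrow> nat \<Rightarrow> nat" where
  "swap_val a b x = (if x = a then b else if x = b then a else x)"

definition six :: "nat list" where "six = [1, 2, 3, 4, 5, 6]"

lemma set_six: "set six = {1..6}"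
  unfolding six_def by auto

lemma syn_table_involution:
  "list_all (\<lambda>i. list_all (\<lambda>j. i < j \<longrightarrow> list_all (\<lambda>x. syn i j x \<in> set six \<and> syn i j x \<noteq> x \<and> syn i j (syn i j x) = x) six) six) six"
  by code_simp

definition duads :: "(nat \<times> nat) list" where
  "duads = concat (map (\<lambda>i. map (Pair i) (filter ((<) i) six)) six)"

lemma set_duads: "(i, j) \<in> set duads \<longleftrightarrow> i \<in> set six \<and> j \<in> set six \<and> i < j"
  by (auto simp: duads_def)

lemma syn_table_injective: "distinct (map (\<lambda>(i, j). map (syn i j) six) duads)"
  by code_simp

text \<open>Conjugation by the transposition (a b) acts on the synthemes by applying \<sigma> with
  index {a, b} to their index pairs. The companion \<open>syn_table_syntheme\<close> exchanges the
  two roles.\<close>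

lemma syn_table_transpose:
  "list_all (\<lambda>a. list_all (\<lambda>b. a < b \<longrightarrow> list_all (\<lambda>i. list_all (\<lambda>j. i < j \<longrightarrow> list_all (\<lambda>x.
     swap_val a b (syn i j x) = syn (syn a b i) (syn a b j) (swap_val a b x)) six) six) six) six) six"
  by code_simp

lemma syn_table_syntheme:
  "list_all (\<lambda>a. list_all (\<lambda>b. a < b \<longrightarrow> list_all (\<lambda>i. list_all (\<lambda>j. i < j \<longrightarrow> list_all (\<lambda>x.
     syn a b (syn i j x) = syn (swap_val a b i) (swap_val a b j) (syn a b x)) six) six) six) six) six"
  by code_simp

lemma syn_commute: "syn i j = syn j i"
  by (simp add: syn_def fun_eq_iff min.commute max.commute)

lemma swap_val_transpose: "swap_val a b = transpose a b"
  by (simp add: swap_val_def transpose_def fun_eq_iff)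

lemma syn_involution:
  assumes "i \<in> {1..6}" "j \<in> {1..6}" "i \<noteq> j" "x \<in> {1..6}"
  shows "syn i j x \<in> {1..6}" "syn i j x \<noteq> x" "syn i j (syn i j x) = x"
proof -
  have *: "syn i j x \<in> set six \<and> syn i j x \<noteq> x \<and> syn i j (syn i j x) = x" if "i < j" "i \<in> set six" "j \<in> set six" "x \<in> set six" for i j x
    using syn_table_involution[unfolded list_all_iff, rule_format, OF that(2,3,1,4)] by blast
  have "syn i j x \<in> set six \<and> syn i j x \<noteq> x \<and> syn i j (syn i j x) = x"
    using *[of i j x] *[of j i x] assms unfolding set_six syn_commute[of j i] by (cases i j rule: linorder_cases) auto
  then show "syn i j x \<in> {1..6}" "syn i j x \<noteq> x" "syn i j (syn i j x) = x" unfolding set_six by auto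
qed

lemma syn_injective:
  assumes "i \<in> {1..6}" "j \<in> {1..6}" "i \<noteq> j" "k \<in> {1..6}" "l \<in> {1..6}" "k \<noteq> l" "\<And>x. x \<in> {1..6} \<Longrightarrow> syn i j x = syn k l x"
  shows "{i, j} = {k, l}"
proof -
  have *: "i = k \<and> j = l" if "i < j" "k < l" "i \<in> set six" "j \<in> set six" "k \<in> set six" "l \<in> set six" "\<And>x. x \<in> set six \<Longrightarrow> syn i j x = syn k l x" for i j k l
  proof -
    have inj: "inj_on (\<lambda>(i, j). map (syn i j) six) (set duads)" using syn_table_injective by (simp only: distinct_map)
    have "(i, j) = (k, l)" by (rule inj_onD[OF inj]) (use that in \<open>auto simp: set_duads\<close>)
    then show ?thesis by simp
  qed
  show ?thesis
    using *[of "min i j" "max i j" "min k l" "max k l"] assms unfolding set_six syn_def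
    by (cases i j rule: linorder_cases; cases k l rule: linorder_cases) (auto simp: min_def max_def)
qed

lemma syn_transpose:
  assumes "a \<in> {1..6}" "b \<in> {1..6}" "a \<noteq> b" "i \<in> {1..6}" "j \<in> {1..6}" "i \<noteq> j" "x \<in> {1..6}"
  shows "transpose a b (syn i j x) = syn (syn a b i) (syn a b j) (transpose a b x)"
    and "syn a b (syn i j x) = syn (transpose a b i) (transpose a b j) (syn a b x)"
proof -
  have *: "transpose a b (syn i j x) = syn (syn a b i) (syn a b j) (transpose a b x) \<and>
      syn a b (syn i j x) = syn (transpose a b i) (transpose a b j) (syn a b x)"
    if "a < b" "i < j" "a \<in> set six" "b \<in> set six" "i \<in> set six" "j \<in> set six" "x \<in> set six" for a b i j x
    using syn_table_transpose[unfolded list_all_iff swap_val_transpose, rule_format, OF that(3,4,1,5,6,2,7)]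
      syn_table_syntheme[unfolded list_all_iff swap_val_transpose, rule_format, OF that(3,4,1,5,6,2,7)] ..
  have "transpose a b (syn i j x) = syn (syn a b i) (syn a b j) (transpose a b x) \<and>
      syn a b (syn i j x) = syn (transpose a b i) (transpose a b j) (syn a b x)"
  proof (cases a b rule: linorder_cases)
    case less
    then show ?thesis
    proof (cases i j rule: linorder_cases)
      case greater
      then show ?thesis using *[of a b j i x] less assms unfolding set_six
        syn_commute[of j i] syn_commute[of "syn a b j"] syn_commute[of "transpose a b j"] by simp
    qed (use *[of a b i j x] assms in \<open>auto simp: set_six\<close>)
  next
    case greater
    then show ?thesis
    proof (cases i j rule: linorder_cases)
      case greater
      then show ?thesis using *[of b a j i x] \<open>b < a\<close> assms unfolding set_six
        syn_commute[of b a] transpose_commute[of b a]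
        syn_commute[of j i] syn_commute[of "syn a b j"] syn_commute[of "transpose a b j"] by simp
    next
      case less
      then show ?thesis using *[of b a i j x] \<open>b < a\<close> assms unfolding set_six
        syn_commute[of b a] transpose_commute[of b a] by simp
    qed (use assms in auto)
  qed (use assms in auto)
  then show "transpose a b (syn i j x) = syn (syn a b i) (syn a b j) (transpose a b x)"
    "syn a b (syn i j x) = syn (transpose a b i) (transpose a b j) (syn a b x)" by auto
qed

text \<open>Extended by the identity outside {1..6}, so that it is a permutation of the whole
  type.\<close>

definition syntheme :: "nat \<Rightarrow> nat \<Rightarrow> nat \<Rightarrow> nat" where
  "syntheme i j x = (if x \<in> {1..6} then syn i j x else x)"

lemma syntheme_permutes:
  assumes "i \<in> {1..6}" "j \<in> {1..6}" "i \<noteq> j"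
  shows "syntheme i j permutes {1..6}"
proof (rule bij_imp_permutes)
  show "bij_betw (syntheme i j) {1..6} {1..6}"
    by (rule bij_betwI[of _ _ _ "syntheme i j"]) (use syn_involution[OF assms] in \<open>auto simp: syntheme_def simp del: atLeastAtMost_iff\<close>)
qed (auto simp: syntheme_def)

text \<open>q is the permutation of the six totals induced by p. As a relation it can be built up
  along transpositions from either side.\<close>

definition dual :: "(nat \<Rightarrow> nat) \<Rightarrow> (nat \<Rightarrow> nat) \<Rightarrow> bool" where
  "dual p q \<longleftrightarrow> p permutes {1..6} \<and> q permutes {1..6} \<and>
     (\<forall>i\<in>{1..6}. \<forall>j\<in>{1..6}. i \<noteq> j \<longrightarrow> p \<circ> syntheme i j = syntheme (q i) (q j) \<circ> p)"

lemma dual_id: "dual id id"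
  by (simp add: dual_def permutes_id)

lemma dual_comp:
  assumes "dual p q" "dual p' q'" shows "dual (p \<circ> p') (q \<circ> q')"
  unfolding dual_def
proof (intro conjI ballI impI)
  show "p \<circ> p' permutes {1..6}" "q \<circ> q' permutes {1..6}" using assms by (auto simp: dual_def intro: permutes_compose)
  fix i j :: nat assume ij: "i \<in> {1..6}" "j \<in> {1..6}" "i \<noteq> j"
  have q': "q' permutes {1..6}" using assms(2) by (simp add: dual_def)
  have "q' i \<in> {1..6}" "q' j \<in> {1..6}" "q' i \<noteq> q' j"
    using ij permutes_in_image[OF q'] inj_eq[OF permutes_inj[OF q']] by auto
  then have 1: "p \<circ> syntheme (q' i) (q' j) = syntheme (q (q' i)) (q (q' j)) \<circ> p" using assms(1) by (simp add: dual_def)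
  have "p' \<circ> syntheme i j = syntheme (q' i) (q' j) \<circ> p'" using assms(2) ij by (simp add: dual_def)
  then have "(p \<circ> p') \<circ> syntheme i j = (p \<circ> syntheme (q' i) (q' j)) \<circ> p'" by (simp add: comp_assoc)
  then show "(p \<circ> p') \<circ> syntheme i j = syntheme ((q \<circ> q') i) ((q \<circ> q') j) \<circ> (p \<circ> p')" unfolding 1 by (simp add: comp_assoc)
qed

text \<open>The first part makes every p have a partner, the second makes every q occur as
  one.\<close>

lemma dual_transpose:
  assumes "a \<in> {1..6}" "b \<in> {1..6}" "a \<noteq> b"
  shows "dual (transpose a b) (syntheme a b)" "dual (syntheme a b) (transpose a b)"
proof -
  have t: "transpose a b permutes {1..6}" using assms(1,2) by (rule transpose_permutes)
  note s = syntheme_permutes[OF assms]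
  have in6: "transpose a b x \<in> {1..6} \<longleftrightarrow> x \<in> {1..6}" for x by (rule permutes_in_image[OF t])
  have out: "transpose a b x = x" if "x \<notin> {1..6}" for x using permutes_not_in[OF t that] .
  have "transpose a b \<circ> syntheme i j = syntheme (syntheme a b i) (syntheme a b j) \<circ> transpose a b"
    "syntheme a b \<circ> syntheme i j = syntheme (transpose a b i) (transpose a b j) \<circ> syntheme a b"
    if ij: "i \<in> {1..6}" "j \<in> {1..6}" "i \<noteq> j" for i j
  proof -
    have "(transpose a b \<circ> syntheme i j) x = (syntheme (syntheme a b i) (syntheme a b j) \<circ> transpose a b) x \<and>
      (syntheme a b \<circ> syntheme i j) x = (syntheme (transpose a b i) (transpose a b j) \<circ> syntheme a b) x" for x
    proof (cases "x \<in> {1..6}")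
      case True
      then show ?thesis unfolding comp_apply syntheme_def
        using syn_transpose[OF assms ij True] ij in6[of x] syn_involution(1)[OF assms True] syn_involution(1)[OF ij True]
        by (simp only: if_True)
    next
      case False
      then show ?thesis unfolding comp_apply syntheme_def using out[OF False] by (simp only: if_False)
    qed
    then show "transpose a b \<circ> syntheme i j = syntheme (syntheme a b i) (syntheme a b j) \<circ> transpose a b"
      "syntheme a b \<circ> syntheme i j = syntheme (transpose a b i) (transpose a b j) \<circ> syntheme a b" by (auto simp only: fun_eq_iff)
  qed
  then show "dual (transpose a b) (syntheme a b)" "dual (syntheme a b) (transpose a b)" unfolding dual_def using t s by blast+
qed

text \<open>Different duads carry different synthemes, so q and q' agree on duads; two duads meeting
  in i determine the image of i.\<close>

lemma dual_unique:
  assumes "dual p q" "dual p q'" shows "q = q'"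
proof -
  have p: "p permutes {1..6}" and q: "q permutes {1..6}" and q': "q' permutes {1..6}" using assms by (auto simp: dual_def)
  have pair: "{q i, q j} = {q' i, q' j}" if ij: "i \<in> {1..6}" "j \<in> {1..6}" "i \<noteq> j" for i j
  proof (rule syn_injective)
    show "q i \<in> {1..6}" "q j \<in> {1..6}" "q' i \<in> {1..6}" "q' j \<in> {1..6}" using permutes_in_image q q' ij(1,2) by metis+
    show "q i \<noteq> q j" "q' i \<noteq> q' j" using ij(3) inj_eq[OF permutes_inj[OF q]] inj_eq[OF permutes_inj[OF q']] by simp_all
    have "syntheme (q i) (q j) \<circ> p = syntheme (q' i) (q' j) \<circ> p" using assms ij unfolding dual_def by metis
    then have "syntheme (q i) (q j) \<circ> p \<circ> inv' p = syntheme (q' i) (q' j) \<circ> p \<circ> inv' p" by simp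
    then have "syntheme (q i) (q j) = syntheme (q' i) (q' j)" by (simp only: comp_assoc permutes_inv_o(1)[OF p] comp_id)
    then show "syn (q i) (q j) x = syn (q' i) (q' j) x" if "x \<in> {1..6}" for x using that by (metis syntheme_def)
  qed
  have "q i = q' i" if i: "i \<in> {1..6}" for i
  proof -
    have "\<exists>j l. j \<in> {1..6} \<and> l \<in> {1..6} \<and> j \<noteq> i \<and> l \<noteq> i \<and> l \<noteq> j" unfolding atLeastAtMost_iff by presburger
    then obtain j l where j: "j \<in> {1..6}" "j \<noteq> i" and l: "l \<in> {1..6}" "l \<noteq> i" "l \<noteq> j" by blast
    have "q' j \<noteq> q' l" using l inj_eq[OF permutes_inj[OF q']] by simp
    then show ?thesis using pair[OF i j(1)] pair[OF i l(1)] j l by (metis doubleton_eq_iff)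
  qed
  then show ?thesis using permutes_not_in[OF q] permutes_not_in[OF q'] by (metis ext)
qed

definition outer :: "(nat \<Rightarrow> nat) \<Rightarrow> nat \<Rightarrow> nat" where
  "outer p = (THE q. dual p q)"

lemma outer_eq: "dual p q \<Longrightarrow> outer p = q"
  unfolding outer_def using dual_unique by blast

lemma ex_dual:
  assumes p: "p permutes {1..6}" shows "\<exists>q. dual p q"
  using p finite_atLeastAtMost
proof (induction p rule: permutes_induct)
  case id
  then show ?case using dual_id by blast
next
  case (swap a b p)
  then show ?case using dual_comp[OF dual_transpose(1)] by blast
qed

lemma ex_dual':
  assumes q: "q permutes {1..6}" shows "\<exists>p. dual p q"
  using q finite_atLeastAtMost
proof (induction q rule: permutes_induct)
  case id
  then show ?case using dual_id by blast
next
  case (swap a b q)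
  then show ?case using dual_comp[OF dual_transpose(2)] by blast
qed

lemma dual_outer: "p permutes {1..6} \<Longrightarrow> dual p (outer p)"
  using ex_dual outer_eq by metis

text \<open>Surjectivity comes from \<open>ex_dual'\<close>; injectivity follows by
  finiteness.\<close>

lemma outer_bij: "bij_betw outer {p. p permutes {1..6}} {p. p permutes {1..6}}"
proof -
  have onto: "outer ` {p. p permutes {1..6}} = {p. p permutes {1..6}}"
  proof (intro equalityI subsetI)
    fix q assume "q \<in> {p. p permutes {1..6::nat}}"
    then obtain p where "dual p q" using ex_dual' by blast
    then show "q \<in> outer ` {p. p permutes {1..6}}" using outer_eq by (auto simp: dual_def)
  qed (use dual_outer in \<open>auto simp: dual_def\<close>)
  moreover have "inj_on outer {p. p permutes {1..6}}"
    by (rule eq_card_imp_inj_on) (use finite_permutations[of "{1..6::nat}"] onto in auto)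
  ultimately show ?thesis by (simp add: bij_betw_def)
qed

lemma outer_comp: "p permutes {1..6} \<Longrightarrow> q permutes {1..6} \<Longrightarrow> outer (p \<circ> q) = outer p \<circ> outer q"
  by (intro outer_eq dual_comp dual_outer)

lemma bij_betw_lessThan_surj:
  assumes "bij_betw f {..<k} S" "x \<in> S"
  shows "\<exists>j<k::nat. f j = x"
proof -
  have "x \<in> f ` {..<k}" using assms by (simp add: bij_betw_def)
  then show ?thesis by auto
qed

text \<open>Replacing each character by its composite with \<phi> and each class by its preimage
  under \<phi> leaves all matrix entries unchanged.\<close>

lemma automorphism_table_data:
  assumes d: "table_data n X \<psi> C"
    and bij: "bij_betw \<phi> {p. p permutes {1..n}} {p. p permutes {1..n}}"
    and hom: "\<And>p q. p permutes {1..n} \<Longrightarrow> q permutes {1..n} \<Longrightarrow> \<phi> (p \<circ> q) = \<phi> p \<circ> \<phi> q"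
  shows "\<exists>\<psi>'. table_data n X \<psi>' (\<lambda>j. {g. g permutes {1..n} \<and> \<phi> g \<in> C j})"
proof -
  define k where "k = card (partitions_of n)"
  let ?P = "{p. p permutes {1..n}}" and ?C = "\<lambda>j. {g. g permutes {1..n} \<and> \<phi> g \<in> C j}"
  let ?Irr = "irreducible_characters (sym_group n)" and ?Cls = "conjugacy_classes (sym_group n)"
  have \<psi>: "bij_betw \<psi> {..<k} ?Irr" and C: "bij_betw C {..<k} ?Cls"
    and ent: "\<And>i j g. i < k \<Longrightarrow> j < k \<Longrightarrow> g \<in> C j \<Longrightarrow> X $$ (i, j) = \<psi> i g"
    using d by (auto simp: table_data_def k_def)
  have \<phi>P: "\<phi> p permutes {1..n}" if "p permutes {1..n}" for p using bij_betw_apply[OF bij, of p] that by simp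
  have onto: "\<exists>p. p permutes {1..n} \<and> \<phi> p = q" if "q permutes {1..n}" for q
  proof -
    have "q \<in> \<phi> ` ?P" unfolding bij_betw_imp_surj_on[OF bij] using that by simp
    then show ?thesis by blast
  qed
  have inj: "p = q" if "p permutes {1..n}" "q permutes {1..n}" "\<phi> p = \<phi> q" for p q
    using inj_onD[OF bij_betw_imp_inj_on[OF bij], of p q] that by simp
  have one: "\<phi> id = id"
  proof -
    have "\<phi> id \<circ> \<phi> id = \<phi> id" using hom[OF permutes_id permutes_id] by simp
    then have "inv' (\<phi> id) \<circ> (\<phi> id \<circ> \<phi> id) = inv' (\<phi> id) \<circ> \<phi> id" by simp
    then show ?thesis by (simp add: comp_assoc[symmetric] permutes_inv_o[OF \<phi>P[OF permutes_id]])
  qed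
  have inv: "\<phi> (inv' z) = inv' (\<phi> z)" if z: "z permutes {1..n}" for z
  proof -
    have "\<phi> z \<circ> \<phi> (inv' z) = id" "\<phi> (inv' z) \<circ> \<phi> z = id"
      using hom[OF z permutes_inv[OF z]] hom[OF permutes_inv[OF z] z] one permutes_inv_o[OF z] by simp_all
    then show ?thesis by (metis inv_unique_comp)
  qed
  have conj: "\<phi> (z \<circ> x \<circ> inv' z) = \<phi> z \<circ> \<phi> x \<circ> inv' (\<phi> z)" if "z permutes {1..n}" "x permutes {1..n}" for z x
    using that hom inv permutes_compose permutes_inv by metis
  have cls_eq: "{g. g permutes {1..n} \<and> \<phi> g \<in> cclass n (\<phi> y)} = cclass n y" if y: "y permutes {1..n}" for y
  proof (intro equalityI subsetI)
    fix g assume "g \<in> {g. g permutes {1..n} \<and> \<phi> g \<in> cclass n (\<phi> y)}"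
    then have g: "g permutes {1..n}" "\<phi> g \<in> cclass n (\<phi> y)" by auto
    obtain z where z: "z permutes {1..n}" "\<phi> g = z \<circ> \<phi> y \<circ> inv' z" using g(2) by (rule cclassE)
    obtain w where w: "w permutes {1..n}" "\<phi> w = z" using onto[OF z(1)] by blast
    have "\<phi> g = \<phi> (w \<circ> y \<circ> inv' w)" using conj[OF w(1) y] w(2) z(2) by simp
    moreover have "w \<circ> y \<circ> inv' w permutes {1..n}" using w(1) y by (intro permutes_compose permutes_inv)
    ultimately have "g = w \<circ> y \<circ> inv' w" using inj g(1) by blast
    then show "g \<in> cclass n y" using cclassI[OF w(1)] by simp
  next
    fix g assume g: "g \<in> cclass n y"
    then obtain w where w: "w permutes {1..n}" "g = w \<circ> y \<circ> inv' w" by (rule cclassE)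
    then have "\<phi> g \<in> cclass n (\<phi> y)" using conj[OF w(1) y] cclassI[OF \<phi>P[OF w(1)]] by simp
    then show "g \<in> {g. g permutes {1..n} \<and> \<phi> g \<in> cclass n (\<phi> y)}" using cclass_permutes[OF y g] by simp
  qed
  have Cls: "?C j \<in> ?Cls \<and> (\<exists>g. g permutes {1..n} \<and> C j = cclass n (\<phi> g) \<and> ?C j = cclass n g)" if j: "j < k" for j
  proof -
    have Cj: "C j \<in> ?Cls" using bij_betw_apply[OF C] j by simp
    then obtain h where h: "h \<in> C j" using class_nonempty by blast
    obtain g where g: "g permutes {1..n}" "\<phi> g = h" using onto[OF classD(1)[OF Cj h]] by blast
    have 1: "C j = cclass n (\<phi> g)" using classD(2)[OF Cj h] g(2) by simp
    have 2: "?C j = cclass n g" unfolding 1 by (rule cls_eq[OF g(1)])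
    have "cclass n g \<in> ?Cls" using g(1) by (auto simp: conjugacy_classes_sym)
    then show ?thesis using 1 2 g(1) by auto
  qed
  have "inj_on ?C {..<k}"
  proof (rule inj_onI)
    fix j j' assume j: "j \<in> {..<k}" "j' \<in> {..<k}" and eq: "?C j = ?C j'"
    obtain g where g: "g permutes {1..n}" "C j = cclass n (\<phi> g)" "?C j = cclass n g" using Cls[of j] j by blast
    then have "g \<in> ?C j'" using eq cclass_self by auto
    moreover have "C j' \<in> ?Cls" using bij_betw_apply[OF C] j by simp
    ultimately have "C j' = C j" using classD(2)[of "C j'" n "\<phi> g"] g(2) by simp
    then show "j = j'" using inj_onD[OF bij_betw_imp_inj_on[OF C]] j by metis
  qed
  moreover have "?C ` {..<k} = ?Cls"
  proof (rule card_subset_eq[OF finite_classes])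
    show "?C ` {..<k} \<subseteq> ?Cls" using Cls by blast
    show "card (?C ` {..<k}) = card ?Cls" using card_image[OF \<open>inj_on ?C {..<k}\<close>] bij_betw_same_card[OF C] by simp
  qed
  ultimately have bC: "bij_betw ?C {..<k} ?Cls" by (simp add: bij_betw_def)
  have "table_data n X (\<lambda>i. restrict (\<lambda>g. 1 * \<psi> i (\<phi> g)) (carrier (sym_group n))) ?C"
  proof (rule table_data_relabel[OF d])
    show "bij_betw ?C {..<card (partitions_of n)} ?Cls" using bC by (simp add: k_def)
    fix i assume i: "i < card (partitions_of n)"
    then have "\<psi> i \<in> ?Irr" using bij_betw_apply[OF \<psi>] by (simp add: k_def)
    then show "restrict (\<lambda>g. 1 * \<psi> i (\<phi> g)) (carrier (sym_group n)) \<in> ?Irr"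
      by (rule irreducible_character_twist) (use \<phi>P onto hom one in \<open>auto simp: sym_group_simps\<close>)
    fix j g assume "j < card (partitions_of n)" "g \<in> ?C j"
    then show "X $$ (i, j) = restrict (\<lambda>g. 1 * \<psi> i (\<phi> g)) (carrier (sym_group n)) g"
      using ent[of i j "\<phi> g"] i by (simp add: k_def sym_group_simps)
  qed
  then show ?thesis by blast
qed

text \<open>The column of the class of a syntheme becomes that of a transposition after pulling
  back; the types differ because only the transposition has fixed points.\<close>

lemma card_labellings_six:
  assumes stc: "same_type_conjugate 6" and X: "X \<in> carrier_mat (card (partitions_of 6)) (card (partitions_of 6))"
    and d: "table_data 6 X \<psi> C"
  shows "card (labellings 6 X) = 2"
proof -
  let ?C = "\<lambda>j. {g. g permutes {1..6} \<and> outer g \<in> C j}"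
  obtain \<psi>' where d': "table_data 6 X \<psi>' ?C" using automorphism_table_data[OF d outer_bij outer_comp] by blast
  let ?t = "transpose 1 (2::nat)" and ?s = "syntheme 1 2"
  have t: "?t permutes {1..6}" by (rule transpose_permutes) auto
  have s: "?s permutes {1..6}" by (rule syntheme_permutes) auto
  have ts: "outer ?t = ?s" by (rule outer_eq, rule dual_transpose) auto
  have C: "bij_betw C {..<card (partitions_of 6)} (conjugacy_classes (sym_group 6))"
    and C': "bij_betw ?C {..<card (partitions_of 6)} (conjugacy_classes (sym_group 6))" using d d' by (auto simp: table_data_def)
  have "cclass 6 ?s \<in> conjugacy_classes (sym_group 6)" using s by (auto simp: conjugacy_classes_sym)
  then obtain j where j: "j < card (partitions_of 6)" "C j = cclass 6 ?s"
    using bij_betw_lessThan_surj[OF C] by blast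
  have "?s \<in> C j" "?t \<in> ?C j" using j(2) cclass_self t ts by auto
  then have types: "class_type 6 (C j) = cycle_type 6 ?s" "class_type 6 (?C j) = cycle_type 6 ?t"
    using classD(3) bij_betw_apply[OF C] bij_betw_apply[OF C'] j(1) by auto
  have "cycles 6 ?s \<noteq> cycles 6 ?t"
  proof
    assume "cycles 6 ?s = cycles 6 ?t"
    then have "card {x\<in>{1..6}. ?s x = x} = card {x\<in>{1..6}. ?t x = x}" using count_fixed[OF s] count_fixed[OF t] by metis
    moreover have "{x\<in>{1..6}. ?s x = x} = {}" using syn_involution(2)[of 1 2] by (auto simp: syntheme_def)
    ultimately have "card {x\<in>{1..6}. ?t x = x} = 0" by (metis card.empty)
    then have "{x\<in>{1..6}. ?t x = x} = {}" by (subst (asm) card_0_eq) auto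
    moreover have "3 \<in> {x\<in>{1..6}. ?t x = x}" by (simp add: transpose_def)
    ultimately show False by blast
  qed
  then show ?thesis using types by (intro card_labellings_two_data[OF stc X _ d d' j(1)]) (auto simp: cycle_type_eq_iff)
qed

section \<open>The exceptional symmetry in degree four\<close>

text \<open>Cutting a cycle by a transposition flips the sign and adds one cycle, down to the
  identity with n cycles.\<close>

lemma sign_cycles: "p permutes {1..n} \<Longrightarrow> sign p = (- 1) ^ (n - size (cycles n p))"
proof (induction "n - size (cycles n p)" arbitrary: p rule: less_induct)
  case less
  note p = less.prems
  have perm: "permutation p" by (rule perm_p[OF p])
  show ?case
  proof (cases "\<exists>a. a \<in># cycles n p \<and> 2 \<le> a")
    case False
    then have c: "cycles n p = replicate_mset n 1" using parts_all_ones[OF cycles_parts[OF p]] by (meson not_le)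
    have "{x\<in>{1..n}. p x = x} = {1..n}"
      by (rule card_subset_eq) (use count_fixed[OF p] c in auto)
    then have "p x = x" for x using permutes_not_in[OF p, of x] by blast
    then have "p = id" by (simp add: fun_eq_iff)
    then show ?thesis using c by simp
  next
    case True
    then obtain a where a: "a \<in># cycles n p" "2 \<le> a" by blast
    obtain x where x: "x \<in> {1..n}" "card (orb p x) = a" using cycles_obtain[OF p a(1)] by blast
    let ?y = "(p ^^ 1) x" and ?q = "p \<circ> transpose x ((p ^^ 1) x)"
    have b: "0 < (1::nat)" "1 < card (orb p x)" using x a by auto
    note s = cycles_split[OF p x(1) b]
    have q: "?q permutes {1..n}" using p x(1) s(2) by (intro permutes_compose transpose_permutes)
    have sz: "size (cycles n ?q) = Suc (size (cycles n p))" using arg_cong[OF s(3), of size] by simp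
    have le: "size (cycles n ?q) \<le> n" by (rule size_parts[OF cycles_parts[OF q]])
    have "sign ?q = (- 1) ^ (n - size (cycles n ?q))" by (rule less.hyps[OF _ q]) (use sz le in linarith)
    moreover have "sign ?q = - sign p" using s(1) perm by (simp add: sign_compose permutation_swap_id sign_swap_id)
    moreover have "n - size (cycles n p) = Suc (n - size (cycles n ?q))" using sz le by simp
    ultimately show ?thesis by simp
  qed
qed

text \<open>By \<open>sign_cycles\<close> an odd permutation of four points has one or three
  cycles.\<close>

lemma odd_in_four:
  assumes g: "g permutes {1..4}" and s: "sign g = -1" and t: "t \<in> transp 4"
  shows "cycles 4 g = cycles 4 t \<or> cycles 4 g = {#4#}"
proof -
  let ?M = "cycles 4 g"
  have P: "?M \<in> parts 4" by (rule cycles_parts[OF g])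
  then have sum: "sum_mset ?M = 4" by (simp add: parts_def)
  have "size ?M \<le> 4" by (rule size_parts[OF P])
  have "odd (4 - size ?M)" using s unfolding sign_cycles[OF g] by (cases "even (4 - size ?M)") auto
  moreover have "odd (4 - m) \<Longrightarrow> m \<le> 4 \<Longrightarrow> m = 1 \<or> m = 3" for m :: nat by presburger
  ultimately have "size ?M = 1 \<or> size ?M = 3" using \<open>size ?M \<le> 4\<close> by blast
  then show ?thesis
  proof
    assume "size ?M = 1"
    then obtain a where "?M = {#a#}" using size_1_singleton_mset by blast
    then show ?thesis using sum by simp
  next
    assume sz: "size ?M = 3"
    have "\<exists>a. a \<in># ?M \<and> 2 \<le> a"
    proof (rule ccontr)
      assume "\<not> ?thesis"
      then have "?M = replicate_mset 4 1" using parts_all_ones[OF P] by (meson not_le)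
      then show False using sz by simp
    qed
    then obtain a M0 where a: "2 \<le> a" "?M = add_mset a M0" by (metis mset_add)
    have M0: "M0 \<in> parts (4 - a)" "size M0 = 2" using P a sz by (auto simp: parts_def)
    then have "2 \<le> 4 - a" using size_parts by metis
    then have "a = 2" using a(1) by linarith
    then have P2: "M0 \<in> parts 2" using M0 by simp
    have "M0 = replicate_mset 2 1"
    proof (rule parts_all_ones[OF P2], rule ccontr)
      fix b assume b: "b \<in># M0" "\<not> b < 2"
      then obtain M1 where M1: "M0 = add_mset b M1" by (metis mset_add)
      then have "M1 \<in> parts (2 - b)" "size M1 = 1" using P2 M0(2) by (auto simp: parts_def)
      then show False using size_parts[of M1 "2 - b"] b(2) by simp
    qed
    then have "?M + {#1, 1#} = replicate_mset 4 1 + {#2#}" using a(2) \<open>a = 2\<close> by (simp add: numeral_eq_Suc)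
    then have "?M = cycles 4 t" using cycles_transp[OF t] by (metis add_right_imp_eq)
    then show ?thesis ..
  qed
qed

text \<open>\<open>d1\<close>, \<open>d2\<close> and \<open>d3\<close> are the nontrivial elements
  of the normal Klein four-group.\<close>

definition d1 :: "nat \<Rightarrow> nat" where "d1 = transpose 1 2 \<circ> transpose 3 4"
definition d2 :: "nat \<Rightarrow> nat" where "d2 = transpose 1 3 \<circ> transpose 2 4"
definition d3 :: "nat \<Rightarrow> nat" where "d3 = transpose 1 4 \<circ> transpose 2 3"

lemma four: "{1..4::nat} = {1, 2, 3, 4}"
  by auto

lemma d_val:
  "d1 1 = 2" "d1 2 = 1" "d1 3 = 4" "d1 4 = 3" "d2 1 = 3" "d2 2 = 4" "d2 3 = 1" "d2 4 = 2"
  "d3 1 = 4" "d3 2 = 3" "d3 3 = 2" "d3 4 = 1" "d1 (Suc 0) = 2" "d2 (Suc 0) = 3" "d3 (Suc 0) = 4"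
  by (simp_all add: d1_def d2_def d3_def transpose_def)

lemma d_permutes: "d1 permutes {1..4}" "d2 permutes {1..4}" "d3 permutes {1..4}"
  unfolding d1_def d2_def d3_def by (intro permutes_compose transpose_permutes; simp)+

lemma eq_on_four:
  assumes "p permutes {1..4::nat}" "q permutes {1..4}" "p 1 = q 1" "p 2 = q 2" "p 3 = q 3" "p 4 = q 4"
  shows "p = q"
proof
  fix x
  show "p x = q x"
  proof (cases "x \<in> {1..4}")
    case True
    then have "x = 1 \<or> x = 2 \<or> x = 3 \<or> x = 4" unfolding four by blast
    then show ?thesis using assms(3-6) by blast
  next
    case False
    then show ?thesis using permutes_not_in[OF assms(1)] permutes_not_in[OF assms(2)] by simp
  qed
qed

lemma d_mult: "d1 \<circ> d1 = id" "d1 \<circ> d2 = d3" "d1 \<circ> d3 = d2"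
  by (rule eq_on_four; (intro permutes_compose d_permutes permutes_id)?; simp add: d_val)+

lemma d_distinct: "d1 \<noteq> d2" "d1 \<noteq> d3" "d2 \<noteq> d3"
  using d_val by (metis numeral_eq_iff semiring_norm(87) semiring_norm(88) semiring_norm(89) numeral_eq_one_iff)+

lemma d_involution: "d \<in> {d1, d2, d3} \<Longrightarrow> x \<in> {1..4} \<Longrightarrow> d x \<noteq> x \<and> d (d x) = x"
  unfolding four by (auto simp: d_val)

lemma involution_in_four:
  assumes s: "s permutes {1..4}" and inv: "\<And>x. x \<in> {1..4} \<Longrightarrow> s x \<noteq> x \<and> s (s x) = x"
  shows "s \<in> {d1, d2, d3}"
proof -
  have mem: "s x \<in> {1, 2, 3, 4}" if "x \<in> {1..4}" for x using permutes_in_image[OF s, of x] that four by blast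
  have I: "s 1 \<noteq> 1" "s 2 \<noteq> 2" "s 3 \<noteq> 3" "s 4 \<noteq> 4" "s (s 1) = 1" "s (s 2) = 2" "s (s 3) = 3" "s (s 4) = 4" using inv by auto
  have inj: "s x = s y \<longleftrightarrow> x = y" for x y by (rule inj_eq[OF permutes_inj[OF s]])
  consider "s 1 = 2" | "s 1 = 3" | "s 1 = 4" using mem[of 1] I(1) by auto
  then show ?thesis
  proof cases
    case 1
    then have "s 2 = 1" using I by simp
    then have "s 3 = 4" using mem[of 3] I(3) inj[of 3 1] inj[of 3 2] 1 by auto
    then have "s 4 = 3" using I by metis
    then have "s = d1" using 1 \<open>s 2 = 1\<close> \<open>s 3 = 4\<close> by (intro eq_on_four[OF s d_permutes(1)]) (simp_all add: d_val)
    then show ?thesis by simp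
  next
    case 2
    then have "s 3 = 1" using I by simp
    then have "s 2 = 4" using mem[of 2] I(2) inj[of 2 1] inj[of 2 3] 2 by auto
    then have "s 4 = 2" using I by metis
    then have "s = d2" using 2 \<open>s 3 = 1\<close> \<open>s 2 = 4\<close> by (intro eq_on_four[OF s d_permutes(2)]) (simp_all add: d_val)
    then show ?thesis by simp
  next
    case 3
    then have "s 4 = 1" using I by simp
    then have "s 2 = 3" using mem[of 2] I(2) inj[of 2 1] inj[of 2 4] 3 by auto
    then have "s 3 = 2" using I by metis
    then have "s = d3" using 3 \<open>s 4 = 1\<close> \<open>s 2 = 3\<close> by (intro eq_on_four[OF s d_permutes(3)]) (simp_all add: d_val)
    then show ?thesis by simp
  qed
qed

lemma d_cycles: "d \<in> {d1, d2, d3} \<Longrightarrow> cycles 4 d = cycles 4 d1"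
proof -
  have "cycles 4 e = replicate_mset 2 2" if "e \<in> {d1, d2, d3}" for e
  proof -
    have "e permutes {1..4}" using that d_permutes by blast
    then have "\<exists>m. 4 = 2 * m \<and> cycles 4 e = replicate_mset m 2"
      using fixed_point_free_involution[of e 4] d_involution[OF that] by blast
    then obtain m where "4 = 2 * m" "cycles 4 e = replicate_mset m 2" by blast
    moreover from this have "m = 2" by simp
    ultimately show ?thesis by simp
  qed
  then show "d \<in> {d1, d2, d3} \<Longrightarrow> cycles 4 d = cycles 4 d1" by simp
qed

text \<open>
  The double transpositions \<open>d\<^sub>1, d\<^sub>2, d\<^sub>3\<close> form a class which multiplies a transposition into one
  transposition and two four-cycles, and one of its own members into the identity and the other two.
  Hence \<open>r = \<chi> d\<^sub>1 / \<chi> 1\<close> satisfies \<open>3 r\<^sup>2 = 1 + 2 r\<close>, and a four-cycle has the value \<open>\<plusminus>\<close> that of a transposition.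
\<close>

lemma four_cycle_value:
  assumes stc: "same_type_conjugate 4" and \<mu>: "\<mu> \<in> partitions_of 4"
    and t: "t \<in> transp 4" and f: "f permutes {1..4}" "cycles 4 f = {#4#}"
  shows "specht_character \<mu> f = specht_character \<mu> t \<or> specht_character \<mu> f = - specht_character \<mu> t"
proof -
  interpret same_type_conjugate 4 by (rule stc)
  let ?\<chi> = "specht_character \<mu>" and ?P = "{z. z permutes {1..4::nat}}"
  let ?D = "{d1, d2, d3}" and ?g = "\<lambda>z. z \<circ> d1 \<circ> inv' z"
  have image: "?g ` ?P = ?D"
  proof (intro equalityI subsetI)
    fix s assume "s \<in> ?g ` ?P"
    then obtain z where z: "z permutes {1..4}" "s = z \<circ> d1 \<circ> inv' z" by blast
    have s: "s permutes {1..4}" unfolding z(2) using z(1) d_permutes(1) by (intro permutes_compose permutes_inv)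
    show "s \<in> ?D"
    proof (rule involution_in_four[OF s])
      fix x :: nat assume x: "x \<in> {1..4}"
      define y where "y = inv' z x"
      have xy: "x = z y" using permutes_inverses(1)[OF z(1)] by (simp add: y_def)
      have y: "y \<in> {1..4}" using x permutes_in_image[OF permutes_inv[OF z(1)]] by (simp add: y_def)
      have sz: "s (z v) = z (d1 v)" for v using permutes_inverses(2)[OF z(1)] by (simp add: z(2))
      show "s x \<noteq> x \<and> s (s x) = x" unfolding xy sz using d_involution[of d1 y] y inj_eq[OF permutes_inj[OF z(1)]] by simp
    qed
  next
    fix s assume s: "s \<in> ?D"
    then have "s permutes {1..4}" using d_permutes by blast
    then show "s \<in> ?g ` ?P" using conj[OF d_permutes(1) _ d_cycles[OF s, symmetric]] by blast
  qed
  define c where "c = card {z. z permutes {1..4::nat} \<and> ?g z = d1}"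
  have fib: "card {z\<in>?P. ?g z = s} = c" if "s \<in> ?D" for s
  proof -
    have "s \<in> ?g ` ?P" unfolding image by (rule that)
    then obtain w where w: "w permutes {1..4}" "s = w \<circ> d1 \<circ> inv' w" by blast
    show ?thesis unfolding w(2) c_def using card_conjugators[OF w(1), of d1] by simp
  qed
  \<comment> \<open>Each of the three conjugates of \<open>d1\<close> is reached by c elements z, so
    sums over z reduce to three terms; with the constant function 1 this gives 24 = 3 c.\<close>
  have sum_D: "(\<Sum>z\<in>?P. F (?g z)) = of_nat c * (F d1 + F d2 + F d3)" for F :: "(nat \<Rightarrow> nat) \<Rightarrow> complex"
  proof -
    have "(\<Sum>z\<in>?P. F (?g z)) = (\<Sum>s\<in>?g ` ?P. \<Sum>z | z \<in> ?P \<and> ?g z = s. F (?g z))"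
      by (rule sum.image_gen) (simp add: finite_permutations)
    also have "\<dots> = (\<Sum>s\<in>?D. of_nat c * F s)" unfolding image
      by (intro sum.cong refl) (use fib in simp)
    finally show ?thesis using d_distinct by (simp add: algebra_simps)
  qed
  have "of_nat (card ?P) = (of_nat c * 3 :: complex)" using sum_D[of "\<lambda>_. 1"] by simp
  then have c3: "(fact 4 :: complex) = of_nat c * 3" using card_permutations[of "{1..4::nat}" 4] by simp
  have c0: "(of_nat c :: complex) \<noteq> 0" using c3 by (metis fact_nonzero mult_zero_left)
  have tp: "t permutes {1..4}" by (rule transp_permutes[OF t])
  let ?t = "transpose 1 (2::nat)"
  have t1: "?t \<in> transp 4" by (rule transpI) auto
  have t1p: "?t permutes {1..4}" by (rule transp_permutes[OF t1])
  obtain d where d: "d > 0" "?\<chi> id = of_nat d" using specht_id[OF \<mu>] by blast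
  define a b e where "a = ?\<chi> ?t" and "b = ?\<chi> f" and "e = ?\<chi> d1"
  have e: "?\<chi> x = e" if "x \<in> ?D" for x
    unfolding e_def using specht_same_type[OF \<mu> _ d_permutes(1) d_cycles[OF that]] d_permutes that by blast
  have td1: "?\<chi> (?t \<circ> d1) = a"
  proof -
    have "?t \<circ> d1 = transpose 3 4" by (simp add: d1_def fun_eq_iff)
    moreover have "transpose 3 (4::nat) \<in> transp 4" by (rule transpI) auto
    ultimately show ?thesis unfolding a_def using cycles_transp_iff[OF t1] transp_permutes specht_same_type[OF \<mu> _ t1p] by metis
  qed
  \<comment> \<open>These products are odd and without fixed points, hence four-cycles.\<close>
  have td: "?\<chi> (?t \<circ> x) = b" if "x = d2 \<or> x = d3" for x
  proof -
    have xp: "x permutes {1..4}" using that d_permutes by blast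
    have p: "?t \<circ> x permutes {1..4}" using t1p xp by (rule permutes_compose[rotated])
    have "sign x = 1" using that unfolding d2_def d3_def by (auto simp: sign_compose permutation_swap_id sign_swap_id)
    then have "sign (?t \<circ> x) = -1"
      using perm_p[OF xp] by (simp add: sign_compose permutation_swap_id sign_swap_id)
    moreover have "cycles 4 (?t \<circ> x) \<noteq> cycles 4 ?t"
    proof
      assume "cycles 4 (?t \<circ> x) = cycles 4 ?t"
      then have "card {y\<in>{1..4}. (?t \<circ> x) y = y} = card {y\<in>{1..4}. ?t y = y}" using count_fixed[OF p] count_fixed[OF t1p] by metis
      moreover have "{y\<in>{1..4}. (?t \<circ> x) y = y} = {}" using that unfolding four by (auto simp: d_val transpose_def)
      moreover have "{y\<in>{1..4}. ?t y = y} = {3, 4}" unfolding four by (auto simp: transpose_def)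
      ultimately have "card {3, 4 :: nat} = card ({} :: nat set)" by metis
      then show False by simp
    qed
    ultimately have "cycles 4 (?t \<circ> x) = cycles 4 f" using odd_in_four[OF p _ t1] f(2) by simp
    then show ?thesis unfolding b_def by (rule specht_same_type[OF \<mu> p f(1)])
  qed
  have "of_nat c * (a + b + b) = fact 4 * a * e / of_nat d"
    using specht_conjugate_average[OF \<mu> t1p d_permutes(1)] sum_D[of "\<lambda>s. ?\<chi> (?t \<circ> s)"] td1 td d(2)
    by (simp add: a_def e_def)
  then have "of_nat c * (a + b + b) * of_nat d = of_nat c * 3 * a * e" unfolding c3 using d(1) by (simp add: nonzero_eq_divide_eq)
  moreover have "of_nat c * (a + b + b) * of_nat d = of_nat c * ((a + 2 * b) * of_nat d)" by (simp add: algebra_simps)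
  ultimately have "of_nat c * ((a + 2 * b) * of_nat d) = of_nat c * (3 * a * e)" by (simp only: mult.assoc)
  then have 1: "(a + 2 * b) * of_nat d = 3 * a * e" unfolding mult_left_cancel[OF c0] .
  have "of_nat c * (of_nat d + e + e) = fact 4 * e * e / of_nat d"
  proof -
    have v: "?\<chi> (d1 \<circ> d1) = of_nat d" "?\<chi> (d1 \<circ> d2) = e" "?\<chi> (d1 \<circ> d3) = e" "?\<chi> d1 = e"
      unfolding d_mult using d(2) e[of d1] e[of d2] e[of d3] by simp_all
    show ?thesis
      using specht_conjugate_average[OF \<mu> d_permutes(1) d_permutes(1)]
      unfolding sum_D[of "\<lambda>s. ?\<chi> (d1 \<circ> s)"] v d(2) .
  qed
  then have "of_nat c * (of_nat d + e + e) * of_nat d = of_nat c * 3 * e * e" unfolding c3 using d(1) by (simp add: nonzero_eq_divide_eq)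
  moreover have "of_nat c * (of_nat d + e + e) * of_nat d = of_nat c * ((of_nat d + 2 * e) * of_nat d)" by (simp add: algebra_simps)
  ultimately have "of_nat c * ((of_nat d + 2 * e) * of_nat d) = of_nat c * (3 * e * e)" by (simp only: mult.assoc)
  then have 2: "(of_nat d + 2 * e) * of_nat d = 3 * e * e" unfolding mult_left_cancel[OF c0] .
  \<comment> \<open>The quadratic equation factors. Its root e = d turns the linear relation between
    a and b into b = a, the root e = -d/3 turns it into b = -a.\<close>
  have "(e - of_nat d) * (3 * e + of_nat d) = 0" using 2 by (simp add: algebra_simps)
  then consider "e = of_nat d" | "3 * e = - of_nat d" by (auto simp: eq_neg_iff_add_eq_0)
  then have "b = a \<or> b = - a"
  proof cases
    case e1: 1
    have "(2 * b - 2 * a) * of_nat d = 0" using 1 unfolding e1 by (simp add: algebra_simps)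
    then show ?thesis using d(1) by simp
  next
    case e2: 2
    have "(a + 2 * b) * of_nat d = a * (3 * e)" using 1 by (simp add: mult_ac)
    then have "(2 * b + 2 * a) * of_nat d = 0" unfolding e2 by (simp add: algebra_simps)
    then have "2 * (b + a) = 0" using d(1) by simp
    then have "b + a = 0" by (metis mult_eq_0_iff zero_neq_numeral)
    then show ?thesis by (simp add: eq_neg_iff_add_eq_0)
  qed
  moreover have "?\<chi> t = a" unfolding a_def using specht_same_type[OF \<mu> tp t1p] cycles_transp_iff[OF t1 tp] t by blast
  ultimately show ?thesis by (simp add: b_def)
qed

text \<open>The second ordering exchanges the classes of transpositions and four-cycles. This is not
  induced by an automorphism: the rows are repaired individually, by twisting with the sign those
  whose values on the two classes differ.\<close>

lemma card_labellings_four: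
  assumes stc: "same_type_conjugate 4" and X: "X \<in> carrier_mat (card (partitions_of 4)) (card (partitions_of 4))"
    and d: "table_data 4 X \<psi> C"
  shows "card (labellings 4 X) = 2"
proof -
  interpret same_type_conjugate 4 by (rule stc)
  define k where "k = card (partitions_of 4)"
  let ?Irr = "irreducible_characters (sym_group 4)" and ?Cls = "conjugacy_classes (sym_group 4)"
  have \<psi>: "bij_betw \<psi> {..<k} ?Irr" and C: "bij_betw C {..<k} ?Cls"
    and ent: "\<And>i j g. i < k \<Longrightarrow> j < k \<Longrightarrow> g \<in> C j \<Longrightarrow> X $$ (i, j) = \<psi> i g"
    using d by (auto simp: table_data_def k_def)
  obtain \<alpha> where lab: "(\<alpha>, \<lambda>j\<in>{..<k}. class_type 4 (C j)) \<in> labellings 4 X"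
    and val: "\<And>i g. i < k \<Longrightarrow> g permutes {1..4} \<Longrightarrow> \<psi> i g = specht_character (\<alpha> i) g"
    using table_data_labelling[OF d X] unfolding k_def by blast
  have \<alpha>: "\<alpha> i \<in> partitions_of 4" if "i < k" for i
    using lab X that bij_betw_apply[of \<alpha> "{..<k}"] by (auto simp: labellings_def k_def)
  define t where "t = transpose 1 (2::nat)"
  have t: "t \<in> transp 4" unfolding t_def by (rule transpI) auto
  have tp: "t permutes {1..4}" by (rule transp_permutes[OF t])
  obtain f where f: "f permutes {1..4}" "cycles 4 f = {#4#}" using ex_cycles[of "{#4#}" 4] by (auto simp: parts_def)
  have "size (cycles 4 t) = 3" using arg_cong[OF cycles_transp[OF t], of size] by simp
  then have tf: "cycles 4 t \<noteq> cycles 4 f" using f(2) by auto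
  have mem_class: "g \<in> cclass 4 x" if "g permutes {1..4}" "x permutes {1..4}" "cycles 4 g = cycles 4 x" for g x
    using conj[OF that(2,1) that(3)[symmetric]] cclassI by metis
  have ne: "cclass 4 t \<noteq> cclass 4 f" using tf cclass_self cclass_cycles[OF f(1)] by metis
  have in_Cls: "cclass 4 t \<in> ?Cls" "cclass 4 f \<in> ?Cls" using tp f(1) by (auto simp: conjugacy_classes_sym)
  define sw where "sw K = (if K = cclass 4 t then cclass 4 f else if K = cclass 4 f then cclass 4 t else K)" for K
  have "bij_betw sw ?Cls ?Cls" by (rule bij_betwI[of _ _ _ sw]) (use in_Cls in \<open>auto simp: sw_def\<close>)
  then have C': "bij_betw (\<lambda>j. sw (C j)) {..<k} ?Cls" using bij_betw_trans[OF C] by (simp add: comp_def)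
  \<comment> \<open>If the values differ they are opposite, and both classes are odd, so the sign
    twist exchanges them.\<close>
  define c where "c i g = (if \<psi> i f = \<psi> i t then 1 else of_int (sign g) :: complex)" for i and g :: "nat \<Rightarrow> nat"
  define \<psi>' where "\<psi>' i = restrict (\<lambda>g. c i g * \<psi> i g) (carrier (sym_group 4))" for i
  have \<psi>': "\<psi>' i \<in> ?Irr" if "i < k" for i
    unfolding \<psi>'_def
  proof (rule irreducible_character_twist[where f = "\<lambda>g. g" and c = "c i"])
    show "\<psi> i \<in> ?Irr" using bij_betw_apply[OF \<psi>] that by simp
    show "c i (g \<otimes>\<^bsub>sym_group 4\<^esub> h) = c i g * c i h" if "g \<in> carrier (sym_group 4)" "h \<in> carrier (sym_group 4)" for g h
      using that perm_p[of g 4] perm_p[of h 4] by (simp add: c_def sym_group_simps sign_compose)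
  qed (auto simp: c_def sym_group_simps)
  have ft: "\<psi> i f = \<psi> i t \<or> \<psi> i f = - \<psi> i t" if "i < k" for i
    using four_cycle_value[OF stc \<alpha>[OF that] t f] val[OF that] f(1) tp by simp
  have same: "\<psi> i g = \<psi> i x" if "i < k" "x permutes {1..4}" "g \<in> cclass 4 x" for i g x
    using specht_same_type[OF \<alpha>[OF that(1)] _ that(2) cclass_cycles[OF that(2,3)]] val[OF that(1)] cclass_permutes[OF that(2,3)] that(2) by simp
  have sgn: "sign g = -1" if "g \<in> cclass 4 t \<or> g \<in> cclass 4 f" for g
  proof -
    have "sign t = -1" by (simp add: t_def sign_swap_id)
    moreover have "sign f = -1" using sign_cycles[OF f(1)] f(2) by simp
    moreover have "sign g = sign t \<or> sign g = sign f"
      using that sign_cycles cclass_cycles cclass_permutes tp f(1) by metis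
    ultimately show ?thesis by auto
  qed
  have \<psi>'_val: "\<psi>' i g = c i g * \<psi> i g" if "g permutes {1..4}" for i g using that by (simp add: \<psi>'_def sym_group_simps)
  have "table_data 4 X \<psi>' (\<lambda>j. sw (C j))"
  proof (rule table_data_relabel[OF d])
    show "bij_betw (\<lambda>j. sw (C j)) {..<card (partitions_of 4)} ?Cls" using C' by (simp add: k_def)
    fix i assume "i < card (partitions_of 4)"
    then have i: "i < k" by (simp add: k_def)
    then show "\<psi>' i \<in> ?Irr" by (rule \<psi>')
    fix j g assume "j < card (partitions_of 4)" and g: "g \<in> sw (C j)"
    then have j: "j < k" by (simp add: k_def)
    have Cj: "C j \<in> ?Cls" using bij_betw_apply[OF C] j by simp
    consider "C j = cclass 4 t" | "C j = cclass 4 f" | "C j \<noteq> cclass 4 t" "C j \<noteq> cclass 4 f" by blast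
    then show "X $$ (i, j) = \<psi>' i g"
    proof cases
      case 1
      then have gf: "g \<in> cclass 4 f" using g by (simp add: sw_def)
      have "X $$ (i, j) = \<psi> i t" using ent[OF i j] 1 cclass_self by simp
      moreover have "\<psi>' i g = c i g * \<psi> i f" using \<psi>'_val[OF cclass_permutes[OF f(1) gf]] same[OF i f(1) gf] by simp
      ultimately show ?thesis using ft[OF i] sgn[of g] gf by (auto simp: c_def)
    next
      case 2
      then have gt: "g \<in> cclass 4 t" using g ne by (simp add: sw_def)
      have "X $$ (i, j) = \<psi> i f" using ent[OF i j] 2 cclass_self by simp
      moreover have "\<psi>' i g = c i g * \<psi> i t" using \<psi>'_val[OF cclass_permutes[OF tp gt]] same[OF i tp gt] by simp
      ultimately show ?thesis using ft[OF i] sgn[of g] gt by (auto simp: c_def)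
    next
      case 3
      then have gC: "g \<in> C j" using g by (simp add: sw_def)
      have gp: "g permutes {1..4}" by (rule classD(1)[OF Cj gC])
      \<comment> \<open>All other classes are even, so the twist leaves their entries alone.\<close>
      have "sign g \<noteq> -1"
      proof
        assume "sign g = -1"
        then have "g \<in> cclass 4 t \<or> g \<in> cclass 4 f"
          using odd_in_four[OF gp _ t] mem_class[OF gp tp] mem_class[OF gp f(1)] f(2) by auto
        then show False using classD(2)[OF Cj gC] cclass_eq 3 by metis
      qed
      then have "sign g = 1" using sign_cases[of g] by auto
      then show ?thesis using ent[OF i j gC] \<psi>'_val[OF gp] by (simp add: c_def)
    qed
  qed
  moreover obtain j where j: "j < k" "C j = cclass 4 t" using bij_betw_lessThan_surj[OF C in_Cls(1)] by blast
  moreover have "class_type 4 (C j) \<noteq> class_type 4 (sw (C j))"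
  proof -
    have "sw (C j) = cclass 4 f" using j(2) by (simp add: sw_def)
    then show ?thesis using classD(3)[OF in_Cls(1) cclass_self] classD(3)[OF in_Cls(2) cclass_self] j(2) tf cycle_type_eq_iff by simp
  qed
  ultimately show ?thesis using card_labellings_two_data[OF stc X _ d] by (simp add: k_def)
qed

theorem theorem1p1:
  fixes n :: nat and X :: "complex mat"
  assumes "n \<ge> 1"
    and "X \<in> carrier_mat (card (partitions_of n)) (card (partitions_of n))"
    and "is_character_table (sym_group n) X"
  shows "(n \<noteq> 4 \<and> n \<noteq> 6 \<longrightarrow> (\<exists>!L. L \<in> labellings n X)) \<and>
         (n = 4 \<or> n = 6 \<longrightarrow> card (labellings n X) = 2)"
proof -
  note X = assms(2)
  obtain \<psi> C where d: "table_data n X \<psi> C"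
    using assms(3) X unfolding is_character_table_def table_data_def by auto
  have "card (conjugacy_classes (sym_group n)) = card (partitions_of n)"
    using d bij_betw_same_card by (fastforce simp: table_data_def)
  then have stc: "same_type_conjugate n" by (rule same_type_conjugate_if_card)
  obtain L where "L \<in> labellings n X" using table_data_labelling[OF d X] by blast
  then have "\<exists>!L. L \<in> labellings n X" if "n \<noteq> 4" "n \<noteq> 6" using labelling_unique[OF stc X _ _ assms(1) that] by blast
  moreover have "card (labellings n X) = 2" if "n = 4 \<or> n = 6"
    using that card_labellings_four[of X \<psi> C] card_labellings_six[of X \<psi> C] stc X d by blast
  ultimately show ?thesis by blast
qed

end
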